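(* Let $\mu\in\mathcal P(\mathbb{R}^n\times\mathbb{R}^n)$ be a closed probability measure. Then there exists a probability measure $\vartheta$ on $\mathcal C(\mathbb{R},\mathbb{R}^n)$ such that: (i) $\vartheta$ is $\Theta$-invariant, i.e. $\vartheta=\vartheta\circ\Theta_t^{-1}$ for every $t\in\mathbb{R}$, where $\Theta_t(\gamma)=\gamma(t+\cdot)$; (ii) $\vartheta$-almost every curve $\gamma$ is Lipschitz continuous and differentiable at $0$; (iii) for every bounded measurable $\varphi:\mathbb{R}^n\times\mathbb{R}^n\to\mathbb{R}$, $$\int\varphi(x,v_\mu(x))\,d(\pi_*\mu)(x)=\int\varphi(\gamma(0),\gamma'(0))\,d\vartheta(\gamma).$$ Moreover, $\vartheta$-almost every $\gamma$ satisfies $\gamma'(t)=v_\mu(\gamma(t))$ for almost every $t\in\mathbb{R}$.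
   Context: $\mathcal C(\mathbb{R},\mathbb{R}^n)$ is the space of continuous curves with the topology of uniform convergence on compact intervals, and $\mathcal P(E)$ denotes Borel probability measures on $E$. Let $\pi:\mathbb{R}^n\times\mathbb{R}^n\to\mathbb{R}^n$, $\pi(x,v)=x$, and $\pi_*\mu$ the pushforward. For $\mu\in\mathcal P(\mathbb{R}^n\times\mathbb{R}^n)$, write its disintegration $\mu=\int\mu_x\,d(\pi_*\mu)(x)$ with $\mu_x$ probability measures on $\mathbb{R}^n$ (so $\int\varphi\,d\mu=\int\int\varphi(x,v)\,d\mu_x(v)\,d\pi_*\mu(x)$ for bounded continuous $\varphi$), and define the centroid field $v_\mu(x)=\int v\,d\mu_x(v)$. A compactly supported $\mu\in\mathcal P(\mathbb{R}^n\times\mathbb{R}^n)$ is closed if $\int\langle\nabla g(x),v\rangle\,d\mu(x,v)=0$ for every $g\in\mathcal C^\infty(\mathbb{R}^n,\mathbb{R})$. *)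

theory Defs
  imports "HOL-Analysis.Analysis" "HOL-Probability.Probability"
begin

(* C^\<infinity> functions R^n -> R: all iterated partial derivatives exist and every one of
   them is (Frechet) differentiable everywhere. D xs is the iterated partial derivative
   along the basis directions listed in xs (innermost first = last element). *)
definition smooth_fun :: "('a::euclidean_space \<Rightarrow> real) \<Rightarrow> bool" where
  "smooth_fun g \<longleftrightarrow> (\<exists>D :: 'a list \<Rightarrow> 'a \<Rightarrow> real. D [] = g \<and>
     (\<forall>xs x. (D xs has_derivative (\<lambda>h. \<Sum>b\<in>Basis. (h \<bullet> b) * D (b # xs) x)) (at x)))"

definition compactly_supported_prob :: "('a::euclidean_space \<times> 'a) measure \<Rightarrow> bool" where
  "compactly_supported_prob \<mu> \<longleftrightarrow> prob_space \<mu> \<and> sets \<mu> = sets borel \<and>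
     (\<exists>K. compact K \<and> K \<in> sets \<mu> \<and> emeasure \<mu> K = 1)"

definition closed_measure :: "('a::euclidean_space \<times> 'a) measure \<Rightarrow> bool" where
  "closed_measure \<mu> \<longleftrightarrow> compactly_supported_prob \<mu> \<and>
     (\<forall>g. smooth_fun g \<longrightarrow> (\<integral>z. frechet_derivative g (at (fst z)) (snd z) \<partial>\<mu>) = 0)"

definition proj_measure :: "('a::euclidean_space \<times> 'a) measure \<Rightarrow> 'a measure" where
  "proj_measure \<mu> = distr \<mu> borel fst"

definition disintegration :: "('a::euclidean_space \<times> 'a) measure \<Rightarrow> ('a \<Rightarrow> 'a measure) \<Rightarrow> bool" where
  "disintegration \<mu> K \<longleftrightarrow> K \<in> borel \<rightarrow>\<^sub>M prob_algebra borel \<and>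
     (\<forall>\<phi> :: 'a \<times> 'a \<Rightarrow> real. continuous_on UNIV \<phi> \<and> bounded (range \<phi>) \<longrightarrow>
        (\<integral>z. \<phi> z \<partial>\<mu>) = (\<integral>x. (\<integral>v. \<phi> (x, v) \<partial>K x) \<partial>proj_measure \<mu>))"

definition centroid :: "('a::euclidean_space \<Rightarrow> 'a measure) \<Rightarrow> 'a \<Rightarrow> 'a" where
  "centroid K x = (\<integral>v. v \<partial>K x)"

(* C(R,R^n) with the Borel sigma-algebra of the topology of local uniform convergence,
   which coincides with the sigma-algebra generated by the evaluation maps *)
definition curve_space :: "(real \<Rightarrow> 'a::euclidean_space) measure" where
  "curve_space = restrict_space (Pi\<^sub>M UNIV (\<lambda>_. borel)) {\<gamma>. continuous_on UNIV \<gamma>}"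

definition shift :: "real \<Rightarrow> (real \<Rightarrow> 'a) \<Rightarrow> real \<Rightarrow> 'a" where
  "shift t \<gamma> = (\<lambda>s. \<gamma> (t + s))"

end

theory Submission
  imports Defs
begin

text \<open>
  Write \<open>m\<close> for the projected measure and \<open>b\<close> for the centroid field; closedness says that \<open>b m\<close> is
  divergence free. For a smooth convex \<open>f\<close> and \<open>h > 0\<close> the tangent inequality
  \<open>f (x - h b x) \<ge> f x - h \<nabla>f x \<bullet> b x\<close> integrates to \<open>\<integral>f (x - h b x) dm \<ge> \<integral>f dm\<close>, so \<open>m\<close> is
  dominated in convex order by the law of \<open>x - h b x\<close>. By a quantized form of Strassen's theorem there is
  a stationary Markov chain with one-time law \<open>m\<close> for which the increments \<open>X\<^sub>k\<^sub>+\<^sub>1 - X\<^sub>k - h b X\<^sub>k\<^sub>+\<^sub>1\<close> are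
  martingale differences of size \<open>h\<close>. Over a bounded time these sum to \<open>O(\<surd>h)\<close> in mean square, hence as
  \<open>h \<rightarrow> 0\<close> the chains converge to a stationary process with Lipschitz paths that solves
  \<open>\<gamma>' = b \<gamma>\<close>. Compactness of the laws reduces to Helly's theorem on the line, because
  countably many bounded coordinates can be read off a single real number by continuous functions.
\<close>

section \<open>Log-sum-exp functions\<close>

text \<open>The field \<open>b\<close> is only bounded and measurable: it has no flow, and its
  composition with a path does not pass to weak limits. Two devices answer this. The chains run on
  pairs of position and velocity, so that no value of \<open>b\<close> is needed at a displaced
  point; and the limit equation is tested with Lipschitz fields \<open>c\<close>, whose L1 distance
  from \<open>b\<close> bounds the error at every time because each one-time law of the limit is
  \<open>m\<close>. The convex order compares \<open>m\<close> with the law of the backward point,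
  which is why the velocity is taken at the end of a step. The increments have size h in mean
  square, not pointwise: by stationarity their variance is the change of the second moment from x to
  x - h b(x), and its term linear in h vanishes because closedness, tested with |x|^2 / 2, makes x
  and b(x) orthogonal on average. Invariance is exact in every chain; only the barycentres and the
  approximation of \<open>m\<close> carry a slack, which is what permits finitely supported
  laws.\<close>

lemma smooth_funI_closed_class:
  fixes F :: "('a::euclidean_space \<Rightarrow> real) set"
  assumes step: "\<And>f. f \<in> F \<Longrightarrow> \<exists>d. (\<forall>b. d b \<in> F) \<and>
      (\<forall>x. (f has_derivative (\<lambda>h. \<Sum>b\<in>Basis. (h \<bullet> b) * d b x)) (at x))"
    and g: "g \<in> F"
  shows "smooth_fun g"
proof -
  obtain d where d: "\<And>f b. f \<in> F \<Longrightarrow> d f b \<in> F"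
    "\<And>f x. f \<in> F \<Longrightarrow> (f has_derivative (\<lambda>h. \<Sum>b\<in>Basis. (h \<bullet> b) * d f b x)) (at x)"
    using bchoice[of F "\<lambda>f d. (\<forall>b. d b \<in> F) \<and>
      (\<forall>x. (f has_derivative (\<lambda>h. \<Sum>b\<in>Basis. (h \<bullet> b) * d b x)) (at x))"] step by blast
  define D where "D = rec_list g (\<lambda>b xs f. d f b)"
  have D: "D [] = g" "\<And>b xs. D (b # xs) = d (D xs) b"
    by (simp_all add: D_def)
  have "D xs \<in> F" for xs
    by (induction xs) (use g d(1) D in auto)
  then show ?thesis
    unfolding smooth_fun_def using D d(2) by (intro exI[of _ D]) auto
qed

lemma has_derivative_basis_sum:
  fixes f :: "'a::euclidean_space \<Rightarrow> real"
  assumes "(f has_derivative f') (at x)"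
  shows "(f has_derivative (\<lambda>h. \<Sum>b\<in>Basis. (h \<bullet> b) * f' b)) (at x)"
proof -
  have "linear f'" using assms has_derivative_linear by blast
  then have "f' h = (\<Sum>b\<in>Basis. (h \<bullet> b) * f' b)" for h
    by (subst euclidean_representation[of h, symmetric])
       (simp only: linear_sum linear_scale real_scaleR_def)
  then show ?thesis using assms by (metis (no_types, lifting) ext)
qed

text \<open>A class closed under partial derivatives, as \<open>smooth_funI_closed_class\<close>
  demands. Differentiating the logarithm produces the reciprocal of the sum, hence the generator
  \<open>recip\<close>, whose own derivative stays in the algebra. The constants supply the
  coefficients \<open>\<beta> i \<bullet> b\<close>.\<close>

inductive_set exp_algebra :: "'i set \<Rightarrow> ('i \<Rightarrow> 'a::euclidean_space) \<Rightarrow> ('i \<Rightarrow> real) \<Rightarrow> ('a \<Rightarrow> real) set"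
  for I \<beta> c where
  const: "(\<lambda>_. k) \<in> exp_algebra I \<beta> c"
| exps: "i \<in> I \<Longrightarrow> (\<lambda>x. exp (\<beta> i \<bullet> x - c i)) \<in> exp_algebra I \<beta> c"
| add: "f \<in> exp_algebra I \<beta> c \<Longrightarrow> g \<in> exp_algebra I \<beta> c \<Longrightarrow> (\<lambda>x. f x + g x) \<in> exp_algebra I \<beta> c"
| mult: "f \<in> exp_algebra I \<beta> c \<Longrightarrow> g \<in> exp_algebra I \<beta> c \<Longrightarrow> (\<lambda>x. f x * g x) \<in> exp_algebra I \<beta> c"
| recip: "(\<lambda>x. inverse (\<Sum>i\<in>I. exp (\<beta> i \<bullet> x - c i))) \<in> exp_algebra I \<beta> c"
| log: "(\<lambda>x. ln (\<Sum>i\<in>I. exp (\<beta> i \<bullet> x - c i))) \<in> exp_algebra I \<beta> c"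

lemma exp_algebra_sum:
  assumes "finite J" "\<And>j. j \<in> J \<Longrightarrow> f j \<in> exp_algebra I \<beta> c"
  shows "(\<lambda>x. \<Sum>j\<in>J. f j x) \<in> exp_algebra I \<beta> c"
  using assms by (induction J) (auto intro: exp_algebra.const exp_algebra.add)

lemma exp_sum_pos:
  fixes \<beta> :: "'i \<Rightarrow> 'a::euclidean_space"
  assumes "finite I" "I \<noteq> {}"
  shows "(\<Sum>i\<in>I. exp (\<beta> i \<bullet> x - c i :: real)) > 0"
  by (intro sum_pos assms) auto

lemma exp_affine_has_derivative:
  fixes v :: "'a::euclidean_space"
  shows "((\<lambda>x. exp (v \<bullet> x - k)) has_derivative (\<lambda>h. (v \<bullet> h) * exp (v \<bullet> x - k))) (at x)"
proof -
  have "((\<lambda>x. v \<bullet> x - k) has_derivative (\<lambda>h. v \<bullet> h - 0)) (at x)"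
    by (intro has_derivative_diff has_derivative_inner_right has_derivative_ident has_derivative_const)
  from has_derivative_exp[OF this] show ?thesis by simp
qed

lemma exp_algebra_derivative:
  fixes \<beta> :: "'i \<Rightarrow> 'a::euclidean_space"
  assumes I: "finite I" "I \<noteq> {}" and f: "f \<in> exp_algebra I \<beta> c"
  shows "\<exists>d. (\<forall>b. d b \<in> exp_algebra I \<beta> c) \<and>
      (\<forall>x. (f has_derivative (\<lambda>h. \<Sum>b\<in>Basis. (h \<bullet> b) * d b x)) (at x))"
proof -
  let ?E = "exp_algebra I \<beta> c"
  let ?s = "\<lambda>x. \<Sum>i\<in>I. exp (\<beta> i \<bullet> x - c i)"
  have pos: "?s x > 0" for x by (rule exp_sum_pos[OF I])
  have ds: "(?s has_derivative (\<lambda>h. \<Sum>i\<in>I. (\<beta> i \<bullet> h) * exp (\<beta> i \<bullet> x - c i))) (at x)" for x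
    by (intro has_derivative_sum exp_affine_has_derivative)
  have ds_in: "(\<lambda>x. \<Sum>i\<in>I. (\<beta> i \<bullet> b) * exp (\<beta> i \<bullet> x - c i)) \<in> ?E" for b
    by (intro exp_algebra_sum I exp_algebra.mult exp_algebra.const exp_algebra.exps)
  have "\<exists>d. (\<forall>b. (\<lambda>x. d x b) \<in> ?E) \<and> (\<forall>x. (f has_derivative d x) (at x))"
    using f
  proof induction
    case (const k)
    then show ?case by (intro exI[of _ "\<lambda>_ _. 0"]) (auto intro: exp_algebra.const)
  next
    case (exps i)
    show ?case
      by (intro exI[of _ "\<lambda>x b. (\<beta> i \<bullet> b) * exp (\<beta> i \<bullet> x - c i)"] conjI allI
          exp_algebra.mult exp_algebra.const exp_algebra.exps exps exp_affine_has_derivative)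
  next
    case (add f g)
    then obtain d e where *: "\<And>b. (\<lambda>x. d x b) \<in> ?E" "\<And>x. (f has_derivative d x) (at x)"
      "\<And>b. (\<lambda>x. e x b) \<in> ?E" "\<And>x. (g has_derivative e x) (at x)"
      by metis
    show ?case
      by (intro exI[of _ "\<lambda>x b. d x b + e x b"] conjI allI exp_algebra.add * has_derivative_add)
  next
    case (mult f g)
    then obtain d e where *: "\<And>b. (\<lambda>x. d x b) \<in> ?E" "\<And>x. (f has_derivative d x) (at x)"
      "\<And>b. (\<lambda>x. e x b) \<in> ?E" "\<And>x. (g has_derivative e x) (at x)"
      by metis
    show ?case
      by (intro exI[of _ "\<lambda>x b. f x * e x b + d x b * g x"] conjI allI exp_algebra.add
          exp_algebra.mult mult * has_derivative_mult)
  next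
    case recip
    show ?case
    proof (intro exI[of _ "\<lambda>x b. (-1) * (inverse (?s x) * (\<Sum>i\<in>I. (\<beta> i \<bullet> b) * exp (\<beta> i \<bullet> x - c i)) * inverse (?s x))"] conjI allI)
      fix x
      have "((\<lambda>x. inverse (?s x)) has_derivative
         (\<lambda>h. - (inverse (?s x) * (\<Sum>i\<in>I. (\<beta> i \<bullet> h) * exp (\<beta> i \<bullet> x - c i)) * inverse (?s x)))) (at x)"
        using pos[of x] by (intro Deriv.has_derivative_inverse ds) auto
      then show "((\<lambda>x. inverse (?s x)) has_derivative
         (\<lambda>h. (-1) * (inverse (?s x) * (\<Sum>i\<in>I. (\<beta> i \<bullet> h) * exp (\<beta> i \<bullet> x - c i)) * inverse (?s x)))) (at x)"
        by simp
    qed (intro exp_algebra.mult exp_algebra.const exp_algebra.recip ds_in)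
  next
    case log
    show ?case
    proof (intro exI[of _ "\<lambda>x b. (\<Sum>i\<in>I. (\<beta> i \<bullet> b) * exp (\<beta> i \<bullet> x - c i)) * inverse (?s x)"] conjI allI)
      fix x
      show "((\<lambda>x. ln (?s x)) has_derivative
         (\<lambda>h. (\<Sum>i\<in>I. (\<beta> i \<bullet> h) * exp (\<beta> i \<bullet> x - c i)) * inverse (?s x))) (at x)"
        using has_derivative_ln[OF pos ds] .
    qed (intro exp_algebra.mult exp_algebra.const exp_algebra.recip ds_in)
  qed
  then obtain d where "\<And>b. (\<lambda>x. d x b) \<in> ?E" "\<And>x. (f has_derivative d x) (at x)"
    by metis
  then show ?thesis
    by (intro exI[of _ "\<lambda>b x. d x b"]) (auto intro: has_derivative_basis_sum)
qed

lemma smooth_fun_log_sum_exp: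
  fixes \<beta> :: "'i \<Rightarrow> 'a::euclidean_space"
  assumes "finite I" "I \<noteq> {}"
  shows "smooth_fun (\<lambda>x. ln (\<Sum>i\<in>I. exp (\<beta> i \<bullet> x - c i)))"
  by (rule smooth_funI_closed_class[where F = "exp_algebra I \<beta> c"])
     (use exp_algebra_derivative[OF assms] in \<open>auto intro: exp_algebra.log\<close>)

lemma log_sum_exp_has_derivative:
  fixes \<beta> :: "'i \<Rightarrow> 'a::euclidean_space"
  assumes "finite I" "I \<noteq> {}"
  shows "((\<lambda>x. ln (\<Sum>i\<in>I. exp (\<beta> i \<bullet> x - c i))) has_derivative
    (\<lambda>h. (\<Sum>i\<in>I. exp (\<beta> i \<bullet> x - c i) * (\<beta> i \<bullet> h)) / (\<Sum>i\<in>I. exp (\<beta> i \<bullet> x - c i)))) (at x)"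
proof -
  have "((\<lambda>x. \<Sum>i\<in>I. exp (\<beta> i \<bullet> x - c i)) has_derivative
      (\<lambda>h. \<Sum>i\<in>I. (\<beta> i \<bullet> h) * exp (\<beta> i \<bullet> x - c i))) (at x)"
    by (intro has_derivative_sum exp_affine_has_derivative)
  from has_derivative_ln[OF exp_sum_pos[OF assms] this] show ?thesis
    by (simp add: divide_inverse mult.commute)
qed

text \<open>The derivative averages the slopes with the weights \<open>w i\<close> proportional to
  \<open>exp (\<beta> i \<bullet> x - c i)\<close>. Jensen's inequality for \<open>exp\<close> under
  these weights becomes the tangent inequality after taking logarithms, so second derivatives are
  avoided.\<close>

lemma log_sum_exp_above_tangent:
  fixes \<beta> :: "'i \<Rightarrow> 'a::euclidean_space"
  assumes I: "finite I" "I \<noteq> {}"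
  shows "ln (\<Sum>i\<in>I. exp (\<beta> i \<bullet> x - c i)) +
      (\<Sum>i\<in>I. exp (\<beta> i \<bullet> x - c i) * (\<beta> i \<bullet> h)) / (\<Sum>i\<in>I. exp (\<beta> i \<bullet> x - c i))
    \<le> ln (\<Sum>i\<in>I. exp (\<beta> i \<bullet> (x + h) - c i))"
proof -
  define s where "s = (\<Sum>i\<in>I. exp (\<beta> i \<bullet> x - c i))"
  define w where "w i = exp (\<beta> i \<bullet> x - c i) / s" for i
  have s: "s > 0" unfolding s_def by (rule exp_sum_pos[OF I])
  have w: "w i \<ge> 0" for i using s by (simp add: w_def)
  have w1: "sum w I = 1" using s by (simp add: w_def s_def flip: sum_divide_distrib)
  have "exp (\<Sum>i\<in>I. w i *\<^sub>R (\<beta> i \<bullet> h)) \<le> (\<Sum>i\<in>I. w i * exp (\<beta> i \<bullet> h))"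
    by (intro convex_on_sum[where C = UNIV] I w w1 exp_convex) auto
  also have "\<dots> = (\<Sum>i\<in>I. exp (\<beta> i \<bullet> (x + h) - c i)) / s"
    by (simp add: w_def sum_divide_distrib inner_add_right exp_diff exp_add field_simps)
  finally have "(\<Sum>i\<in>I. w i * (\<beta> i \<bullet> h)) \<le> ln ((\<Sum>i\<in>I. exp (\<beta> i \<bullet> (x + h) - c i)) / s)"
    using exp_sum_pos[OF I, of \<beta> "x + h" c] s by (subst ln_ge_iff) auto
  also have "\<dots> = ln (\<Sum>i\<in>I. exp (\<beta> i \<bullet> (x + h) - c i)) - ln s"
    using exp_sum_pos[OF I, of \<beta> "x + h" c] s by (simp add: ln_div)
  finally show ?thesis
    by (simp add: s_def w_def sum_divide_distrib)
qed

text \<open>The gap \<open>ln (card I)\<close> does not depend on the values \<open>a i\<close>;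
  this is what allows \<open>convex_order\<close> to scale it away.\<close>

lemma Max_le_log_sum_exp:
  fixes a :: "'i \<Rightarrow> real"
  assumes I: "finite I" "I \<noteq> {}"
  shows "Max (a ` I) \<le> ln (\<Sum>i\<in>I. exp (a i))"
    and "ln (\<Sum>i\<in>I. exp (a i)) \<le> Max (a ` I) + ln (card I)"
proof -
  have pos: "(\<Sum>i\<in>I. exp (a i)) > 0" by (intro sum_pos I) auto
  show "Max (a ` I) \<le> ln (\<Sum>i\<in>I. exp (a i))"
  proof (rule Max.boundedI)
    fix y assume "y \<in> a ` I"
    then obtain i where i: "i \<in> I" "y = a i" by auto
    have "exp (a i) \<le> (\<Sum>i\<in>I. exp (a i))"
      by (rule member_le_sum) (use I i in auto)
    then show "y \<le> ln (\<Sum>i\<in>I. exp (a i))"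
      using pos i by (simp add: ln_ge_iff)
  qed (use I in auto)
  have "(\<Sum>i\<in>I. exp (a i)) \<le> (\<Sum>i\<in>I. exp (Max (a ` I)))"
    by (intro sum_mono) (use I in auto)
  then have "ln (\<Sum>i\<in>I. exp (a i)) \<le> ln (card I * exp (Max (a ` I)))"
    using pos by simp
  also have "\<dots> = Max (a ` I) + ln (card I)"
    using I by (subst ln_mult) (auto simp: card_gt_0_iff)
  finally show "ln (\<Sum>i\<in>I. exp (a i)) \<le> Max (a ` I) + ln (card I)" .
qed

text \<open>Serves as a test function: its derivative at \<open>x\<close> along \<open>b x\<close>
  is \<open>x \<bullet> b x\<close>, so closedness makes position and velocity orthogonal on
  average. The affine functions in the class of the proof contain all its partial
  derivatives.\<close>

lemma smooth_fun_half_norm_squared: "smooth_fun (\<lambda>x::'a::euclidean_space. (x \<bullet> x) / 2)"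
proof (rule smooth_funI_closed_class[where F = "insert (\<lambda>x. (x \<bullet> x) / 2) (range (\<lambda>(v,k) x. v \<bullet> x + k))"])
  fix f :: "'a \<Rightarrow> real"
  assume "f \<in> insert (\<lambda>x. (x \<bullet> x) / 2) (range (\<lambda>(v,k) x. v \<bullet> x + k))"
  then consider "f = (\<lambda>x. (x \<bullet> x) / 2)" | v k where "f = (\<lambda>x. v \<bullet> x + k)" by auto
  then show "\<exists>d. (\<forall>b. d b \<in> insert (\<lambda>x. (x \<bullet> x) / 2) (range (\<lambda>(v,k) x. v \<bullet> x + k))) \<and>
      (\<forall>x. (f has_derivative (\<lambda>h. \<Sum>b\<in>Basis. (h \<bullet> b) * d b x)) (at x))"
  proof cases
    case 1
    show ?thesis
    proof (intro exI[of _ "\<lambda>b x. b \<bullet> x + 0"] conjI allI)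
      show "(f has_derivative (\<lambda>h. \<Sum>b\<in>Basis. (h \<bullet> b) * (b \<bullet> x + 0))) (at x)" for x
        unfolding 1 by (rule has_derivative_basis_sum)
          (auto intro!: derivative_eq_intros simp: inner_commute)
      show "(\<lambda>x. b \<bullet> x + 0) \<in> insert (\<lambda>x. (x \<bullet> x) / 2) (range (\<lambda>(v,k) x. v \<bullet> x + k))" for b :: 'a
        by (rule insertI2, rule range_eqI[of _ _ "(b, 0)"]) simp
    qed
  next
    case 2
    show ?thesis
    proof (intro exI[of _ "\<lambda>b x. 0 \<bullet> x + v \<bullet> b"] conjI allI)
      show "(f has_derivative (\<lambda>h. \<Sum>b\<in>Basis. (h \<bullet> b) * (0 \<bullet> x + v \<bullet> b))) (at x)" for x
        unfolding 2 by (simp, rule has_derivative_basis_sum)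
          (auto intro!: derivative_eq_intros simp: inner_commute)
      show "(\<lambda>x. 0 \<bullet> x + v \<bullet> b) \<in> insert (\<lambda>x. (x \<bullet> x) / 2) (range (\<lambda>(v,k) x. v \<bullet> x + k))" for b :: 'a
        by (rule insertI2, rule range_eqI[of _ _ "(0, v \<bullet> b)"]) simp
    qed
  qed
qed auto

section \<open>Martingale couplings of finitely supported laws\<close>

text \<open>Tychonoff's theorem for functions with the product topology. Couplings can then be
  minimised over as functions on an arbitrary index type, without passing to a finite-dimensional
  space.\<close>

lemma compact_fun_space_box:
  fixes S :: "'i \<Rightarrow> 'b::topological_space set"
  assumes "\<And>i. compact (S i)"
  shows "compact {f. \<forall>i. f i \<in> S i}"
proof -
  have "compactin (product_topology (\<lambda>_. euclidean) UNIV) (PiE UNIV S)"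
    using assms by (subst compactin_PiE) auto
  then have "compact (PiE UNIV S)"
    by (simp add: euclidean_product_topology)
  then show ?thesis by (simp add: PiE_UNIV_domain Pi_def)
qed

lemma nonneg_of_quadratic_perturbation:
  fixes a q :: real
  assumes "\<And>t. 0 < t \<Longrightarrow> t \<le> 1 \<Longrightarrow> 0 \<le> 2 * t * a + t\<^sup>2 * q"
  shows "0 \<le> a"
proof (rule ccontr)
  assume "\<not> 0 \<le> a"
  then have a: "a < 0" by simp
  \<comment> \<open>Chosen so that \<open>t * q \<le> - a\<close>; then the factor
    \<open>2 * a + t * q\<close> is at most \<open>a\<close>, which is negative.\<close>
  define t where "t = min 1 (- a / (\<bar>q\<bar> + 1))"
  have t: "0 < t" "t \<le> 1" using a by (auto simp: t_def divide_neg_pos)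
  have "t * (\<bar>q\<bar> + 1) \<le> - a" unfolding t_def
    by (subst pos_le_divide_eq[symmetric]) auto
  then have "t * q \<le> - a"
    using t mult_left_mono[of q "\<bar>q\<bar> + 1" t] by linarith
  then have "2 * a + t * q < 0" using a by linarith
  then have "t * (2 * a + t * q) < 0" using t by (simp add: mult_pos_neg)
  then show False using assms[OF t] by (simp add: algebra_simps power2_eq_square)
qed

text \<open>A finite Strassen theorem with slack. At a minimiser of the squared residuals \<open>r\<close> of the column
  constraints and \<open>e\<close> of the barycentre constraints, the residuals themselves define the convex function
  \<open>max\<^sub>i (\<mu>\<^sub>i - e\<^sub>i \<bullet> y)\<close> with \<open>\<mu>\<^sub>i = min\<^sub>j (r\<^sub>j + e\<^sub>i \<bullet> z\<^sub>j)\<close>, and the first-order condition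
  combined with the order hypothesis for this function forces them to vanish.\<close>

lemma approximate_martingale_coupling:
  fixes x z :: "'i \<Rightarrow> 'a::euclidean_space" and w :: "'i \<Rightarrow> real"
  assumes I: "finite I" "I \<noteq> {}" and w: "\<And>i. i \<in> I \<Longrightarrow> 0 \<le> w i" and \<kappa>: "0 \<le> \<kappa>"
    and order: "\<And>\<beta> c L. (\<And>i. i \<in> I \<Longrightarrow> norm (\<beta> i) \<le> L) \<Longrightarrow>
       (\<Sum>k\<in>I. w k * Max ((\<lambda>i. \<beta> i \<bullet> x k - c i) ` I))
       \<le> (\<Sum>k\<in>I. w k * Max ((\<lambda>i. \<beta> i \<bullet> z k - c i) ` I)) + L * \<kappa>"
  obtains p :: "'i \<Rightarrow> 'i \<Rightarrow> real" where "\<And>i j. 0 \<le> p i j"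
    "\<And>i. i \<in> I \<Longrightarrow> (\<Sum>j\<in>I. p i j) = w i" "\<And>j. j \<in> I \<Longrightarrow> (\<Sum>i\<in>I. p i j) = w j"
    "(\<Sum>i\<in>I. norm ((\<Sum>j\<in>I. p i j *\<^sub>R z j) - w i *\<^sub>R x i)) \<le> \<kappa>"
proof -
  \<comment> \<open>A point is a matrix \<open>p\<close> together with slack vectors
    \<open>s\<close>. Row sums and the total slack \<open>\<kappa>\<close> are hard constraints,
    while column sums and barycentres are penalised in \<open>J\<close>. The boxes encode
    nonnegativity of \<open>p\<close> and, with the value 0 outside \<open>I\<close>, make the set
    compact.\<close>
  define C :: "(('i \<times> 'i \<Rightarrow> real) \<times> ('i \<Rightarrow> 'a)) set" where
    "C = ({p. \<forall>u. p u \<in> (if u \<in> I \<times> I then {0..w (fst u)} else {0})} \<times>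
          {s. \<forall>i. s i \<in> (if i \<in> I then cball 0 \<kappa> else {0})})
        \<inter> ({u. \<forall>i\<in>I. (\<Sum>j\<in>I. fst u (i,j)) = w i} \<inter> {u. (\<Sum>i\<in>I. norm (snd u i)) \<le> \<kappa>})"
  define r where "r u j = (\<Sum>i\<in>I. fst u (i,j)) - w j" for u :: "('i \<times> 'i \<Rightarrow> real) \<times> ('i \<Rightarrow> 'a)" and j
  define e where "e u i = (\<Sum>j\<in>I. fst u (i,j) *\<^sub>R z j) - w i *\<^sub>R x i - snd u i"
    for u :: "('i \<times> 'i \<Rightarrow> real) \<times> ('i \<Rightarrow> 'a)" and i
  define J where "J u = (\<Sum>j\<in>I. r u j * r u j) + (\<Sum>i\<in>I. e u i \<bullet> e u i)" for u
  have cf[continuous_intros]: "continuous_on A (\<lambda>u. fst u k)"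
    for A :: "(('i \<times> 'i \<Rightarrow> real) \<times> ('i \<Rightarrow> 'a)) set" and k
    by (rule continuous_on_product_then_coordinatewise) (intro continuous_intros)
  have cs[continuous_intros]: "continuous_on A (\<lambda>u. snd u k)"
    for A :: "(('i \<times> 'i \<Rightarrow> real) \<times> ('i \<Rightarrow> 'a)) set" and k
    by (rule continuous_on_product_then_coordinatewise) (intro continuous_intros)
  have "compact C" unfolding C_def
  proof (intro compact_Int_closed compact_Times compact_fun_space_box closed_Int)
    show "closed {u :: ('i \<times> 'i \<Rightarrow> real) \<times> ('i \<Rightarrow> 'a). \<forall>i\<in>I. (\<Sum>j\<in>I. fst u (i,j)) = w i}"
      unfolding Ball_def by (intro closed_Collect_all closed_Collect_imp closed_Collect_eq open_Collect_const continuous_intros)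
    show "closed {u :: ('i \<times> 'i \<Rightarrow> real) \<times> ('i \<Rightarrow> 'a). (\<Sum>i\<in>I. norm (snd u i)) \<le> \<kappa>}"
      by (intro closed_Collect_le continuous_intros)
  qed auto
  moreover have memC: "(p, s) \<in> C" if "\<And>i j. 0 \<le> p (i,j)" "\<And>u. u \<notin> I \<times> I \<Longrightarrow> p u = 0"
    "\<And>i. i \<in> I \<Longrightarrow> (\<Sum>j\<in>I. p (i,j)) = w i"
    "\<And>i. i \<notin> I \<Longrightarrow> s i = 0" "(\<Sum>i\<in>I. norm (s i)) \<le> \<kappa>" for p s
  proof -
    have "p (i,j) \<le> w i" if "i \<in> I" "j \<in> I" for i j
      using member_le_sum[of j I "\<lambda>j. p (i,j)"] I that \<open>\<And>i j. 0 \<le> p (i,j)\<close> \<open>\<And>i. i \<in> I \<Longrightarrow> (\<Sum>j\<in>I. p (i,j)) = w i\<close>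
      by auto
    moreover have "norm (s i) \<le> \<kappa>" if "i \<in> I" for i
      using member_le_sum[of i I "\<lambda>i. norm (s i)"] I that \<open>(\<Sum>i\<in>I. norm (s i)) \<le> \<kappa>\<close> by auto
    ultimately show ?thesis using that by (auto simp: C_def)
  qed
  obtain i0 where i0: "i0 \<in> I" using I by auto
  have pick: "((\<lambda>(i,j). if i \<in> I \<and> j \<in> I \<and> j = f i then w i else 0), s) \<in> C"
    if f: "\<And>i. i \<in> I \<Longrightarrow> f i \<in> I" and s: "\<And>i. i \<notin> I \<Longrightarrow> s i = 0" "(\<Sum>i\<in>I. norm (s i)) \<le> \<kappa>" for f s
  proof (rule memC)
    show "(\<Sum>j\<in>I. case (i, j) of (i, j) \<Rightarrow> if i \<in> I \<and> j \<in> I \<and> j = f i then w i else 0) = w i" if "i \<in> I" for i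
    proof -
      have "(\<Sum>j\<in>I. case (i, j) of (i, j) \<Rightarrow> if i \<in> I \<and> j \<in> I \<and> j = f i then w i else 0)
        = (\<Sum>j\<in>I. if j = f i then w i else 0)"
        using that by (intro sum.cong) auto
      then show ?thesis using f that I by simp
    qed
  qed (use f s w in \<open>auto split: if_splits\<close>)
  have "C \<noteq> {}" using pick[of "\<lambda>_. i0" "\<lambda>_. 0"] i0 \<kappa> by auto
  moreover have "continuous_on C J" unfolding J_def r_def e_def by (intro continuous_intros)
  ultimately obtain u where u: "u \<in> C" and min: "\<And>u'. u' \<in> C \<Longrightarrow> J u \<le> J u'"
    using continuous_attains_inf[of C J] by blast
  have Cnn: "0 \<le> fst v (i,j)" if "v \<in> C" for v i j
  proof -
    have "fst v (i,j) \<in> (if (i,j) \<in> I \<times> I then {0..w (fst (i,j))} else {0})"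
      using that unfolding C_def mem_Times_iff Int_iff mem_Collect_eq by blast
    then show ?thesis by (auto split: if_splits)
  qed
  have C0: "fst v k = 0" if "v \<in> C" "k \<notin> I \<times> I" for v k
  proof -
    have "fst v k \<in> (if k \<in> I \<times> I then {0..w (fst k)} else {0})"
      using that(1) unfolding C_def mem_Times_iff Int_iff mem_Collect_eq by blast
    then show ?thesis using that(2) by (simp split: if_splits)
  qed
  have C1: "snd v i = 0" if "v \<in> C" "i \<notin> I" for v i
  proof -
    have "snd v i \<in> (if i \<in> I then cball 0 \<kappa> else {0})"
      using that(1) unfolding C_def mem_Times_iff Int_iff mem_Collect_eq by blast
    then show ?thesis using that(2) by (simp split: if_splits)
  qed
  \<comment> \<open>First-order condition at the minimiser, along the segment from \<open>u\<close>
    to \<open>v\<close>. Since \<open>r\<close> and \<open>e\<close> are affine, it says that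
    \<open>J u\<close>, the squared length of the residual at \<open>u\<close>, is at most the inner
    product of the residuals at \<open>u\<close> and \<open>v\<close>.\<close>
  have var: "J u \<le> (\<Sum>j\<in>I. r u j * r v j) + (\<Sum>i\<in>I. e u i \<bullet> e v i)" if v: "v \<in> C" for v
  proof -
    let ?a = "(\<Sum>j\<in>I. r u j * (r v j - r u j)) + (\<Sum>i\<in>I. e u i \<bullet> (e v i - e u i))"
    let ?q = "(\<Sum>j\<in>I. (r v j - r u j) * (r v j - r u j)) + (\<Sum>i\<in>I. (e v i - e u i) \<bullet> (e v i - e u i))"
    have "0 \<le> ?a"
    proof (rule nonneg_of_quadratic_perturbation)
      fix t :: real assume t: "0 < t" "t \<le> 1"
      define y where "y = ((\<lambda>k. (1 - t) * fst u k + t * fst v k), (\<lambda>i. (1 - t) *\<^sub>R snd u i + t *\<^sub>R snd v i))"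
      have "y \<in> C" unfolding y_def
      proof (rule memC)
        show "(1 - t) * fst u (i, j) + t * fst v (i, j) \<ge> 0" for i j
          using Cnn[OF u] Cnn[OF v] t by simp
        show "(\<Sum>j\<in>I. (1 - t) * fst u (i, j) + t * fst v (i, j)) = w i" if "i \<in> I" for i
        proof -
          have "(\<Sum>j\<in>I. fst u (i, j)) = w i" "(\<Sum>j\<in>I. fst v (i, j)) = w i"
            using u v that by (auto simp: C_def)
          then show ?thesis
            by (simp add: sum.distrib flip: sum_distrib_left) (simp add: algebra_simps)
        qed
        have "(\<Sum>i\<in>I. norm ((1 - t) *\<^sub>R snd u i + t *\<^sub>R snd v i))
          \<le> (\<Sum>i\<in>I. (1 - t) * norm (snd u i) + t * norm (snd v i))"
          using t by (intro sum_mono norm_triangle_le) auto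
        also have "\<dots> = (1 - t) * (\<Sum>i\<in>I. norm (snd u i)) + t * (\<Sum>i\<in>I. norm (snd v i))"
          by (simp add: sum.distrib sum_distrib_left)
        also have "\<dots> \<le> (1 - t) * \<kappa> + t * \<kappa>"
          using u v t by (intro add_mono mult_left_mono) (auto simp: C_def)
        finally show "(\<Sum>i\<in>I. norm ((1 - t) *\<^sub>R snd u i + t *\<^sub>R snd v i)) \<le> \<kappa>" by (simp add: algebra_simps)
      qed (use C0[OF u] C0[OF v] C1[OF u] C1[OF v] in auto)
      then have "J u \<le> J y" by (rule min)
      have ry: "r y j = r u j + t * (r v j - r u j)" for j
        by (simp add: r_def y_def sum.distrib sum_distrib_left algebra_simps sum_subtractf)
      have ey: "e y i = e u i + t *\<^sub>R (e v i - e u i)" for i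
        by (simp add: e_def y_def sum.distrib scaleR_sum_right algebra_simps sum_subtractf)
      have "J y = J u + 2 * t * ?a + t\<^sup>2 * ?q"
        by (simp add: J_def ry ey algebra_simps inner_simps sum.distrib sum_distrib_left
            power2_eq_square sum_subtractf inner_commute)
      with \<open>J u \<le> J y\<close> show "0 \<le> 2 * t * ?a + t\<^sup>2 * ?q" by simp
    qed
    also have "?a = (\<Sum>j\<in>I. r u j * r v j) + (\<Sum>i\<in>I. e u i \<bullet> e v i) - J u"
      by (simp add: J_def algebra_simps inner_simps sum_subtractf)
    finally show ?thesis by simp
  qed
  define L where "L = Max ((\<lambda>i. norm (e u i)) ` I)"
  have L: "norm (e u i) \<le> L" if "i \<in> I" for i using I that by (auto simp: L_def)
  obtain i1 where i1: "i1 \<in> I" "norm (e u i1) = L"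
  proof -
    have "L \<in> (\<lambda>i. norm (e u i)) ` I" unfolding L_def using I by (intro Max_in) auto
    then show ?thesis using that by auto
  qed
  \<comment> \<open>Row by row the competitor puts the whole mass \<open>w i\<close> on one column.
    Together with the slack \<open>s\<close> chosen below it minimises over \<open>C\<close> the
    affine functional on the right of \<open>var\<close>.\<close>
  obtain f where f: "\<And>i. i \<in> I \<Longrightarrow> f i \<in> I"
    and fmin: "\<And>i j. i \<in> I \<Longrightarrow> j \<in> I \<Longrightarrow> r u (f i) + e u i \<bullet> z (f i) \<le> r u j + e u i \<bullet> z j"
  proof -
    have "\<exists>k\<in>I. \<forall>j\<in>I. r u k + e u i \<bullet> z k \<le> r u j + e u i \<bullet> z j" for i
      using arg_min_if_finite(1)[OF I, of "\<lambda>j. r u j + e u i \<bullet> z j"]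
        arg_min_least[OF I, of _ "\<lambda>j. r u j + e u i \<bullet> z j"] by blast
    then show ?thesis using that by metis
  qed
  \<comment> \<open>The entire slack goes to the row with the largest residual, in the direction of
    that residual. Its contribution \<open>- (\<kappa> * L)\<close> cancels the error
    \<open>L * \<kappa>\<close> of \<open>order\<close>.\<close>
  define s where "s i = (if i = i1 then \<kappa> *\<^sub>R sgn (e u i1) else 0)" for i
  define v where "v = ((\<lambda>(i,j). if i \<in> I \<and> j \<in> I \<and> j = f i then w i else 0), s)"
  have ns: "norm (s i) \<le> (if i = i1 then \<kappa> else 0)" for i
    using \<kappa> by (auto simp: s_def norm_sgn)
  have "(\<Sum>i\<in>I. norm (s i)) \<le> (\<Sum>i\<in>I. if i = i1 then \<kappa> else 0)"
    by (intro sum_mono ns)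
  also have "\<dots> = \<kappa>" using I i1 by simp
  finally have vC: "v \<in> C" unfolding v_def using f i1 by (intro pick) (auto simp: s_def)
  have sdot: "(\<Sum>i\<in>I. e u i \<bullet> s i) = \<kappa> * L"
  proof -
    have "(\<Sum>i\<in>I. e u i \<bullet> s i) = (\<Sum>i\<in>I. if i = i1 then \<kappa> * (e u i1 \<bullet> sgn (e u i1)) else 0)"
      by (intro sum.cong) (auto simp: s_def)
    also have "\<dots> = \<kappa> * (e u i1 \<bullet> sgn (e u i1))" using I i1 by simp
    also have "e u i1 \<bullet> sgn (e u i1) = L"
      unfolding i1(2)[symmetric] by (cases "e u i1 = 0") (auto simp: sgn_div_norm power2_norm_eq_inner[symmetric] power2_eq_square)
    finally show ?thesis .
  qed
  let ?m = "\<lambda>i. r u (f i) + e u i \<bullet> z (f i)"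
  have sumv: "(\<Sum>j\<in>I. r u j * r v j) = (\<Sum>i\<in>I. w i * r u (f i)) - (\<Sum>j\<in>I. w j * r u j)"
  proof -
    have "(\<Sum>j\<in>I. r u j * (\<Sum>i\<in>I. fst v (i,j))) = (\<Sum>i\<in>I. \<Sum>j\<in>I. r u j * fst v (i,j))"
      by (subst sum.swap) (simp add: sum_distrib_left)
    also have "\<dots> = (\<Sum>i\<in>I. \<Sum>j\<in>I. if j = f i then w i * r u j else 0)"
      by (intro sum.cong) (auto simp: v_def)
    also have "\<dots> = (\<Sum>i\<in>I. w i * r u (f i))"
      using f I by (intro sum.cong) (auto simp: sum.delta)
    finally show ?thesis unfolding r_def[of v]
      by (simp add: right_diff_distrib sum_subtractf mult.commute)
  qed
  have fv: "(\<Sum>j\<in>I. fst v (i,j) *\<^sub>R z j) = w i *\<^sub>R z (f i)" if "i \<in> I" for i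
  proof -
    have "(\<Sum>j\<in>I. fst v (i,j) *\<^sub>R z j) = (\<Sum>j\<in>I. if j = f i then w i *\<^sub>R z j else 0)"
      using that by (intro sum.cong) (auto simp: v_def)
    then show ?thesis using f[OF that] I by (auto simp: sum.delta)
  qed
  have "(\<Sum>i\<in>I. e u i \<bullet> e v i) = (\<Sum>i\<in>I. e u i \<bullet> (w i *\<^sub>R z (f i) - w i *\<^sub>R x i - s i))"
    unfolding e_def[of v] by (intro sum.cong) (simp_all only: fv, simp add: v_def)
  then have sume: "(\<Sum>i\<in>I. e u i \<bullet> e v i) = (\<Sum>i\<in>I. w i * (e u i \<bullet> z (f i))) - (\<Sum>i\<in>I. w i * (e u i \<bullet> x i)) - \<kappa> * L"
    by (simp add: inner_simps sum_subtractf sdot)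
  have ord: "(\<Sum>k\<in>I. w k * Max ((\<lambda>i. (- e u i) \<bullet> x k - (- ?m i)) ` I))
     \<le> (\<Sum>k\<in>I. w k * Max ((\<lambda>i. (- e u i) \<bullet> z k - (- ?m i)) ` I)) + L * \<kappa>"
    by (rule order) (use L in auto)
  have "(\<Sum>k\<in>I. w k * (?m k - e u k \<bullet> x k)) \<le> (\<Sum>k\<in>I. w k * Max ((\<lambda>i. (- e u i) \<bullet> x k - (- ?m i)) ` I))"
    using I by (intro sum_mono mult_left_mono w Max_ge) (auto intro!: image_eqI)
  also note ord
  \<comment> \<open>At \<open>z k\<close> the piece \<open>i\<close> has the value
    \<open>?m i - e u i \<bullet> z k\<close>, at most \<open>r u k\<close> because
    \<open>f i\<close> is a minimiser. On the other side of \<open>ord\<close>, only the piece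
    \<open>i = k\<close> of the maximum at \<open>x k\<close> was kept.\<close>
  also have "(\<Sum>k\<in>I. w k * Max ((\<lambda>i. (- e u i) \<bullet> z k - (- ?m i)) ` I)) \<le> (\<Sum>k\<in>I. w k * r u k)"
    using I fmin by (intro sum_mono mult_left_mono w Max.boundedI) (auto simp: algebra_simps)
  finally have "(\<Sum>k\<in>I. w k * (?m k - e u k \<bullet> x k)) \<le> (\<Sum>k\<in>I. w k * r u k) + L * \<kappa>" by simp
  then have "(\<Sum>j\<in>I. r u j * r v j) + (\<Sum>i\<in>I. e u i \<bullet> e v i) \<le> 0"
    unfolding sumv sume by (simp add: algebra_simps sum.distrib sum_subtractf)
  with var[OF vC] have "J u \<le> 0" by simp
  moreover have "(\<Sum>j\<in>I. r u j * r u j) \<ge> 0" "(\<Sum>i\<in>I. e u i \<bullet> e u i) \<ge> 0"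
    by (auto intro!: sum_nonneg)
  ultimately have "(\<Sum>j\<in>I. r u j * r u j) = 0" "(\<Sum>i\<in>I. e u i \<bullet> e u i) = 0"
    by (auto simp: J_def)
  then have r0: "\<And>j. j \<in> I \<Longrightarrow> r u j = 0" and e0: "\<And>i. i \<in> I \<Longrightarrow> e u i = 0"
    using I by (auto simp: sum_nonneg_eq_0_iff)
  show ?thesis
  proof (rule that[of "\<lambda>i j. fst u (i,j)"])
    show "0 \<le> fst u (i,j)" for i j using Cnn[OF u] .
    show "(\<Sum>j\<in>I. fst u (i, j)) = w i" if "i \<in> I" for i using u that by (auto simp: C_def)
    show "(\<Sum>i\<in>I. fst u (i, j)) = w j" if "j \<in> I" for j using r0[OF that] by (simp add: r_def)
    have "(\<Sum>i\<in>I. norm ((\<Sum>j\<in>I. fst u (i, j) *\<^sub>R z j) - w i *\<^sub>R x i)) = (\<Sum>i\<in>I. norm (snd u i))"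
      using e0 by (intro sum.cong refl arg_cong[where f = norm]) (simp add: e_def)
    also have "\<dots> \<le> \<kappa>" using u by (auto simp: C_def)
    finally show "(\<Sum>i\<in>I. norm ((\<Sum>j\<in>I. fst u (i, j) *\<^sub>R z j) - w i *\<^sub>R x i)) \<le> \<kappa>" .
  qed
qed

section \<open>Convex order from divergence-freeness\<close>

text \<open>All that the construction uses of a closed measure: its projection \<open>m\<close>, the
  centroid field \<open>b\<close> up to a null set, and div (b m) = 0 in weak form. One constant
  \<open>M\<close> bounds positions and velocities.\<close>

locale invariant_field = prob_space m for m :: "'a::euclidean_space measure" +
  fixes b :: "'a \<Rightarrow> 'a" and M :: real
  assumes sets_m: "sets m = sets borel"
    and b_measurable: "b \<in> borel_measurable borel"
    and M_ge_1: "1 \<le> M"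
    and norm_point: "AE x in m. norm x \<le> M"
    and norm_field: "AE x in m. norm (b x) \<le> M"
    and divergence_free: "smooth_fun g \<Longrightarrow> (\<integral>x. frechet_derivative g (at x) (b x) \<partial>m) = 0"
begin

lemma space_m: "space m = UNIV"
  using sets_eq_imp_space_eq[OF sets_m] by simp

lemma measurable_m_eq: "measurable m N = measurable borel N"
  by (rule measurable_cong_sets) (auto simp: sets_m)

lemma b_measurable_m [measurable]: "b \<in> m \<rightarrow>\<^sub>M borel"
  using b_measurable by (simp add: measurable_m_eq)

lemma id_measurable_m [measurable]: "(\<lambda>x. x) \<in> m \<rightarrow>\<^sub>M borel"
  by (simp add: measurable_m_eq)

lemma integrable_continuous:
  fixes F :: "'a \<times> 'a \<Rightarrow> 'b::euclidean_space"
  assumes "continuous_on UNIV F"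
  shows "integrable m (\<lambda>x. F (x, b x))"
proof -
  have [measurable]: "F \<in> borel_measurable (borel \<Otimes>\<^sub>M borel)"
    using assms by (simp add: borel_prod borel_measurable_continuous_onI)
  have "compact (F ` (cball 0 M \<times> cball 0 M))"
    using assms by (intro compact_continuous_image compact_Times) (auto intro: continuous_on_subset)
  then obtain C where C: "\<And>y. y \<in> F ` (cball 0 M \<times> cball 0 M) \<Longrightarrow> norm y \<le> C"
    using compact_imp_bounded bounded_iff by metis
  show ?thesis
  proof (rule integrable_const_bound[where B = C])
    show "AE x in m. norm (F (x, b x)) \<le> C"
      using norm_point norm_field by eventually_elim (auto intro!: C)
  qed measurable
qed

text \<open>Log-sum-exp replaces the maximum, so that \<open>divergence_free\<close> applies and the
  integral of the tangent term vanishes. Passing from the maximum to log-sum-exp costs nothing on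
  the left; the way back on the right costs \<open>ln (card I)\<close> once.\<close>

lemma convex_order_log_card:
  fixes \<beta> :: "'i \<Rightarrow> 'a"
  assumes I: "finite I" "I \<noteq> {}"
  shows "(\<integral>x. Max ((\<lambda>i. \<beta> i \<bullet> x - c i) ` I) \<partial>m)
    \<le> (\<integral>x. Max ((\<lambda>i. \<beta> i \<bullet> (x - h *\<^sub>R b x) - c i) ` I) \<partial>m) + ln (card I)"
proof -
  let ?s = "\<lambda>x. \<Sum>i\<in>I. exp (\<beta> i \<bullet> x - c i)"
  let ?g = "\<lambda>x. ln (?s x)"
  let ?d = "\<lambda>x v. (\<Sum>i\<in>I. exp (\<beta> i \<bullet> x - c i) * (\<beta> i \<bullet> v)) / ?s x"
  have pos: "?s x \<noteq> 0" for x using exp_sum_pos[OF I, of \<beta> x c] by simp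
  have cM: "continuous_on UNIV (\<lambda>x::'a \<times> 'a. Max ((\<lambda>i. \<beta> i \<bullet> u x - c i) ` I))"
    if u: "continuous_on UNIV u" for u :: "'a \<times> 'a \<Rightarrow> 'a"
    using I
  proof (induction rule: finite_ne_induct)
    case (insert i F)
    then show ?case
      by (simp add: Max_insert) (intro continuous_on_max continuous_intros u)
  qed (auto intro!: continuous_intros u)
  have int1: "integrable m (\<lambda>x. Max ((\<lambda>i. \<beta> i \<bullet> x - c i) ` I))"
    using integrable_continuous[OF cM[of fst]] by (simp add: continuous_on_fst)
  have int2: "integrable m (\<lambda>x. Max ((\<lambda>i. \<beta> i \<bullet> (x - h *\<^sub>R b x) - c i) ` I))"
    using integrable_continuous[OF cM[of "\<lambda>x. fst x - h *\<^sub>R snd x"]] by (simp add: continuous_intros)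
  have "continuous_on UNIV (\<lambda>u::'a \<times> 'a. ?g (fst u))"
    using pos by (intro continuous_intros) auto
  then have int3: "integrable m ?g"
    using integrable_continuous[of "\<lambda>u. ?g (fst u)"] by simp
  have "continuous_on UNIV (\<lambda>u::'a \<times> 'a. ?g (fst u - h *\<^sub>R snd u))"
    using pos by (intro continuous_intros) auto
  then have int4: "integrable m (\<lambda>x. ?g (x - h *\<^sub>R b x))"
    using integrable_continuous[of "\<lambda>u. ?g (fst u - h *\<^sub>R snd u)"] by simp
  have "continuous_on UNIV (\<lambda>u::'a \<times> 'a. ?d (fst u) (snd u))"
    using pos by (intro continuous_intros) auto
  then have int5: "integrable m (\<lambda>x. ?d x (b x))"
    using integrable_continuous[of "\<lambda>u. ?d (fst u) (snd u)"] by simp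
  have "(\<integral>x. ?d x (b x) \<partial>m) = (\<integral>x. frechet_derivative ?g (at x) (b x) \<partial>m)"
    by (simp add: frechet_derivative_at[OF log_sum_exp_has_derivative[OF I], symmetric])
  then have zero: "(\<integral>x. ?d x (b x) \<partial>m) = 0"
    using divergence_free[OF smooth_fun_log_sum_exp[OF I]] by simp
  have dneg: "?d x (- h *\<^sub>R v) = - h * ?d x v" for x v
    by (simp add: sum_distrib_left sum_divide_distrib sum_negf ac_simps)
  have "(\<integral>x. Max ((\<lambda>i. \<beta> i \<bullet> x - c i) ` I) \<partial>m) \<le> (\<integral>x. ?g x \<partial>m)"
    by (intro integral_mono int1 int3 Max_le_log_sum_exp I)
  also have "\<dots> = (\<integral>x. ?g x - h * ?d x (b x) \<partial>m)"
    by (subst Bochner_Integration.integral_diff[OF int3 integrable_mult_right[OF int5]])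
       (simp only: integral_mult_right_zero zero mult_zero_right diff_zero)
  also have "\<dots> \<le> (\<integral>x. ?g (x - h *\<^sub>R b x) \<partial>m)"
  proof (intro integral_mono int4 Bochner_Integration.integrable_diff int3 integrable_mult_right int5)
    show "?g x - h * ?d x (b x) \<le> ?g (x - h *\<^sub>R b x)" for x
      using log_sum_exp_above_tangent[OF I, of \<beta> x c "- h *\<^sub>R b x"] unfolding dneg by simp
  qed
  also have "\<dots> \<le> (\<integral>x. Max ((\<lambda>i. \<beta> i \<bullet> (x - h *\<^sub>R b x) - c i) ` I) + ln (card I) \<partial>m)"
    by (intro integral_mono int4 Bochner_Integration.integrable_add int2 Max_le_log_sum_exp I) auto
  also have "\<dots> = (\<integral>x. Max ((\<lambda>i. \<beta> i \<bullet> (x - h *\<^sub>R b x) - c i) ` I) \<partial>m) + ln (card I)"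
    using int2 by (simp add: prob_space)
  finally show ?thesis .
qed

text \<open>Scaling slopes and intercepts by n + 1 multiplies both maxima by n + 1 but leaves the
  error \<open>ln (card I)\<close> as it is; after division the error tends to 0.\<close>

lemma convex_order:
  fixes \<beta> :: "'i \<Rightarrow> 'a"
  assumes I: "finite I" "I \<noteq> {}"
  shows "(\<integral>x. Max ((\<lambda>i. \<beta> i \<bullet> x - c i) ` I) \<partial>m)
    \<le> (\<integral>x. Max ((\<lambda>i. \<beta> i \<bullet> (x - h *\<^sub>R b x) - c i) ` I) \<partial>m)" (is "?l \<le> ?r")
proof -
  have scale: "Max ((\<lambda>i. (k *\<^sub>R \<beta> i) \<bullet> y - k * c i) ` I) = k * Max ((\<lambda>i. \<beta> i \<bullet> y - c i) ` I)"
    if "k > 0" for k :: real and y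
    using that I by (subst mono_Max_commute[where f = "\<lambda>x. k * x"])
      (auto simp: mono_def image_image algebra_simps intro!: arg_cong[where f = Max])
  have "?l \<le> ?r + ln (card I) / (real n + 1)" for n
  proof -
    let ?k = "real n + 1"
    have k0: "0 < ?k" by simp
    have "?k * ?l \<le> ?k * ?r + ln (card I)"
      using convex_order_log_card[OF I, of "\<lambda>i. ?k *\<^sub>R \<beta> i" "\<lambda>i. ?k * c i" h]
      by (simp only: scale[OF k0] integral_mult_right_zero)
    then show ?thesis by (simp add: field_simps)
  qed
  moreover have "(\<lambda>n. ?r + ln (card I) / (real n + 1)) \<longlonglongrightarrow> ?r + 0"
    using tendsto_add[OF tendsto_const[of ?r] tendsto_mult[OF tendsto_const[of "ln (real (card I))"] LIMSEQ_inverse_real_of_nat]]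
    by (simp add: divide_inverse add.commute)
  ultimately show ?thesis
    by (intro LIMSEQ_le_const[of _ ?r]) auto
qed

text \<open>Simple functions approximate the pair \<open>(x, b x)\<close> in L1, and the law of such
  a function is the finitely supported \<open>w\<close>. Keeping the velocity as a second coordinate
  is essential: a quantized position carries no meaningful value of a merely measurable
  \<open>b\<close>.\<close>

lemma quantization:
  assumes "0 < \<delta>"
  obtains w :: "('a \<times> 'a) pmf" where "finite (set_pmf w)" "set_pmf w \<subseteq> cball 0 (4 * M)"
    "\<And>F L. continuous_on UNIV F \<Longrightarrow> L-lipschitz_on (cball 0 (4 * M)) F \<Longrightarrow>
       \<bar>measure_pmf.expectation w F - (\<integral>x. F (x, b x) \<partial>m)\<bar> \<le> L * \<delta>"
proof -
  \<comment> \<open>Projecting both entries onto the ball changes nothing almost everywhere and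
    gives bounds at every point. The pair then has norm at most 2 M, and the approximating simple
    functions at most twice that, which is the radius 4 M.\<close>
  define s where "s x = (closest_point (cball 0 M) x, closest_point (cball 0 M) (b x))" for x
  have M: "0 < M" using M_ge_1 by simp
  have "continuous_on UNIV (closest_point (cball 0 M :: 'a set))"
    using M by (intro continuous_on_closest_point) auto
  then have cp [measurable]: "closest_point (cball 0 M :: 'a set) \<in> borel \<rightarrow>\<^sub>M borel"
    by (rule borel_measurable_continuous_onI)
  have cpn: "norm (closest_point (cball 0 M) (x::'a)) \<le> M" for x
    using closest_point_in_set[of "cball 0 M" x] M by auto
  have s_meas: "s \<in> borel_measurable m" unfolding s_def borel_prod[symmetric] by measurable
  have sn: "norm (s x) \<le> 2 * M" for x
    using norm_Pair_le[of "fst (s x)" "snd (s x)"] cpn[of x] cpn[of "b x"] by (simp add: s_def)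
  have s_eq: "AE x in m. s x = (x, b x)"
    using norm_point norm_field by eventually_elim (simp add: s_def closest_point_self)
  obtain F where F: "\<And>i. simple_function m (F i)" "\<And>x. (\<lambda>i. F i x) \<longlonglongrightarrow> s x"
    "\<And>i x. norm (F i x) \<le> 2 * norm (s x)"
    using borel_measurable_implies_sequence_metric[OF s_meas, of 0] by (auto simp: space_m)
  have Fm [measurable]: "F i \<in> borel_measurable m" for i
    using F(1) by (rule borel_measurable_simple_function)
  note [measurable] = s_meas
  have Fn: "norm (F i x) \<le> 4 * M" for i x using F(3)[of i x] sn[of x] by linarith
  have "(\<lambda>i. \<integral>x. norm (F i x - s x) \<partial>m) \<longlonglongrightarrow> (\<integral>x. 0 \<partial>m)"
  proof (rule integral_dominated_convergence[where w = "\<lambda>_. 6 * M"])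
    show "AE x in m. (\<lambda>i. norm (F i x - s x)) \<longlonglongrightarrow> 0"
      using F(2) by (simp add: tendsto_norm_zero_iff LIM_zero_iff)
    show "AE x in m. norm (norm (F i x - s x)) \<le> 6 * M" for i
    proof (intro AE_I2)
      show "norm (norm (F i x - s x)) \<le> 6 * M" for x
        using norm_triangle_ineq4[of "F i x" "s x"] Fn[of i x] sn[of x] by simp
    qed
  qed auto
  then have "(\<lambda>i. \<integral>x. norm (F i x - s x) \<partial>m) \<longlonglongrightarrow> 0" by simp
  from order_tendstoD(2)[OF this assms] obtain i where i: "(\<integral>x. norm (F i x - s x) \<partial>m) < \<delta>"
    by (meson eventually_sequentially order_refl)
  have Fc: "F i \<in> m \<rightarrow>\<^sub>M count_space UNIV"
    using F(1) by (rule measurable_simple_function)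
  define D where "D = distr m (count_space UNIV) (F i)"
  have D: "prob_space D" "sets D = UNIV" using Fc by (auto simp: D_def intro: prob_space_distr)
  have fin: "finite (range (F i))" using simple_functionD(1)[OF F(1)[of i]] by (simp add: space_m)
  have supp: "AE y in D. y \<in> range (F i)" unfolding D_def by (subst AE_distr_iff[OF Fc]) auto
  interpret D: prob_space D by (rule D)
  have "AE y in D. measure D {y} \<noteq> 0"
    using D.AE_support_countable[OF D(2)] supp countable_finite[OF fin] by blast
  then have w: "measure_pmf (Abs_pmf D) = D" using D by (intro Abs_pmf_inverse) auto
  have "AE y in Abs_pmf D. y \<in> range (F i)" unfolding w by (rule supp)
  then have set: "set_pmf (Abs_pmf D) \<subseteq> range (F i)" by (auto simp: AE_measure_pmf_iff)
  show ?thesis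
  proof (rule that[of "Abs_pmf D"])
    show "finite (set_pmf (Abs_pmf D))" using set fin by (rule finite_subset)
    show "set_pmf (Abs_pmf D) \<subseteq> cball 0 (4 * M)" using set Fn by auto
    fix G :: "'a \<times> 'a \<Rightarrow> real" and L
    assume G: "continuous_on UNIV G" and L: "L-lipschitz_on (cball 0 (4 * M)) G"
    have L0: "0 \<le> L" using L by (rule lipschitz_on_nonneg)
    have Gm [measurable]: "G \<in> borel_measurable borel" using G by (rule borel_measurable_continuous_onI)
    have lip: "\<bar>G (F i x) - G (s x)\<bar> \<le> L * norm (F i x - s x)" for x
      using lipschitz_onD[OF L, of "F i x" "s x"] Fn[of i x] sn[of x] M
      by (simp add: dist_norm)
    have eq: "(\<integral>x. G (x, b x) \<partial>m) = (\<integral>x. G (s x) \<partial>m)"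
      using s_eq by (intro integral_cong_AE) (auto simp: borel_prod[symmetric])
    have intF: "integrable m (\<lambda>x. norm (F i x - s x))"
    proof (rule integrable_const_bound[where B = "6 * M"])
      show "AE x in m. norm (norm (F i x - s x)) \<le> 6 * M"
      proof (intro AE_I2)
        show "norm (norm (F i x - s x)) \<le> 6 * M" for x
          using norm_triangle_ineq4[of "F i x" "s x"] Fn[of i x] sn[of x] by simp
      qed
    qed simp
    have int: "integrable m (\<lambda>x. G (F i x))" "integrable m (\<lambda>x. G (s x))"
    proof -
      have "compact (G ` cball 0 (4 * M))"
        using G by (intro compact_continuous_image) (auto intro: continuous_on_subset)
      then obtain C where C: "\<And>y. y \<in> G ` (cball 0 (4 * M)) \<Longrightarrow> norm y \<le> C"
        using compact_imp_bounded bounded_iff by metis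
      have "norm (s x) \<le> 4 * M" for x using sn[of x] M by linarith
      then show "integrable m (\<lambda>x. G (F i x))" "integrable m (\<lambda>x. G (s x))"
        using C Fn by (auto intro!: integrable_const_bound[where B = C])
    qed
    have "measure_pmf.expectation (Abs_pmf D) G = (\<integral>x. G (F i x) \<partial>m)"
      unfolding w unfolding D_def by (rule integral_distr[OF Fc]) simp
    then have "\<bar>measure_pmf.expectation (Abs_pmf D) G - (\<integral>x. G (x, b x) \<partial>m)\<bar> = \<bar>\<integral>x. G (F i x) - G (s x) \<partial>m\<bar>"
      using int by (simp add: eq)
    also have "\<dots> \<le> (\<integral>x. \<bar>G (F i x) - G (s x)\<bar> \<partial>m)" by (rule integral_abs_bound)
    also have "\<dots> \<le> (\<integral>x. L * norm (F i x - s x) \<partial>m)"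
      using int intF by (intro integral_mono lip integrable_abs integrable_mult_right Bochner_Integration.integrable_diff)
    also have "\<dots> = L * (\<integral>x. norm (F i x - s x) \<partial>m)" by simp
    also have "\<dots> \<le> L * \<delta>" using i L0 by (intro mult_left_mono) auto
    finally show "\<bar>measure_pmf.expectation (Abs_pmf D) G - (\<integral>x. G (x, b x) \<partial>m)\<bar> \<le> L * \<delta>" .
  qed
qed


section \<open>One step of an approximate stationary chain\<close>

lemma Max_inner_lipschitz:
  fixes \<beta> :: "'i \<Rightarrow> 'a"
  assumes I: "finite I" "I \<noteq> {}" and L: "\<And>i. i \<in> I \<Longrightarrow> norm (\<beta> i) \<le> L"
  shows "\<bar>Max ((\<lambda>i. \<beta> i \<bullet> y - c i) ` I) - Max ((\<lambda>i. \<beta> i \<bullet> y' - c i) ` I)\<bar> \<le> L * norm (y - y')"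
proof -
  have le: "Max ((\<lambda>i. \<beta> i \<bullet> y - c i) ` I) \<le> Max ((\<lambda>i. \<beta> i \<bullet> y' - c i) ` I) + L * norm (y - y')" for y y'
  proof (rule Max.boundedI)
    fix a assume "a \<in> (\<lambda>i. \<beta> i \<bullet> y - c i) ` I"
    then obtain i where i: "i \<in> I" "a = \<beta> i \<bullet> y - c i" by auto
    have "\<beta> i \<bullet> (y - y') \<le> norm (\<beta> i) * norm (y - y')" by (rule norm_cauchy_schwarz)
    also have "\<dots> \<le> L * norm (y - y')" using L i by (intro mult_right_mono) auto
    finally have "a \<le> (\<beta> i \<bullet> y' - c i) + L * norm (y - y')" using i by (simp add: inner_diff_right)
    moreover have "\<beta> i \<bullet> y' - c i \<le> Max ((\<lambda>i. \<beta> i \<bullet> y' - c i) ` I)" using I i by auto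
    ultimately show "a \<le> Max ((\<lambda>i. \<beta> i \<bullet> y' - c i) ` I) + L * norm (y - y')" by linarith
  qed (use I in auto)
  show ?thesis using le[of y y'] le[of y' y] by (simp add: norm_minus_commute abs_le_iff)
qed

end

lemma finite_pmf_exists:
  fixes f :: "'b \<Rightarrow> real"
  assumes "finite I" "\<And>i. i \<in> I \<Longrightarrow> 0 \<le> f i" "sum f I = 1"
  shows "\<exists>q. set_pmf q \<subseteq> I \<and> (\<forall>i\<in>I. pmf q i = f i)"
proof -
  let ?g = "\<lambda>i. if i \<in> I then f i else 0"
  have "(\<integral>\<^sup>+ i. ennreal (?g i) \<partial>count_space UNIV) = (\<Sum>i\<in>I. ennreal (?g i))"
    using assms(1) by (intro nn_integral_count_space') auto
  also have "\<dots> = ennreal (\<Sum>i\<in>I. f i)" using assms(2) by (simp add: sum_ennreal)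
  also have "\<dots> = 1" using assms(3) by simp
  finally have 1: "(\<integral>\<^sup>+ i. ennreal (?g i) \<partial>count_space UNIV) = 1" .
  have p: "pmf (embed_pmf ?g) i = ?g i" for i
    by (rule pmf_embed_pmf) (use 1 assms(2) in auto)
  then have "set_pmf (embed_pmf ?g) \<subseteq> I" by (auto simp: set_pmf_eq split: if_splits)
  with p show ?thesis by (intro exI[of _ "embed_pmf ?g"]) auto
qed

context invariant_field begin

text \<open>Transfers \<open>convex_order\<close> from \<open>m\<close> to the quantized law and
  feeds it into the coupling theorem. The transfer costs \<open>L * \<delta>\<close> on the left and
  \<open>2 * L * \<delta>\<close> on the right, as the backward point is a 2-Lipschitz function of
  the state for h at most 1. Dividing the coupling by its row masses gives the kernel, and the
  column sums give exact invariance.\<close>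

lemma approximate_chain_step:
  assumes h: "0 < h" "h \<le> 1" and \<kappa>: "0 < \<kappa>"
  obtains w :: "('a \<times> 'a) pmf" and kern where
    "finite (set_pmf w)" "set_pmf w \<subseteq> cball 0 (4 * M)" "bind_pmf w kern = w"
    "measure_pmf.expectation w (\<lambda>i. norm (measure_pmf.expectation (kern i) (\<lambda>j. fst j - h *\<^sub>R snd j) - fst i)) \<le> \<kappa>"
    "\<bar>measure_pmf.expectation w (\<lambda>i. fst i \<bullet> snd i)\<bar> \<le> \<kappa>"
    "\<And>F L. continuous_on UNIV F \<Longrightarrow> L-lipschitz_on UNIV F \<Longrightarrow>
       \<bar>measure_pmf.expectation w F - (\<integral>x. F (x, b x) \<partial>m)\<bar> \<le> L * \<kappa>"
proof -
  \<comment> \<open>\<open>8 * M\<close> is the Lipschitz constant of the inner product of position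
    and velocity on the ball of radius 4 M; since \<open>M\<close> is at least 1, this
    \<open>\<delta>\<close> also satisfies \<open>3 * \<delta> \<le> \<kappa>\<close>, as the order
    condition requires.\<close>
  define \<delta> where "\<delta> = \<kappa> / (8 * M)"
  have M: "0 < M" using M_ge_1 by simp
  have \<delta>: "0 < \<delta>" "3 * \<delta> \<le> \<kappa>" "8 * M * \<delta> = \<kappa>" "\<delta> \<le> \<kappa>"
    using M_ge_1 \<kappa> by (auto simp: \<delta>_def field_simps mult_right_mono)
  obtain w where w: "finite (set_pmf w)" "set_pmf w \<subseteq> cball 0 (4 * M)"
    and wF: "\<And>F L. continuous_on UNIV F \<Longrightarrow> L-lipschitz_on (cball 0 (4 * M)) F \<Longrightarrow>
       \<bar>measure_pmf.expectation w F - (\<integral>x. F (x, b x) \<partial>m)\<bar> \<le> L * \<delta>"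
    using quantization[OF \<delta>(1)] by metis
  let ?I = "set_pmf w"
  let ?z = "\<lambda>j::'a \<times> 'a. fst j - h *\<^sub>R snd j"
  have sumw: "measure_pmf.expectation w F = (\<Sum>i\<in>?I. pmf w i * F i)" for F :: "'a \<times> 'a \<Rightarrow> real"
    using w(1) by (subst integral_measure_pmf[of ?I]) auto
  have cM: "continuous_on UNIV (\<lambda>x. Max ((\<lambda>i. \<beta> i \<bullet> u x - c i) ` ?I))"
    and lM: "(L * K)-lipschitz_on UNIV (\<lambda>x. Max ((\<lambda>i. \<beta> i \<bullet> u x - c i) ` ?I))"
    if u: "K-lipschitz_on UNIV u" and L: "\<And>i. i \<in> ?I \<Longrightarrow> norm (\<beta> i) \<le> L"
    for u :: "'a \<times> 'a \<Rightarrow> 'a" and K c \<beta> L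
  proof -
    obtain i where "i \<in> ?I" using set_pmf_not_empty[of w] by blast
    then have L0: "0 \<le> L" using L[of i] norm_ge_zero order_trans by blast
    have K0: "0 \<le> K" using u by (rule lipschitz_on_nonneg)
    show lM: "(L * K)-lipschitz_on UNIV (\<lambda>x. Max ((\<lambda>i. \<beta> i \<bullet> u x - c i) ` ?I))"
    proof (rule lipschitz_onI)
      fix x y
      have "\<bar>Max ((\<lambda>i. \<beta> i \<bullet> u x - c i) ` ?I) - Max ((\<lambda>i. \<beta> i \<bullet> u y - c i) ` ?I)\<bar> \<le> L * norm (u x - u y)"
        using w L by (intro Max_inner_lipschitz set_pmf_not_empty)
      also have "\<dots> \<le> L * (K * dist x y)"
        using lipschitz_onD[OF u, of x y] L0 by (intro mult_left_mono) (auto simp: dist_norm)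
      finally show "dist (Max ((\<lambda>i. \<beta> i \<bullet> u x - c i) ` ?I)) (Max ((\<lambda>i. \<beta> i \<bullet> u y - c i) ` ?I)) \<le> L * K * dist x y"
        by (simp add: dist_real_def)
    qed (use L0 K0 in simp)
    show "continuous_on UNIV (\<lambda>x. Max ((\<lambda>i. \<beta> i \<bullet> u x - c i) ` ?I))"
      by (rule lipschitz_on_continuous_on[OF lM])
  qed
  have lf: "1-lipschitz_on UNIV (fst :: 'a \<times> 'a \<Rightarrow> 'a)"
    by (rule lipschitz_onI) (auto simp: dist_fst_le)
  have lz: "2-lipschitz_on UNIV ?z"
  proof (rule lipschitz_onI)
    fix x y :: "'a \<times> 'a"
    have "dist (?z x) (?z y) \<le> norm (fst x - fst y) + h * norm (snd x - snd y)"
    proof -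
      have "?z x - ?z y = (fst x - fst y) - h *\<^sub>R (snd x - snd y)" by (simp add: algebra_simps)
      then show ?thesis
        using h norm_triangle_ineq4[of "fst x - fst y" "h *\<^sub>R (snd x - snd y)"]
        unfolding dist_norm by (simp only: norm_scaleR abs_of_pos)
    qed
    also have "\<dots> \<le> dist x y + 1 * dist x y"
      using h dist_fst_le[of x y] dist_snd_le[of x y] by (intro add_mono mult_mono) (auto simp: dist_norm)
    finally show "dist (?z x) (?z y) \<le> 2 * dist x y" by simp
  qed simp
  have order: "(\<Sum>k\<in>?I. pmf w k * Max ((\<lambda>i. \<beta> i \<bullet> fst k - c i) ` ?I))
       \<le> (\<Sum>k\<in>?I. pmf w k * Max ((\<lambda>i. \<beta> i \<bullet> ?z k - c i) ` ?I)) + L * \<kappa>"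
    if L: "\<And>i. i \<in> ?I \<Longrightarrow> norm (\<beta> i) \<le> L" for \<beta> c L
  proof -
    let ?f = "\<lambda>y. Max ((\<lambda>i. \<beta> i \<bullet> y - c i) ` ?I)"
    obtain i where "i \<in> ?I" using set_pmf_not_empty[of w] by blast
    then have L0: "0 \<le> L" using L[of i] norm_ge_zero order_trans by blast
    have "\<bar>measure_pmf.expectation w (\<lambda>k. ?f (fst k)) - (\<integral>x. ?f (fst (x, b x)) \<partial>m)\<bar> \<le> L * 1 * \<delta>"
      by (rule wF[OF cM[OF lf L] lipschitz_on_subset[OF lM[OF lf L]]]) auto
    moreover have "\<bar>measure_pmf.expectation w (\<lambda>k. ?f (?z k)) - (\<integral>x. ?f (?z (x, b x)) \<partial>m)\<bar> \<le> L * 2 * \<delta>"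
      by (rule wF[OF cM[OF lz L] lipschitz_on_subset[OF lM[OF lz L]]]) auto
    moreover have "(\<integral>x. ?f (fst (x, b x)) \<partial>m) \<le> (\<integral>x. ?f (?z (x, b x)) \<partial>m)"
      using convex_order[OF w(1) set_pmf_not_empty, of \<beta> c h] by simp
    moreover have "L * (3 * \<delta>) \<le> L * \<kappa>" using \<delta> L0 by (intro mult_left_mono)
    ultimately have "measure_pmf.expectation w (\<lambda>k. ?f (fst k)) \<le> measure_pmf.expectation w (\<lambda>k. ?f (?z k)) + L * \<kappa>"
      by (simp add: abs_le_iff)
    then show ?thesis unfolding sumw .
  qed
  obtain p where p: "\<And>i j. 0 \<le> p i j"
    "\<And>i. i \<in> ?I \<Longrightarrow> (\<Sum>j\<in>?I. p i j) = pmf w i" "\<And>j. j \<in> ?I \<Longrightarrow> (\<Sum>i\<in>?I. p i j) = pmf w j"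
    "(\<Sum>i\<in>?I. norm ((\<Sum>j\<in>?I. p i j *\<^sub>R ?z j) - pmf w i *\<^sub>R fst i)) \<le> \<kappa>"
  proof (rule approximate_martingale_coupling[of ?I "pmf w" \<kappa> fst ?z])
    show "(\<Sum>k\<in>?I. pmf w k * Max ((\<lambda>i. \<beta> i \<bullet> fst k - c i) ` ?I))
       \<le> (\<Sum>k\<in>?I. pmf w k * Max ((\<lambda>i. \<beta> i \<bullet> ?z k - c i) ` ?I)) + L * \<kappa>"
      if "\<And>i. i \<in> ?I \<Longrightarrow> norm (\<beta> i) \<le> L" for \<beta> c L using that by (rule order)
  qed (use w(1) \<kappa> set_pmf_not_empty that in auto)
  have wpos: "pmf w i > 0" if "i \<in> ?I" for i using that by (rule pmf_positive)
  have "\<exists>q. set_pmf q \<subseteq> ?I \<and> (\<forall>j\<in>?I. pmf q j = p i j / pmf w i)" if "i \<in> ?I" for i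
    using w(1) p wpos[OF that] that
    by (intro finite_pmf_exists) (auto simp flip: sum_divide_distrib)
  then obtain kern where kern: "\<And>i. i \<in> ?I \<Longrightarrow> set_pmf (kern i) \<subseteq> ?I"
    "\<And>i j. i \<in> ?I \<Longrightarrow> j \<in> ?I \<Longrightarrow> pmf (kern i) j = p i j / pmf w i"
    by metis
  show ?thesis
  proof (rule that[of w kern])
    show "bind_pmf w kern = w"
    proof (rule pmf_eqI)
      fix j
      have "pmf (bind_pmf w kern) j = (\<Sum>i\<in>?I. pmf w i * pmf (kern i) j)"
        by (simp add: pmf_bind sumw)
      also have "\<dots> = pmf w j"
      proof (cases "j \<in> ?I")
        case True
        then have "(\<Sum>i\<in>?I. pmf w i * pmf (kern i) j) = (\<Sum>i\<in>?I. p i j)"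
          by (intro sum.cong) (auto simp: kern(2) dest: wpos)
        then show ?thesis using p(3)[OF True] by simp
      next
        case False
        then have "pmf (kern i) j = 0" if "i \<in> ?I" for i
          using kern(1)[OF that] by (auto simp: pmf_eq_0_set_pmf)
        moreover have "pmf w j = 0" using False by (simp add: pmf_eq_0_set_pmf)
        ultimately show ?thesis by simp
      qed
      finally show "pmf (bind_pmf w kern) j = pmf w j" .
    qed
    have "pmf w i * norm (measure_pmf.expectation (kern i) ?z - fst i)
        = norm ((\<Sum>j\<in>?I. p i j *\<^sub>R ?z j) - pmf w i *\<^sub>R fst i)" if i: "i \<in> ?I" for i
    proof -
      have "measure_pmf.expectation (kern i) ?z = (\<Sum>j\<in>?I. pmf (kern i) j *\<^sub>R ?z j)"
        using w(1) kern(1)[OF i] by (intro integral_measure_pmf) auto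
      also have "\<dots> = (\<Sum>j\<in>?I. (p i j / pmf w i) *\<^sub>R ?z j)"
        using kern(2)[OF i] by (intro sum.cong) auto
      finally have "pmf w i *\<^sub>R measure_pmf.expectation (kern i) ?z = (\<Sum>j\<in>?I. p i j *\<^sub>R ?z j)"
        using wpos[OF i] by (simp add: scaleR_sum_right)
      moreover have "pmf w i * norm (measure_pmf.expectation (kern i) ?z - fst i)
        = norm (pmf w i *\<^sub>R measure_pmf.expectation (kern i) ?z - pmf w i *\<^sub>R fst i)"
        by (simp flip: scaleR_diff_right)
      ultimately show ?thesis by simp
    qed
    then show "measure_pmf.expectation w (\<lambda>i. norm (measure_pmf.expectation (kern i) ?z - fst i)) \<le> \<kappa>"
      using p(4) by (simp add: sumw)
    show "\<bar>measure_pmf.expectation w (\<lambda>i. fst i \<bullet> snd i)\<bar> \<le> \<kappa>"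
    proof -
      have lip: "(8 * M)-lipschitz_on (cball 0 (4 * M)) (\<lambda>i::'a \<times> 'a. fst i \<bullet> snd i)"
      proof (rule lipschitz_onI)
        fix x y :: "'a \<times> 'a" assume xy: "x \<in> cball 0 (4 * M)" "y \<in> cball 0 (4 * M)"
        have "\<bar>fst x \<bullet> snd x - fst y \<bullet> snd y\<bar> = \<bar>(fst x - fst y) \<bullet> snd x + fst y \<bullet> (snd x - snd y)\<bar>"
          by (simp add: algebra_simps)
        also have "\<dots> \<le> norm (fst x - fst y) * norm (snd x) + norm (fst y) * norm (snd x - snd y)"
          by (intro order_trans[OF abs_triangle_ineq] add_mono Cauchy_Schwarz_ineq2)
        also have "\<dots> \<le> dist x y * (4 * M) + (4 * M) * dist x y"
          using xy dist_fst_le[of x y] dist_snd_le[of x y] dist_fst_le[of y 0] dist_snd_le[of x 0] M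
          by (intro add_mono mult_mono) (auto simp: dist_norm intro: order_trans)
        finally show "dist (fst x \<bullet> snd x) (fst y \<bullet> snd y) \<le> 8 * M * dist x y"
          by (simp add: dist_real_def)
      qed (use M in simp)
      have "\<bar>measure_pmf.expectation w (\<lambda>i. fst i \<bullet> snd i) - (\<integral>x. fst (x, b x) \<bullet> snd (x, b x) \<partial>m)\<bar> \<le> 8 * M * \<delta>"
        by (rule wF[OF _ lip]) (intro continuous_intros)
      moreover have "((\<lambda>x::'a. (x \<bullet> x) / 2) has_derivative (\<lambda>h. x \<bullet> h)) (at x)" for x
        by (auto intro!: derivative_eq_intros simp: inner_commute)
      then have "frechet_derivative (\<lambda>x::'a. (x \<bullet> x) / 2) (at x) (b x) = x \<bullet> b x" for x
        using frechet_derivative_at by metis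
      then have "(\<integral>x. x \<bullet> b x \<partial>m) = 0"
        using divergence_free[OF smooth_fun_half_norm_squared] by simp
      ultimately show ?thesis using \<delta> by simp
    qed
    show "\<bar>measure_pmf.expectation w F - (\<integral>x. F (x, b x) \<partial>m)\<bar> \<le> L * \<kappa>"
      if F: "continuous_on UNIV F" and L: "L-lipschitz_on UNIV F" for F L
    proof -
      have "\<bar>measure_pmf.expectation w F - (\<integral>x. F (x, b x) \<partial>m)\<bar> \<le> L * \<delta>"
        by (rule wF[OF F lipschitz_on_subset[OF L]]) auto
      also have "\<dots> \<le> L * \<kappa>" using \<delta> lipschitz_on_nonneg[OF L] by (intro mult_left_mono)
      finally show ?thesis .
    qed
  qed (use w in auto)
qed

end

section \<open>Stationary chains\<close>

primrec path_pmf :: "('s \<Rightarrow> 's pmf) \<Rightarrow> nat \<Rightarrow> 's \<Rightarrow> 's list pmf" where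
  "path_pmf kern 0 i = return_pmf [i]"
| "path_pmf kern (Suc k) i = bind_pmf (kern i) (\<lambda>j. map_pmf ((#) i) (path_pmf kern k j))"

definition chain_pmf :: "'s pmf \<Rightarrow> ('s \<Rightarrow> 's pmf) \<Rightarrow> nat \<Rightarrow> 's list pmf" where
  "chain_pmf w kern n = bind_pmf w (path_pmf kern n)"

lemma length_path_pmf: "l \<in> set_pmf (path_pmf kern k i) \<Longrightarrow> length l = Suc k"
  by (induction k arbitrary: i l) auto

lemma hd_path_pmf: "l \<in> set_pmf (path_pmf kern k i) \<Longrightarrow> hd l = i"
  by (induction k arbitrary: i l) auto

lemma length_chain_pmf: "l \<in> set_pmf (chain_pmf w kern n) \<Longrightarrow> length l = Suc n"
  by (auto simp: chain_pmf_def dest: length_path_pmf)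

lemma take_path_pmf: "m \<le> n \<Longrightarrow> map_pmf (take (Suc m)) (path_pmf kern n i) = path_pmf kern m i"
proof (induction n arbitrary: m i)
  case (Suc n)
  show ?case
  proof (cases m)
    case 0
    then show ?thesis
      by (simp add: map_bind_pmf pmf.map_comp o_def bind_pmf_const)
  next
    case (Suc m')
    then have *: "path_pmf kern m' j = map_pmf (take (Suc m')) (path_pmf kern n j)" for j
      using Suc.IH Suc.prems by simp
    show ?thesis
      by (simp add: Suc * map_bind_pmf pmf.map_comp o_def)
  qed
qed simp

lemma take_chain_pmf: "m \<le> n \<Longrightarrow> map_pmf (take (Suc m)) (chain_pmf w kern n) = chain_pmf w kern m"
  by (simp add: chain_pmf_def map_bind_pmf take_path_pmf)

lemma tl_chain_pmf:
  assumes "bind_pmf w kern = w"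
  shows "map_pmf tl (chain_pmf w kern (Suc n)) = chain_pmf w kern n"
proof -
  have "map_pmf tl (chain_pmf w kern (Suc n)) = bind_pmf w (\<lambda>i. bind_pmf (kern i) (path_pmf kern n))"
    by (simp add: chain_pmf_def map_bind_pmf pmf.map_comp o_def)
  also have "\<dots> = chain_pmf w kern n"
    using assms by (simp add: chain_pmf_def bind_assoc_pmf[symmetric])
  finally show ?thesis .
qed

lemma drop_chain_pmf:
  assumes "bind_pmf w kern = w"
  shows "map_pmf (drop a) (chain_pmf w kern (a + n)) = chain_pmf w kern n"
proof (induction a)
  case (Suc a)
  have "map_pmf (drop (Suc a)) (chain_pmf w kern (Suc a + n))
    = map_pmf (drop a) (map_pmf tl (chain_pmf w kern (Suc (a + n))))"
    unfolding pmf.map_comp by (intro map_pmf_cong) (auto simp: drop_Suc)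
  then show ?case by (simp only: tl_chain_pmf[OF assms] Suc)
qed simp

text \<open>Cutting off the end uses only the recursive construction of paths; cutting off the
  beginning uses the invariance of \<open>w\<close>. Together they express stationarity: the law of
  a window does not depend on where it starts.\<close>

lemma window_chain_pmf:
  assumes "bind_pmf w kern = w" "a + m \<le> n"
  shows "map_pmf (\<lambda>l. take (Suc m) (drop a l)) (chain_pmf w kern n) = chain_pmf w kern m"
proof -
  have "map_pmf (\<lambda>l. take (Suc m) (drop a l)) (chain_pmf w kern (a + (n - a)))
    = map_pmf (take (Suc m)) (map_pmf (drop a) (chain_pmf w kern (a + (n - a))))"
    by (simp add: pmf.map_comp o_def)
  also have "\<dots> = chain_pmf w kern m"
    using assms by (simp only: drop_chain_pmf[OF assms(1)] take_chain_pmf)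
  finally show ?thesis using assms by simp
qed

lemma chain_pmf_0: "chain_pmf w kern 0 = map_pmf (\<lambda>i. [i]) w"
  unfolding chain_pmf_def map_pmf_def by (rule bind_pmf_cong) simp_all

lemma nth_chain_pmf:
  assumes "bind_pmf w kern = w" "a \<le> n"
  shows "map_pmf (\<lambda>l. l ! a) (chain_pmf w kern n) = w"
proof -
  have "map_pmf (\<lambda>l. l ! a) (chain_pmf w kern n) = map_pmf hd (map_pmf (\<lambda>l. take (Suc 0) (drop a l)) (chain_pmf w kern n))"
    unfolding pmf.map_comp using assms
    by (intro map_pmf_cong) (auto dest!: length_chain_pmf simp: hd_drop_conv_nth hd_take)
  then show ?thesis
    by (subst (asm) window_chain_pmf) (use assms in \<open>auto simp: chain_pmf_0 pmf.map_comp o_def\<close>)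
qed

lemma set_path_pmf:
  assumes "\<And>i. i \<in> S \<Longrightarrow> set_pmf (kern i) \<subseteq> S" "i \<in> S" "l \<in> set_pmf (path_pmf kern k i)"
  shows "set l \<subseteq> S"
  using assms(2,3)
proof (induction k arbitrary: i l)
  case (Suc k)
  then obtain j l' where "j \<in> set_pmf (kern i)" "l' \<in> set_pmf (path_pmf kern k j)" "l = i # l'" by auto
  with Suc.IH[of j l'] Suc.prems assms(1)[of i] show ?case by auto
qed simp

lemma finite_path_pmf:
  assumes "\<And>i. i \<in> S \<Longrightarrow> set_pmf (kern i) \<subseteq> S" "finite S" "i \<in> S"
  shows "finite (set_pmf (path_pmf kern k i))"
proof (rule finite_subset)
  show "set_pmf (path_pmf kern k i) \<subseteq> {l. set l \<subseteq> S \<and> length l = Suc k}"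
    using set_path_pmf[of S kern i _ k, OF assms(1,3)] length_path_pmf[of _ kern k i] by blast
  show "finite {l. set l \<subseteq> S \<and> length l = Suc k}"
    using assms(2) by (rule finite_lists_length_eq)
qed

lemma bind_pmf_invariant_support:
  assumes "bind_pmf w kern = w" "i \<in> set_pmf w"
  shows "set_pmf (kern i) \<subseteq> set_pmf w"
proof -
  have "set_pmf (kern i) \<subseteq> set_pmf (bind_pmf w kern)" using assms(2) by auto
  then show ?thesis by (simp add: assms(1))
qed

lemma set_chain_pmf:
  assumes "bind_pmf w kern = w" "l \<in> set_pmf (chain_pmf w kern n)"
  shows "set l \<subseteq> set_pmf w"
proof -
  obtain i where "i \<in> set_pmf w" "l \<in> set_pmf (path_pmf kern n i)"
    using assms(2) by (auto simp: chain_pmf_def)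
  then show ?thesis
    using set_path_pmf[of "set_pmf w" kern i l n] bind_pmf_invariant_support[OF assms(1)] by blast
qed

lemma finite_chain_pmf:
  assumes "bind_pmf w kern = w" "finite (set_pmf w)"
  shows "finite (set_pmf (chain_pmf w kern n))"
  using assms finite_path_pmf[of "set_pmf w" kern] bind_pmf_invariant_support[OF assms(1)]
  by (auto simp: chain_pmf_def)


section \<open>Mean-square size of the defect\<close>

lemma expectation_bind_pmf_finite:
  fixes f :: "'b \<Rightarrow> 'c::{banach, second_countable_topology}"
  assumes "finite (set_pmf p)" "\<And>x. x \<in> set_pmf p \<Longrightarrow> finite (set_pmf (q x))"
  shows "measure_pmf.expectation (bind_pmf p q) f
    = measure_pmf.expectation p (\<lambda>x. measure_pmf.expectation (q x) f)"
  using assms by (subst pmf_expectation_bind[of "set_pmf p"]) (auto simp: integral_measure_pmf[of "set_pmf p"])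

text \<open>The accumulated deviation of a path from the backward Euler scheme; up to the slack \<open>\<kappa>\<close> below it
  is a martingale along the chain.\<close>

fun defect :: "real \<Rightarrow> ('a::euclidean_space \<times> 'a) list \<Rightarrow> 'a" where
  "defect h (i # j # l) = (fst j - h *\<^sub>R snd j - fst i) + defect h (j # l)"
| "defect h _ = 0"

lemma defect_Cons: "l \<noteq> [] \<Longrightarrow> defect h (i # l) = (fst (hd l) - h *\<^sub>R snd (hd l) - fst i) + defect h l"
  by (cases l) auto

text \<open>The positions telescope. The index \<open>Suc i\<close> shows that each step uses the
  velocity at its end, so the initial velocity never enters.\<close>

lemma defect_eq:
  "length l = Suc k \<Longrightarrow> defect h l = fst (l ! k) - fst (l ! 0) - (\<Sum>i<k. h *\<^sub>R snd (l ! Suc i))"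
proof (induction k arbitrary: l)
  case 0
  then show ?case by (auto simp: length_Suc_conv)
next
  case (Suc k)
  then obtain i j l' where l: "l = i # j # l'" by (metis length_Suc_conv)
  then show ?case using Suc.IH[of "j # l'"] Suc.prems
    by (simp add: sum.lessThan_Suc_shift del: sum.lessThan_Suc)
qed

text \<open>Only averaged errors are available: the martingale property holds up to
  \<open>\<kappa>\<close> in \<open>w\<close>-mean, not state by state. \<open>orthogonal\<close> is
  what remains of the orthogonality of x and b(x) under \<open>m\<close>; it controls the variance
  of one increment.\<close>

locale approximate_chain =
  fixes w :: "('a::euclidean_space \<times> 'a) pmf" and kern :: "'a \<times> 'a \<Rightarrow> ('a \<times> 'a) pmf" and h C \<kappa> :: real
  assumes fin: "finite (set_pmf w)" and invar: "bind_pmf w kern = w"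
    and h: "0 < h" "h \<le> 1" and C: "1 \<le> C" and \<kappa>: "0 \<le> \<kappa>"
    and bound: "\<And>i. i \<in> set_pmf w \<Longrightarrow> norm (fst i) \<le> C" "\<And>i. i \<in> set_pmf w \<Longrightarrow> norm (snd i) \<le> C"
    and martingale: "measure_pmf.expectation w (\<lambda>i. norm (measure_pmf.expectation (kern i) (\<lambda>j. fst j - h *\<^sub>R snd j) - fst i)) \<le> \<kappa>"
    and orthogonal: "\<bar>measure_pmf.expectation w (\<lambda>i. fst i \<bullet> snd i)\<bar> \<le> \<kappa>"
begin

abbreviation E where "E p f \<equiv> measure_pmf.expectation p f"

abbreviation backstep where "backstep j \<equiv> fst j - h *\<^sub>R snd j"

lemma kern_support: "i \<in> set_pmf w \<Longrightarrow> set_pmf (kern i) \<subseteq> set_pmf w"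
  using bind_pmf_invariant_support[OF invar] .

lemma kern_finite: "i \<in> set_pmf w \<Longrightarrow> finite (set_pmf (kern i))"
  using kern_support fin by (rule finite_subset)

lemma path_finite: "i \<in> set_pmf w \<Longrightarrow> finite (set_pmf (path_pmf kern k i))"
  using finite_path_pmf[of "set_pmf w" kern] kern_support fin by blast

lemma integrable_w [simp]: "integrable (measure_pmf w) (f :: _ \<Rightarrow> 'b::{banach, second_countable_topology})"
  by (rule integrable_measure_pmf_finite[OF fin])

lemma integrable_kern [simp]: "i \<in> set_pmf w \<Longrightarrow> integrable (measure_pmf (kern i)) (f :: _ \<Rightarrow> 'b::{banach, second_countable_topology})"
  by (rule integrable_measure_pmf_finite[OF kern_finite])

lemma integrable_path [simp]: "i \<in> set_pmf w \<Longrightarrow> integrable (measure_pmf (path_pmf kern k i)) (f :: _ \<Rightarrow> 'b::{banach, second_countable_topology})"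
  by (rule integrable_measure_pmf_finite[OF path_finite])

lemma expectation_mono_w:
  "(\<And>i. i \<in> set_pmf w \<Longrightarrow> f i \<le> g i) \<Longrightarrow> E w f \<le> E w (g :: _ \<Rightarrow> real)"
  by (intro integral_mono_AE) (auto simp: AE_measure_pmf_iff)

lemma expectation_cong_pmf: "(\<And>i. i \<in> set_pmf p \<Longrightarrow> f i = g i) \<Longrightarrow> E p f = E p (g :: _ \<Rightarrow> 'b::{banach, second_countable_topology})"
  by (intro integral_cong_AE) (auto simp: AE_measure_pmf_iff)

lemma expectation_kern: "E w (\<lambda>i. E (kern i) f) = E w (f :: _ \<Rightarrow> 'b::{banach, second_countable_topology})"
  using expectation_bind_pmf_finite[of w kern f, OF fin kern_finite] by (simp add: invar)

lemma expectation_path_Suc: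
  fixes f :: "_ \<Rightarrow> 'b::{banach, second_countable_topology}"
  assumes "i \<in> set_pmf w"
  shows "E (path_pmf kern (Suc k) i) f = E (kern i) (\<lambda>j. E (path_pmf kern k j) (\<lambda>l. f (i # l)))"
  using kern_support[OF assms] path_finite by (simp, subst expectation_bind_pmf_finite) (auto simp: kern_finite assms)

definition mean_defect where "mean_defect k i = E (path_pmf kern k i) (defect h)"

lemma mean_defect_Suc:
  assumes i: "i \<in> set_pmf w"
  shows "mean_defect (Suc k) i = (E (kern i) backstep - fst i) + E (kern i) (mean_defect k)"
proof -
  have "E (path_pmf kern k j) (\<lambda>l. defect h (i # l)) = (backstep j - fst i) + mean_defect k j" if "j \<in> set_pmf (kern i)" for j
  proof -
    have j: "j \<in> set_pmf w" using that kern_support[OF i] by auto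
    have "E (path_pmf kern k j) (\<lambda>l. defect h (i # l)) = E (path_pmf kern k j) (\<lambda>l. (backstep j - fst i) + defect h l)"
      by (intro expectation_cong_pmf, subst defect_Cons) (auto dest: length_path_pmf hd_path_pmf)
    then show ?thesis using j by (simp add: mean_defect_def)
  qed
  then have "mean_defect (Suc k) i = E (kern i) (\<lambda>j. (backstep j - fst i) + mean_defect k j)"
    unfolding mean_defect_def[of "Suc k"] expectation_path_Suc[OF i] by (rule expectation_cong_pmf)
  then show ?thesis using i by simp
qed

text \<open>\<open>mean_defect\<close> is the conditional mean of the defect given the initial
  state, zero for an exact martingale. Each step adds one drift, and invariance of \<open>w\<close>
  lets its average be taken at any time, so it costs \<open>\<kappa>\<close>.\<close>

lemma expectation_norm_mean_defect: "E w (\<lambda>i. norm (mean_defect k i)) \<le> real k * \<kappa>"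
proof (induction k)
  case 0
  show ?case by (simp add: mean_defect_def)
next
  case (Suc k)
  have "E w (\<lambda>i. norm (mean_defect (Suc k) i)) \<le> E w (\<lambda>i. norm (E (kern i) backstep - fst i) + E (kern i) (\<lambda>j. norm (mean_defect k j)))"
    using integral_norm_bound by (intro expectation_mono_w) (auto simp: mean_defect_Suc intro!: norm_triangle_le)
  also have "\<dots> = E w (\<lambda>i. norm (E (kern i) backstep - fst i)) + E w (\<lambda>i. norm (mean_defect k i))"
    by (simp add: expectation_kern)
  also have "\<dots> \<le> \<kappa> + real k * \<kappa>" by (intro add_mono martingale Suc)
  finally show ?case by (simp add: algebra_simps)
qed

lemma norm_increment: "i \<in> set_pmf w \<Longrightarrow> j \<in> set_pmf w \<Longrightarrow> norm (backstep j - fst i) \<le> 3 * C"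
proof -
  assume ij: "i \<in> set_pmf w" "j \<in> set_pmf w"
  have "norm (backstep j - fst i) \<le> norm (fst j) + h * norm (snd j) + norm (fst i)"
    using h norm_triangle_ineq4[of "backstep j" "fst i"] norm_triangle_ineq4[of "fst j" "h *\<^sub>R snd j"] by simp
  also have "\<dots> \<le> C + 1 * C + C" using ij bound h C by (intro add_mono mult_mono) auto
  finally show ?thesis by simp
qed

text \<open>After expanding the square, the approximate martingale property replaces the cross term
  by the second moment of \<open>fst i\<close>. Both ends of a step have law \<open>w\<close>, so
  the second moments of position cancel, and what remains is \<open>h\<^sup>2\<close> times the
  squared speed and a multiple of the small correlation in \<open>orthogonal\<close>. That
  correlation and the drift error cost \<open>2 * C * \<kappa>\<close> each.\<close>

lemma expectation_increment_squared:
  "E w (\<lambda>i. E (kern i) (\<lambda>j. (norm (backstep j - fst i))\<^sup>2)) \<le> h\<^sup>2 * C\<^sup>2 + 4 * C * \<kappa>"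
proof -
  have "E (kern i) (\<lambda>j. (norm (backstep j - fst i))\<^sup>2)
     = E (kern i) (\<lambda>j. (norm (backstep j))\<^sup>2) - (norm (fst i))\<^sup>2 - 2 * ((E (kern i) backstep - fst i) \<bullet> fst i)"
    if i: "i \<in> set_pmf w" for i
  proof -
    have "E (kern i) (\<lambda>j. (norm (backstep j - fst i))\<^sup>2) = E (kern i) (\<lambda>j. (norm (backstep j))\<^sup>2 + (norm (fst i))\<^sup>2 - 2 * (backstep j \<bullet> fst i))"
      by (intro Bochner_Integration.integral_cong) (auto simp: power2_norm_eq_inner inner_simps inner_commute)
    also have "\<dots> = E (kern i) (\<lambda>j. (norm (backstep j))\<^sup>2) + (norm (fst i))\<^sup>2 - 2 * (E (kern i) backstep \<bullet> fst i)"
      using i by (simp only: Bochner_Integration.integral_diff Bochner_Integration.integral_add integrable_kern integral_mult_right_zero integral_inner_left)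
        simp
    also have "\<dots> = E (kern i) (\<lambda>j. (norm (backstep j))\<^sup>2) - (norm (fst i))\<^sup>2 - 2 * ((E (kern i) backstep - fst i) \<bullet> fst i)"
      by (simp add: inner_diff_left power2_norm_eq_inner)
    finally show ?thesis .
  qed
  then have "E w (\<lambda>i. E (kern i) (\<lambda>j. (norm (backstep j - fst i))\<^sup>2))
    = E w (\<lambda>i. E (kern i) (\<lambda>j. (norm (backstep j))\<^sup>2) - (norm (fst i))\<^sup>2 - 2 * ((E (kern i) backstep - fst i) \<bullet> fst i))"
    by (rule expectation_cong_pmf)
  also have "\<dots> = E w (\<lambda>i. (norm (backstep i))\<^sup>2) - E w (\<lambda>i. (norm (fst i))\<^sup>2) - 2 * E w (\<lambda>i. (E (kern i) backstep - fst i) \<bullet> fst i)"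
    by (simp add: expectation_kern)
  also have "E w (\<lambda>i. (norm (backstep i))\<^sup>2) = E w (\<lambda>i. (norm (fst i))\<^sup>2 - 2 * h * (fst i \<bullet> snd i) + h\<^sup>2 * (norm (snd i))\<^sup>2)"
    by (intro Bochner_Integration.integral_cong refl)
       (simp only: power2_norm_eq_inner, simp add: inner_simps inner_commute power2_eq_square algebra_simps)
  also have "\<dots> = E w (\<lambda>i. (norm (fst i))\<^sup>2) - 2 * h * E w (\<lambda>i. fst i \<bullet> snd i) + h\<^sup>2 * E w (\<lambda>i. (norm (snd i))\<^sup>2)"
    by simp
  finally have eq: "E w (\<lambda>i. E (kern i) (\<lambda>j. (norm (backstep j - fst i))\<^sup>2))
    = h\<^sup>2 * E w (\<lambda>i. (norm (snd i))\<^sup>2) - 2 * h * E w (\<lambda>i. fst i \<bullet> snd i) - 2 * E w (\<lambda>i. (E (kern i) backstep - fst i) \<bullet> fst i)"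
    by simp
  have "E w (\<lambda>i. (norm (snd i))\<^sup>2) \<le> E w (\<lambda>_. C\<^sup>2)"
    using bound by (intro expectation_mono_w power_mono) auto
  then have 1: "h\<^sup>2 * E w (\<lambda>i. (norm (snd i))\<^sup>2) \<le> h\<^sup>2 * C\<^sup>2" by (intro mult_left_mono) auto
  have "- (2 * h * e) \<le> 2 * h * \<kappa>" if "\<bar>e\<bar> \<le> \<kappa>" for e :: real
  proof -
    have "2 * h * (- e) \<le> 2 * h * \<kappa>" using that h by (intro mult_left_mono) auto
    then show ?thesis by (simp only: mult_minus_right)
  qed
  from this[OF orthogonal] have "- (2 * h * E w (\<lambda>i. fst i \<bullet> snd i)) \<le> 2 * h * \<kappa>" .
  also have "\<dots> \<le> 2 * C * \<kappa>" using h C \<kappa> by (intro mult_right_mono) auto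
  finally have 2: "- (2 * h * E w (\<lambda>i. fst i \<bullet> snd i)) \<le> 2 * C * \<kappa>" .
  have "E w (\<lambda>i. - ((E (kern i) backstep - fst i) \<bullet> fst i)) \<le> E w (\<lambda>i. norm (E (kern i) backstep - fst i) * C)"
  proof (rule expectation_mono_w)
    fix i assume i: "i \<in> set_pmf w"
    have "- ((E (kern i) backstep - fst i) \<bullet> fst i) \<le> norm (E (kern i) backstep - fst i) * norm (fst i)"
      using Cauchy_Schwarz_ineq2[of "E (kern i) backstep - fst i" "fst i"] by linarith
    also have "\<dots> \<le> norm (E (kern i) backstep - fst i) * C" using bound(1)[OF i] by (intro mult_left_mono) auto
    finally show "- ((E (kern i) backstep - fst i) \<bullet> fst i) \<le> norm (E (kern i) backstep - fst i) * C" .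
  qed
  also have "\<dots> \<le> \<kappa> * C" using martingale C by (simp add: mult_right_mono)
  finally have "- E w (\<lambda>i. (E (kern i) backstep - fst i) \<bullet> fst i) \<le> \<kappa> * C"
    by (simp only: Bochner_Integration.integral_minus)
  moreover have "- (2 * e) \<le> 2 * C * \<kappa>" if "- e \<le> \<kappa> * C" for e using that by (simp add: mult.commute)
  ultimately have 3: "- (2 * E w (\<lambda>i. (E (kern i) backstep - fst i) \<bullet> fst i)) \<le> 2 * C * \<kappa>" by blast
  show ?thesis unfolding eq using 1 2 3 by simp
qed

definition mean_square_defect where "mean_square_defect k = E (chain_pmf w kern k) (\<lambda>l. (norm (defect h l))\<^sup>2)"

lemma mean_square_defect_eq: "mean_square_defect k = E w (\<lambda>i. E (path_pmf kern k i) (\<lambda>l. (norm (defect h l))\<^sup>2))"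
  unfolding mean_square_defect_def chain_pmf_def by (rule expectation_bind_pmf_finite[OF fin path_finite])

text \<open>Near-orthogonality of martingale increments. Conditioning on the second state turns the
  cross term into the increment against \<open>mean_defect\<close>: the increment is only bounded,
  by \<open>3 * C\<close>, but the other factor has mean at most \<open>real k * \<kappa>\<close>.
  The resulting \<open>6 * C * real k * \<kappa>\<close> and the \<open>4 * C * \<kappa>\<close> of
  a single increment are absorbed in the constant 10.\<close>

lemma mean_square_defect_Suc: "mean_square_defect (Suc k) \<le> mean_square_defect k + (h\<^sup>2 * C\<^sup>2 + 10 * C * (real k + 1) * \<kappa>)"
proof -
  have sq: "(norm (u + v))\<^sup>2 = (norm u)\<^sup>2 + 2 * (u \<bullet> v) + (norm v)\<^sup>2" for u v :: 'a
    by (simp add: power2_norm_eq_inner inner_add_left inner_add_right inner_commute)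
  let ?B = "\<lambda>j. E (path_pmf kern k j) (\<lambda>l. (norm (defect h l))\<^sup>2)"
  have "E (path_pmf kern (Suc k) i) (\<lambda>l. (norm (defect h l))\<^sup>2)
    \<le> E (kern i) (\<lambda>j. (norm (backstep j - fst i))\<^sup>2) + 6 * C * E (kern i) (\<lambda>j. norm (mean_defect k j)) + E (kern i) ?B"
    if i: "i \<in> set_pmf w" for i
  proof -
    have "E (path_pmf kern k j) (\<lambda>l. (norm (defect h (i # l)))\<^sup>2)
       \<le> (norm (backstep j - fst i))\<^sup>2 + 6 * C * norm (mean_defect k j) + ?B j" if "j \<in> set_pmf (kern i)" for j
    proof -
      have j: "j \<in> set_pmf w" using that kern_support[OF i] by auto
      have "E (path_pmf kern k j) (\<lambda>l. (norm (defect h (i # l)))\<^sup>2)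
         = E (path_pmf kern k j) (\<lambda>l. (norm (backstep j - fst i))\<^sup>2 + 2 * ((backstep j - fst i) \<bullet> defect h l) + (norm (defect h l))\<^sup>2)"
      proof (rule expectation_cong_pmf)
        fix l assume "l \<in> set_pmf (path_pmf kern k j)"
        then have "l \<noteq> []" "hd l = j" by (auto dest: length_path_pmf hd_path_pmf)
        then have d: "defect h (i # l) = (backstep j - fst i) + defect h l" by (simp add: defect_Cons)
        show "(norm (defect h (i # l)))\<^sup>2 = (norm (backstep j - fst i))\<^sup>2 + 2 * ((backstep j - fst i) \<bullet> defect h l) + (norm (defect h l))\<^sup>2"
          unfolding d by (rule sq)
      qed
      also have "\<dots> = (norm (backstep j - fst i))\<^sup>2 + 2 * ((backstep j - fst i) \<bullet> mean_defect k j) + ?B j"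
        using j by (simp add: mean_defect_def)
      also have "(backstep j - fst i) \<bullet> mean_defect k j \<le> norm (backstep j - fst i) * norm (mean_defect k j)" by (rule norm_cauchy_schwarz)
      also have "norm (backstep j - fst i) * norm (mean_defect k j) \<le> 3 * C * norm (mean_defect k j)"
        using norm_increment[OF i j] by (intro mult_right_mono) auto
      finally show ?thesis by simp
    qed
    then have "E (kern i) (\<lambda>j. E (path_pmf kern k j) (\<lambda>l. (norm (defect h (i # l)))\<^sup>2))
      \<le> E (kern i) (\<lambda>j. (norm (backstep j - fst i))\<^sup>2 + 6 * C * norm (mean_defect k j) + ?B j)"
      using i by (intro integral_mono_AE) (auto simp: AE_measure_pmf_iff)
    then show ?thesis unfolding expectation_path_Suc[OF i] using i by simp
  qed
  then have "mean_square_defect (Suc k) \<le> E w (\<lambda>i. E (kern i) (\<lambda>j. (norm (backstep j - fst i))\<^sup>2) + 6 * C * E (kern i) (\<lambda>j. norm (mean_defect k j)) + E (kern i) ?B)"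
    unfolding mean_square_defect_eq by (rule expectation_mono_w)
  also have "\<dots> = E w (\<lambda>i. E (kern i) (\<lambda>j. (norm (backstep j - fst i))\<^sup>2)) + 6 * C * E w (\<lambda>j. norm (mean_defect k j)) + mean_square_defect k"
    by (simp add: expectation_kern mean_square_defect_eq)
  also have "\<dots> \<le> (h\<^sup>2 * C\<^sup>2 + 4 * C * \<kappa>) + 6 * C * (real k * \<kappa>) + mean_square_defect k"
    using C by (intro add_mono expectation_increment_squared mult_left_mono expectation_norm_mean_defect) auto
  also have "\<dots> \<le> mean_square_defect k + (h\<^sup>2 * C\<^sup>2 + 10 * C * (real k + 1) * \<kappa>)"
    using C \<kappa> by (simp add: algebra_simps)
  finally show ?thesis .
qed

lemma mean_square_defect_le: "mean_square_defect k \<le> real k * (h\<^sup>2 * C\<^sup>2 + 10 * C * real k * \<kappa>)"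
proof (induction k)
  case 0
  show ?case by (simp add: mean_square_defect_def chain_pmf_0)
next
  case (Suc k)
  have "10 * C * real k * \<kappa> \<le> 10 * C * real (Suc k) * \<kappa>"
    using C \<kappa> by (intro mult_right_mono mult_left_mono) auto
  then have "real k * (h\<^sup>2 * C\<^sup>2 + 10 * C * real k * \<kappa>) \<le> real k * (h\<^sup>2 * C\<^sup>2 + 10 * C * real (Suc k) * \<kappa>)"
    by (intro mult_left_mono) auto
  with Suc mean_square_defect_Suc[of k] show ?case by (simp add: algebra_simps)
qed

lemma expectation_norm_defect:
  assumes "k \<le> n"
  shows "E (chain_pmf w kern k) (\<lambda>l. norm (defect h l)) \<le> sqrt (real n * (h\<^sup>2 * C\<^sup>2 + 10 * C * real n * \<kappa>))"
proof (rule real_le_rsqrt)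
  let ?p = "chain_pmf w kern k"
  have int: "integrable (measure_pmf ?p) (f :: _ \<Rightarrow> real)" for f
    by (rule integrable_measure_pmf_finite[OF finite_chain_pmf[OF invar fin]])
  \<comment> \<open>A nonnegative variance bounds the squared mean by the mean square.\<close>
  have "0 \<le> measure_pmf.variance ?p (\<lambda>l. norm (defect h l))" by (rule measure_pmf.variance_positive)
  then have "(E ?p (\<lambda>l. norm (defect h l)))\<^sup>2 \<le> mean_square_defect k"
    by (subst (asm) measure_pmf.variance_eq) (auto simp: int mean_square_defect_def)
  also have "\<dots> \<le> real k * (h\<^sup>2 * C\<^sup>2 + 10 * C * real k * \<kappa>)" by (rule mean_square_defect_le)
  also have "\<dots> \<le> real n * (h\<^sup>2 * C\<^sup>2 + 10 * C * real n * \<kappa>)"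
    using assms C \<kappa> by (intro mult_mono add_mono) auto
  finally show "(E ?p (\<lambda>l. norm (defect h l)))\<^sup>2 \<le> real n * (h\<^sup>2 * C\<^sup>2 + 10 * C * real n * \<kappa>)" .
qed

end

section \<open>Displacement and consistency estimates along the chain\<close>

context approximate_chain begin

definition defect_bound where "defect_bound K = sqrt (real K * (h\<^sup>2 * C\<^sup>2 + 10 * C * real K * \<kappa>))"

lemma integrable_chain [simp]:
  "integrable (measure_pmf (chain_pmf w kern n)) (f :: _ \<Rightarrow> 'b::{banach, second_countable_topology})"
  by (rule integrable_measure_pmf_finite[OF finite_chain_pmf[OF invar fin]])

lemma expectation_mono_chain:
  "(\<And>l. l \<in> set_pmf (chain_pmf w kern n) \<Longrightarrow> f l \<le> g l) \<Longrightarrow> E (chain_pmf w kern n) f \<le> E (chain_pmf w kern n) (g :: _ \<Rightarrow> real)"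
  by (intro integral_mono_AE) (auto simp: AE_measure_pmf_iff)

lemma chain_nth_in:
  assumes "l \<in> set_pmf (chain_pmf w kern n)" "k \<le> n"
  shows "l ! k \<in> set_pmf w"
proof -
  have "l ! k \<in> set l" using length_chain_pmf[OF assms(1)] assms(2) by simp
  then show ?thesis using set_chain_pmf[OF invar assms(1)] by blast
qed

lemma norm_velocity_sum:
  assumes "l \<in> set_pmf (chain_pmf w kern K)"
  shows "norm (\<Sum>i<K. h *\<^sub>R snd (l ! Suc i)) \<le> C * (real K * h)"
proof -
  have "norm (\<Sum>i<K. h *\<^sub>R snd (l ! Suc i)) \<le> (\<Sum>i<K. h * C)"
    using h bound(2)[OF chain_nth_in[OF assms]] by (intro sum_norm_le) (auto intro!: mult_left_mono)
  then show ?thesis by (simp add: mult.commute mult.left_commute)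
qed

lemma norm_displacement_le:
  assumes "l \<in> set_pmf (chain_pmf w kern K)"
  shows "norm (fst (l ! K) - fst (l ! 0)) \<le> norm (defect h l) + C * (real K * h)"
proof -
  have "fst (l ! K) - fst (l ! 0) = defect h l + (\<Sum>i<K. h *\<^sub>R snd (l ! Suc i))"
    using defect_eq[OF length_chain_pmf[OF assms], of h] by simp
  then show ?thesis
    using norm_velocity_sum[OF assms] norm_triangle_ineq[of "defect h l" "\<Sum>i<K. h *\<^sub>R snd (l ! Suc i)"]
    by simp
qed

text \<open>Single jumps of the chain need not be of size h, so the speed bound \<open>C\<close> is
  recorded as the mean of a nonnegative excess. When that mean vanishes in the limit, the bound
  holds almost surely.\<close>

lemma displacement_excess:
  "E (chain_pmf w kern K) (\<lambda>l. max 0 (norm (fst (l ! K) - fst (l ! 0)) - C * (real K * h))) \<le> defect_bound K"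
proof -
  have "E (chain_pmf w kern K) (\<lambda>l. max 0 (norm (fst (l ! K) - fst (l ! 0)) - C * (real K * h)))
    \<le> E (chain_pmf w kern K) (\<lambda>l. norm (defect h l))"
    using norm_displacement_le by (intro expectation_mono_chain) (auto simp: diff_le_eq)
  also have "\<dots> \<le> defect_bound K" unfolding defect_bound_def by (rule expectation_norm_defect) simp
  finally show ?thesis .
qed

lemma expectation_displacement:
  assumes "k \<le> K"
  shows "E (chain_pmf w kern K) (\<lambda>l. norm (fst (l ! k) - fst (l ! 0))) \<le> defect_bound K + C * (real K * h)"
proof -
  have "E (chain_pmf w kern K) (\<lambda>l. norm (fst (l ! k) - fst (l ! 0)))
    = E (map_pmf (take (Suc k)) (chain_pmf w kern K)) (\<lambda>l. norm (fst (l ! k) - fst (l ! 0)))"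
    by simp
  also have "\<dots> = E (chain_pmf w kern k) (\<lambda>l. norm (fst (l ! k) - fst (l ! 0)))"
    by (simp only: take_chain_pmf[OF assms])
  also have "\<dots> \<le> E (chain_pmf w kern k) (\<lambda>l. norm (defect h l) + C * (real k * h))"
    using norm_displacement_le by (rule expectation_mono_chain)
  also have "\<dots> = E (chain_pmf w kern k) (\<lambda>l. norm (defect h l)) + C * (real k * h)" by simp
  also have "\<dots> \<le> defect_bound K + C * (real K * h)"
    unfolding defect_bound_def using assms C h
    by (intro add_mono expectation_norm_defect mult_left_mono mult_right_mono) auto
  finally show ?thesis .
qed

text \<open>Compares \<open>K\<close> steps of the chain with one Euler step of a Lipschitz field
  \<open>c\<close>. The three errors are the defect, the replacement of velocities by
  \<open>c\<close>, whose mean is the same at each step by stationarity, and the variation of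
  \<open>c\<close> over the displacement from the starting point.\<close>

lemma one_step_consistency:
  fixes c :: "'a \<Rightarrow> 'a"
  assumes c: "Lc-lipschitz_on UNIV c"
  shows "E (chain_pmf w kern K) (\<lambda>l. norm (fst (l ! K) - fst (l ! 0) - (real K * h) *\<^sub>R c (fst (l ! 0))))
    \<le> defect_bound K + (real K * h) * E w (\<lambda>i. norm (snd i - c (fst i))) + (real K * h) * Lc * (defect_bound K + C * (real K * h))"
proof -
  let ?p = "chain_pmf w kern K"
  have Lc: "0 \<le> Lc" using c by (rule lipschitz_on_nonneg)
  have "E ?p (\<lambda>l. norm (fst (l ! K) - fst (l ! 0) - (real K * h) *\<^sub>R c (fst (l ! 0))))
    \<le> E ?p (\<lambda>l. norm (defect h l) + (\<Sum>i<K. h * norm (snd (l ! Suc i) - c (fst (l ! Suc i))))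
         + (\<Sum>i<K. h * (Lc * norm (fst (l ! Suc i) - fst (l ! 0)))))"
  proof (rule expectation_mono_chain)
    fix l assume l: "l \<in> set_pmf ?p"
    have K: "(real K * h) *\<^sub>R c (fst (l ! 0)) = (\<Sum>i<K. h *\<^sub>R c (fst (l ! 0)))"
      by (simp add: scaleR_sum_left sum_constant_scaleR)
    have "fst (l ! K) - fst (l ! 0) - (real K * h) *\<^sub>R c (fst (l ! 0))
       = defect h l + (\<Sum>i<K. h *\<^sub>R (snd (l ! Suc i) - c (fst (l ! Suc i))))
         + (\<Sum>i<K. h *\<^sub>R (c (fst (l ! Suc i)) - c (fst (l ! 0))))"
      unfolding K defect_eq[OF length_chain_pmf[OF l], of h]
      by (simp add: scaleR_diff_right sum_subtractf)
    also have "norm \<dots> \<le> norm (defect h l) + norm (\<Sum>i<K. h *\<^sub>R (snd (l ! Suc i) - c (fst (l ! Suc i))))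
         + norm (\<Sum>i<K. h *\<^sub>R (c (fst (l ! Suc i)) - c (fst (l ! 0))))"
      by (intro norm_triangle_le add_mono norm_triangle_ineq order_refl)
    also have "\<dots> \<le> norm (defect h l) + (\<Sum>i<K. h * norm (snd (l ! Suc i) - c (fst (l ! Suc i))))
         + (\<Sum>i<K. h * (Lc * norm (fst (l ! Suc i) - fst (l ! 0))))"
      using h lipschitz_onD[OF c] 
      by (intro add_mono order_refl sum_norm_le) (auto intro!: mult_left_mono simp: dist_norm)
    finally show "norm (fst (l ! K) - fst (l ! 0) - (real K * h) *\<^sub>R c (fst (l ! 0)))
      \<le> norm (defect h l) + (\<Sum>i<K. h * norm (snd (l ! Suc i) - c (fst (l ! Suc i))))
         + (\<Sum>i<K. h * (Lc * norm (fst (l ! Suc i) - fst (l ! 0))))" .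
  qed
  also have "\<dots> = E ?p (\<lambda>l. norm (defect h l)) + (\<Sum>i<K. h * E ?p (\<lambda>l. norm (snd (l ! Suc i) - c (fst (l ! Suc i)))))
         + (\<Sum>i<K. h * (Lc * E ?p (\<lambda>l. norm (fst (l ! Suc i) - fst (l ! 0)))))"
    by (simp add: Bochner_Integration.integral_sum)
  also have "\<dots> \<le> defect_bound K + (\<Sum>i<K. h * E w (\<lambda>i. norm (snd i - c (fst i))))
         + (\<Sum>i<K. h * (Lc * (defect_bound K + C * (real K * h))))"
  proof (intro add_mono sum_mono mult_left_mono expectation_displacement)
    show "E ?p (\<lambda>l. norm (defect h l)) \<le> defect_bound K" unfolding defect_bound_def by (rule expectation_norm_defect) simp
    fix i assume "i \<in> {..<K}"
    then have "E (map_pmf (\<lambda>l. l ! Suc i) ?p) (\<lambda>i. norm (snd i - c (fst i))) = E w (\<lambda>i. norm (snd i - c (fst i)))"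
      by (subst nth_chain_pmf[OF invar]) auto
    then show "E ?p (\<lambda>l. norm (snd (l ! Suc i) - c (fst (l ! Suc i)))) \<le> E w (\<lambda>i. norm (snd i - c (fst i)))"
      by simp
  qed (use h Lc in auto)
  also have "\<dots> = defect_bound K + (real K * h) * E w (\<lambda>i. norm (snd i - c (fst i))) + (real K * h) * Lc * (defect_bound K + C * (real K * h))"
    by (simp add: algebra_simps)
  finally show ?thesis .
qed

end

section \<open>Reading countably many coordinates off one real number\<close>

text \<open>The clipped cosine is 0 on the first and 1 on the last third of [0,1], because cos (pi /
  3) = 1/2, and it has period 2. It reads the leading ternary digit, 0 or 2, continuously.\<close>

definition digit_wave :: "real \<Rightarrow> real" where
  "digit_wave t = max 0 (min 1 (1/2 - cos (pi * t)))"

lemma continuous_on_digit_wave: "continuous_on UNIV (\<lambda>t. digit_wave (c * t))"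
  unfolding digit_wave_def by (intro continuous_intros)

lemma digit_wave_bounds: "0 \<le> digit_wave t" "digit_wave t \<le> 1"
  by (auto simp: digit_wave_def)

lemma digit_wave_shift: "digit_wave (of_int (2 * n) + t) = digit_wave t"
proof -
  have "cos (pi * (of_int (2 * n) + t)) = cos (pi * t + 2 * pi * of_int n)"
    by (simp add: algebra_simps)
  also have "\<dots> = cos (pi * t)"
    using sin_cos_eq_iff[of "pi * t + 2 * pi * of_int n" "pi * t"] by (metis add.commute)
  finally show ?thesis by (simp add: digit_wave_def)
qed

lemma digit_wave_0: assumes "0 \<le> t" "t \<le> 1/3" shows "digit_wave t = 0"
proof -
  have "cos (pi / 3) \<le> cos (pi * t)"
    using assms by (intro cos_monotone_0_pi_le) (auto simp: field_simps)
  then show ?thesis by (simp add: digit_wave_def cos_60)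
qed

lemma digit_wave_1: assumes "2/3 \<le> t" "t \<le> 1" shows "digit_wave t = 1"
proof -
  have "cos (pi * t) \<le> cos (2 * pi / 3)"
    using assms by (intro cos_monotone_0_pi_le) (auto simp: field_simps)
  moreover have "cos (2 * pi / 3) = - cos (pi / 3)"
    using cos_pi_minus[of "pi / 3"] by (simp add: field_simps)
  ultimately show ?thesis by (simp add: digit_wave_def cos_60)
qed

text \<open>Schoenberg's trick: the ternary digits 0 and 2 of a point of the Cantor set can be read off
  by continuous functions defined on the whole line.\<close>

lemma digit_wave_reads_cantor_digits:
  fixes a :: "nat \<Rightarrow> bool"
  obtains t where "0 \<le> t" "t \<le> 1" "\<And>k. digit_wave (3 ^ k * t) = of_bool (a k)"
proof -
  define f :: "(nat \<Rightarrow> bool) \<Rightarrow> nat \<Rightarrow> real" where "f a i = 2 * of_bool (a i) / 3 ^ Suc i" for a :: "nat \<Rightarrow> bool" and i :: nat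
  have geo: "(\<lambda>i. 2 * (1/3) ^ Suc i :: real) sums 1"
    using sums_mult[OF geometric_sums[of "1/3 :: real"], of "2/3"] by simp
  have f_le: "f a i \<le> 2 * (1/3) ^ Suc i" and f_ge: "0 \<le> f a i" for a i
    by (auto simp: f_def power_divide)
  have summ: "summable (f a)" for a
    using f_le f_ge by (intro summable_comparison_test[OF _ sums_summable[OF geo]]) auto
  define T where "T a = suminf (f a)" for a
  have T0: "0 \<le> T a" for a unfolding T_def by (intro suminf_nonneg summ f_ge)
  have T1: "T a \<le> 1" for a
    unfolding T_def using suminf_le[OF f_le summ sums_summable[OF geo]] sums_unique[OF geo] by simp
  \<comment> \<open>Multiplication by 3 shifts the ternary digits. The digit that leaves contributes
    0 or 2, an even integer, which the period of \<open>digit_wave\<close> makes invisible.\<close>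
  have step: "3 * T a = of_int (2 * of_bool (a 0)) + T (\<lambda>i. a (Suc i))" for a
  proof -
    have "T a = f a 0 + (\<Sum>i. f a (Suc i))"
      unfolding T_def using suminf_split_head[OF summ[of a]] by simp
    also have "(\<Sum>i. f a (Suc i)) = (\<Sum>i. f (\<lambda>i. a (Suc i)) i / 3)"
      by (intro suminf_cong) (simp add: f_def)
    also have "\<dots> = T (\<lambda>i. a (Suc i)) / 3"
      unfolding T_def by (rule suminf_divide[OF summ])
    finally show ?thesis by (simp add: f_def)
  qed
  have head: "digit_wave (T a) = of_bool (a 0)" for a
    using step[of a] T0[of "\<lambda>i. a (Suc i)"] T1[of "\<lambda>i. a (Suc i)"]
    by (cases "a 0") (auto intro: digit_wave_0 digit_wave_1)
  have "digit_wave (3 ^ k * T a) = of_bool (a k)" for a k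
  proof (induction k arbitrary: a)
    case (Suc k)
    have "3 ^ Suc k * T a = of_int (2 * (3 ^ k * of_bool (a 0))) + 3 ^ k * T (\<lambda>i. a (Suc i))"
    proof -
      have "3 ^ Suc k * T a = 3 ^ k * (3 * T a)" by simp
      also have "\<dots> = of_int (2 * (3 ^ k * of_bool (a 0))) + 3 ^ k * T (\<lambda>i. a (Suc i))"
        unfolding step[of a] by (simp add: distrib_left)
      finally show ?thesis .
    qed
    then show ?case using Suc by (simp only: digit_wave_shift)
  qed (use head in simp)
  then show ?thesis using that[of "T a"] T0 T1 by blast
qed

lemma binary_expansion:
  fixes y :: real
  assumes "0 \<le> y" "y < 1"
  obtains d :: "nat \<Rightarrow> bool" where "(\<lambda>k. of_bool (d k) / 2 ^ Suc k) sums y"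
proof -
  define d where "d k = odd \<lfloor>2 ^ Suc k * y\<rfloor>" for k
  have partial: "(\<Sum>k<n. of_bool (d k) / 2 ^ Suc k) = real_of_int \<lfloor>2 ^ n * y\<rfloor> / 2 ^ n" for n
  proof (induction n)
    case 0
    have "\<lfloor>y\<rfloor> = 0" using assms by linarith
    then show ?case by simp
  next
    case (Suc n)
    have "\<lfloor>2 ^ Suc n * y\<rfloor> = 2 * \<lfloor>2 ^ n * y\<rfloor> + of_bool (d n)"
    proof -
      have "\<lfloor>2 ^ Suc n * y\<rfloor> div 2 = \<lfloor>2 ^ Suc n * y / 2\<rfloor>"
        using floor_divide_real_eq_div[of 2 "2 ^ Suc n * y"] by simp
      then have "\<lfloor>2 ^ Suc n * y\<rfloor> div 2 = \<lfloor>2 ^ n * y\<rfloor>" by simp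
      then show ?thesis unfolding d_def by (auto elim!: oddE evenE)
    qed
    then have "real_of_int \<lfloor>2 ^ Suc n * y\<rfloor> = 2 * real_of_int \<lfloor>2 ^ n * y\<rfloor> + of_bool (d n)"
      by simp
    then show ?case using Suc by (simp add: field_simps)
  qed
  have "(\<lambda>n. of_int \<lfloor>2 ^ n * y\<rfloor> / 2 ^ n) \<longlonglongrightarrow> y"
  proof (rule tendsto_sandwich[of "\<lambda>n. y - (1/2) ^ n" _ _ "\<lambda>_. y"])
    have "y - (1/2) ^ n \<le> of_int \<lfloor>2 ^ n * y\<rfloor> / 2 ^ n" for n
    proof -
      have "2 ^ n * y - 1 \<le> of_int \<lfloor>2 ^ n * y\<rfloor>" by linarith
      then have "(2 ^ n * y - 1) / 2 ^ n \<le> of_int \<lfloor>2 ^ n * y\<rfloor> / 2 ^ n" by (intro divide_right_mono) auto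
      then show ?thesis by (simp add: diff_divide_distrib power_divide)
    qed
    then show "\<forall>\<^sub>F n in sequentially. y - (1/2) ^ n \<le> of_int \<lfloor>2 ^ n * y\<rfloor> / 2 ^ n" by simp
    have "of_int \<lfloor>2 ^ n * y\<rfloor> / 2 ^ n \<le> y" for n
    proof -
      have "of_int \<lfloor>2 ^ n * y\<rfloor> \<le> 2 ^ n * y" by linarith
      then have "of_int \<lfloor>2 ^ n * y\<rfloor> / 2 ^ n \<le> (2 ^ n * y) / 2 ^ n" by (intro divide_right_mono) auto
      then show ?thesis by simp
    qed
    then show "\<forall>\<^sub>F n in sequentially. of_int \<lfloor>2 ^ n * y\<rfloor> / 2 ^ n \<le> y" by simp
    have "(\<lambda>n. (1/2 :: real) ^ n) \<longlonglongrightarrow> 0" by (rule LIMSEQ_power_zero) simp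
    from tendsto_diff[OF tendsto_const this, of y] show "(\<lambda>n. y - (1/2) ^ n) \<longlonglongrightarrow> y" by simp
  qed auto
  then have "(\<lambda>k. of_bool (d k) / 2 ^ Suc k) sums y" unfolding sums_def partial .
  then show ?thesis by (rule that)
qed

text \<open>\<open>prod_encode\<close> distributes the digits of \<open>t\<close> over countably
  many sequences, and the \<open>j\<close>-th of them is read as a binary expansion. This is the
  classical continuous map of the Cantor set onto the Hilbert cube, extended to the whole
  line.\<close>

definition read_coordinate :: "nat \<Rightarrow> real \<Rightarrow> real" where
  "read_coordinate j t = (\<Sum>k. digit_wave (3 ^ prod_encode (j, k) * t) / 2 ^ Suc k)"

lemma sums_half: "(\<lambda>k. 1 / 2 ^ Suc k :: real) sums 1"
  using power_half_series by (simp add: power_divide)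

lemma continuous_on_read_coordinate: "continuous_on UNIV (read_coordinate j)"
proof -
  have "uniform_limit UNIV (\<lambda>n t. \<Sum>k<n. digit_wave (3 ^ prod_encode (j, k) * t) / 2 ^ Suc k)
      (\<lambda>t. \<Sum>k. digit_wave (3 ^ prod_encode (j, k) * t) / 2 ^ Suc k) sequentially"
    by (rule Weierstrass_m_test[where M = "\<lambda>k. 1 / 2 ^ Suc k"])
       (auto simp: digit_wave_bounds divide_right_mono sums_summable[OF sums_half, simplified])
  then show ?thesis unfolding read_coordinate_def
    by (rule uniform_limit_theorem[rotated])
       (auto intro!: always_eventually continuous_on_sum continuous_on_divide continuous_on_digit_wave continuous_on_const)
qed

lemma read_coordinate_bounds: "0 \<le> read_coordinate j t" "read_coordinate j t \<le> 1"
proof -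
  let ?f = "\<lambda>k. digit_wave (3 ^ prod_encode (j, k) * t) / 2 ^ Suc k"
  have s: "summable ?f"
    by (rule summable_comparison_test[OF _ sums_summable[OF sums_half]])
       (auto simp: digit_wave_bounds divide_right_mono)
  show "0 \<le> read_coordinate j t" unfolding read_coordinate_def
    by (intro suminf_nonneg s) (auto simp: digit_wave_bounds)
  have "suminf ?f \<le> (\<Sum>k. 1 / 2 ^ Suc k)"
    by (intro suminf_le s sums_summable[OF sums_half]) (auto simp: digit_wave_bounds divide_right_mono)
  then show "read_coordinate j t \<le> 1" unfolding read_coordinate_def
    by (simp only: sums_unique[OF sums_half, symmetric])
qed

lemma read_coordinate_surj:
  fixes y :: "nat \<Rightarrow> real"
  assumes "\<And>j. 0 \<le> y j" "\<And>j. y j < 1"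
  obtains t where "0 \<le> t" "t \<le> 1" "\<And>j. read_coordinate j t = y j"
proof -
  have "\<exists>d :: nat \<Rightarrow> bool. (\<lambda>k. of_bool (d k) / 2 ^ Suc k) sums y j" for j
    using binary_expansion[OF assms] by metis
  then obtain d where d: "\<And>j. (\<lambda>k. of_bool (d j k :: bool) / 2 ^ Suc k) sums y j" by metis
  obtain t where t: "0 \<le> t" "t \<le> 1" "\<And>n. digit_wave (3 ^ n * t) = of_bool (case prod_decode n of (j, k) \<Rightarrow> d j k)"
    using digit_wave_reads_cantor_digits[of "\<lambda>n. case prod_decode n of (j, k) \<Rightarrow> d j k"] by metis
  have "read_coordinate j t = y j" for j
    unfolding read_coordinate_def using sums_unique[OF d[of j]] by (simp add: t(3))
  with t(1,2) show ?thesis by (rule that)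
qed

text \<open>A bounded family over a countable index set becomes a single point of [0,1]. Since
  \<open>G\<close> is continuous and bounded on the whole line, continuous functions of finitely
  many coordinates become bounded continuous functions of the code, the test functions of weak
  convergence.\<close>

lemma universal_coordinates:
  fixes Q :: "'q set" and R :: real
  assumes Q: "countable Q" and R: "0 < R"
  obtains G :: "'q \<Rightarrow> real \<Rightarrow> 'a::euclidean_space" and B where "\<And>q. continuous_on UNIV (G q)" "\<And>q t. norm (G q t) \<le> B"
    "\<And>y. (\<And>q. q \<in> Q \<Longrightarrow> norm (y q) \<le> R) \<Longrightarrow> \<exists>t. 0 \<le> t \<and> t \<le> 1 \<and> (\<forall>q\<in>Q. G q t = y q)"
proof -
  have cQ: "countable (Q \<times> (Basis :: 'a set))" using Q by (intro countable_SIGMA) (auto intro: countable_finite)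
  define e where "e = to_nat_on (Q \<times> (Basis :: 'a set))"
  define G :: "'q \<Rightarrow> real \<Rightarrow> 'a" where "G q t = (\<Sum>b\<in>Basis. (4 * R * read_coordinate (e (q, b)) t - 2 * R) *\<^sub>R b)" for q t
  show ?thesis
  proof (rule that[of G "DIM('a) * (2 * R)"])
    show "continuous_on UNIV (G q)" for q
      unfolding G_def by (intro continuous_intros continuous_on_read_coordinate)
    show "norm (G q t) \<le> DIM('a) * (2 * R)" for q t
    proof -
      have "norm (G q t) \<le> (\<Sum>b\<in>(Basis::'a set). 2 * R)"
        unfolding G_def
      proof (rule sum_norm_le)
        fix b :: 'a assume b: "b \<in> Basis"
        have "0 \<le> R * read_coordinate (e (q, b)) t" "R * read_coordinate (e (q, b)) t \<le> R * 1"
          using R read_coordinate_bounds[of "e (q,b)" t] by (auto intro!: mult_left_mono)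
        then have "\<bar>4 * R * read_coordinate (e (q, b)) t - 2 * R\<bar> \<le> 2 * R"
          by (simp add: abs_le_iff)
        then show "norm ((4 * R * read_coordinate (e (q, b)) t - 2 * R) *\<^sub>R b) \<le> 2 * R"
          using b by simp
      qed
      then show ?thesis by simp
    qed
    fix y :: "'q \<Rightarrow> 'a" assume y: "\<And>q. q \<in> Q \<Longrightarrow> norm (y q) \<le> R"
    \<comment> \<open>Reading coordinates in the range from -2 R to 2 R sends values between -R and
      R to [1/4, 3/4], safely below the value 1 excluded in \<open>read_coordinate_surj\<close>.
      Indices that encode nothing get 0.\<close>
    define c where "c n = (if n \<in> e ` (Q \<times> Basis) then (case from_nat_into (Q \<times> (Basis :: 'a set)) n of (q, b) \<Rightarrow> (y q \<bullet> b + 2 * R) / (4 * R)) else 0)" for n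
    have ce: "c (e (q, b)) = (y q \<bullet> b + 2 * R) / (4 * R)" if "q \<in> Q" "b \<in> Basis" for q b
      using that cQ by (auto simp: c_def e_def)
    have "0 \<le> c n \<and> c n < 1" for n
    proof (cases "n \<in> e ` (Q \<times> Basis)")
      case True
      then obtain q b where qb: "q \<in> Q" "b \<in> Basis" "n = e (q, b)" by auto
      have "\<bar>y q \<bullet> b\<bar> \<le> R" using Basis_le_norm[OF qb(2), of "y q"] y[OF qb(1)] by linarith
      then show ?thesis unfolding qb(3) ce[OF qb(1,2)] using R by (auto simp: field_simps abs_le_iff)
    qed (simp add: c_def)
    then obtain t where t: "0 \<le> t" "t \<le> 1" "\<And>j. read_coordinate j t = c j"
      using read_coordinate_surj[of c] by metis
    have "G q t = y q" if "q \<in> Q" for q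
    proof -
      have "G q t = (\<Sum>b\<in>Basis. (y q \<bullet> b) *\<^sub>R b)"
        unfolding G_def t(3) using R that by (intro sum.cong) (auto simp: ce field_simps)
      then show ?thesis by (simp add: euclidean_representation)
    qed
    then show "\<exists>t. 0 \<le> t \<and> t \<le> 1 \<and> (\<forall>q\<in>Q. G q t = y q)" using t by blast
  qed
qed

section \<open>The limit process\<close>

text \<open>The reason for the step size 1 / n!: every rational time lies on all sufficiently fine
  grids.\<close>

lemma eventually_Rats_mult_fact_Ints:
  assumes "q \<in> \<rat>"
  shows "\<forall>\<^sub>F n in sequentially. (q :: real) * fact n \<in> \<int>"
proof -
  obtain a b where q: "b > 0" "q = of_int a / of_int b"
    using Rats_cases'[OF assms] by metis
  have "q * fact n \<in> \<int>" if "n \<ge> nat b" for n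
  proof -
    have "nat b dvd fact n" using q that by (intro dvd_fact) auto
    then obtain k where k: "fact n = nat b * k" by auto
    have "(fact n :: real) = of_nat (fact n)" by simp
    also have "\<dots> = of_int b * of_nat k" unfolding k using q by simp
    finally have "q * fact n = of_int (a * int k)" using q by simp
    then show ?thesis by simp
  qed
  then show ?thesis by (rule eventually_sequentiallyI)
qed

text \<open>The \<open>n\<close>-th chain covers the times from -n to n in steps of 1 / n!, so index
  0 is the time -n.\<close>

definition time_index :: "nat \<Rightarrow> real \<Rightarrow> nat" where
  "time_index n t = nat \<lfloor>(t + real n) * fact n\<rfloor>"

definition on_grid :: "nat \<Rightarrow> real \<Rightarrow> bool" where
  "on_grid n t \<longleftrightarrow> \<bar>t\<bar> \<le> real n \<and> t * fact n \<in> \<int>"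

lemma eventually_on_grid: "q \<in> \<rat> \<Longrightarrow> \<forall>\<^sub>F n in sequentially. on_grid n q"
  unfolding on_grid_def using eventually_Rats_mult_fact_Ints[of q]
  by (intro eventually_conj) (auto intro: eventually_mono[OF eventually_ge_at_top[of "nat \<lceil>\<bar>q\<bar>\<rceil>"]] simp: nat_ceiling_le_eq)

lemma time_index_on_grid:
  assumes "on_grid n t"
  shows "real (time_index n t) = (t + real n) * fact n"
proof -
  obtain k where k: "t * fact n = of_int k" using assms by (auto simp: on_grid_def elim: Ints_cases)
  have "(t + real n) * fact n = of_int (k + int (n * fact n))" using k by (simp add: distrib_right)
  moreover have "0 \<le> (t + real n) * fact n" using assms by (auto simp: on_grid_def)
  ultimately show ?thesis unfolding time_index_def by (metis floor_of_int of_int_0_le_iff of_int_of_nat_eq of_nat_nat)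
qed

lemma time_index_le:
  assumes "on_grid n t"
  shows "time_index n t \<le> 2 * n * fact n"
proof -
  have "real (time_index n t) \<le> (real n + real n) * fact n"
    unfolding time_index_on_grid[OF assms] using assms by (intro mult_right_mono) (auto simp: on_grid_def)
  also have "\<dots> = real (2 * n * fact n)" by simp
  finally show ?thesis by (simp only: of_nat_le_iff)
qed

lemma time_index_shift:
  assumes "on_grid n q" "on_grid n q'" "q \<le> q'"
  shows "time_index n q' = time_index n q + nat \<lfloor>(q' - q) * fact n\<rfloor>" "real (nat \<lfloor>(q' - q) * fact n\<rfloor>) = (q' - q) * fact n"
proof -
  have "(q' - q) * fact n \<in> \<int>" using assms by (auto simp: on_grid_def left_diff_distrib)
  then obtain k where k: "(q' - q) * fact n = of_int k" by (auto elim: Ints_cases)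
  moreover have "0 \<le> (q' - q) * fact n" using assms by auto
  ultimately show 1: "real (nat \<lfloor>(q' - q) * fact n\<rfloor>) = (q' - q) * fact n" by simp
  have "real (time_index n q') = real (time_index n q + nat \<lfloor>(q' - q) * fact n\<rfloor>)"
    using assms 1 by (simp add: time_index_on_grid algebra_simps)
  then show "time_index n q' = time_index n q + nat \<lfloor>(q' - q) * fact n\<rfloor>" by (simp only: of_nat_eq_iff)
qed

lemma expectation_window:
  fixes f :: "'s list \<Rightarrow> real"
  assumes "bind_pmf w kern = w" "a + m \<le> n"
  shows "measure_pmf.expectation (chain_pmf w kern n) (\<lambda>l. f (take (Suc m) (drop a l)))
    = measure_pmf.expectation (chain_pmf w kern m) f"
  using window_chain_pmf[OF assms] integral_map_pmf[of "\<lambda>l. take (Suc m) (drop a l)" "chain_pmf w kern n" f] by simp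

lemma nth_window: "a + m < length l \<Longrightarrow> k \<le> m \<Longrightarrow> take (Suc m) (drop a l) ! k = l ! (a + k)"
  by (simp add: add.commute)

lemma tight_of_bounded_support:
  fixes \<tau> :: "nat \<Rightarrow> real measure"
  assumes "\<And>n. real_distribution (\<tau> n)" "\<And>n. AE t in \<tau> n. 0 \<le> t \<and> t \<le> 1"
  shows "tight \<tau>"
  unfolding tight_def
proof (intro conjI allI impI)
  fix \<epsilon> :: real assume "0 < \<epsilon>"
  \<comment> \<open>Tightness is stated with intervals open on the left; the endpoint -1 in place of
    0 keeps a possible atom at 0 inside.\<close>
  have "measure (\<tau> n) {-1<..1} = 1" for n
  proof -
    interpret real_distribution "\<tau> n" by (rule assms)
    show ?thesis using assms(2)[of n] by (subst prob_eq_1) (auto elim!: eventually_mono)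
  qed
  then show "\<exists>a b. a < b \<and> (\<forall>n. 1 - \<epsilon> < measure (\<tau> n) {a<..b})"
    using \<open>0 < \<epsilon>\<close> by (intro exI[of _ "-1"] exI[of _ 1]) auto
qed (use assms in auto)

context invariant_field begin

text \<open>Paths of the chains are replaced by codes in [0,1], whose laws are tight. Decoding by
  the continuous \<open>G\<close> makes every chain estimate the expectation of a bounded continuous
  function of the code, so it survives a weak limit \<open>\<tau>\<close>. Rational times suffice
  here and belong to almost all grids.\<close>

lemma limit_process:
  obtains \<tau> :: "real measure" and G :: "real \<Rightarrow> real \<Rightarrow> 'a" and B :: real where
    "prob_space \<tau>" "sets \<tau> = sets borel" "\<And>q. continuous_on UNIV (G q)" "\<And>q t. norm (G q t) \<le> B"
    "\<And>q F L. q \<in> \<rat> \<Longrightarrow> L-lipschitz_on UNIV F \<Longrightarrow> (\<integral>t. F (G q t) \<partial>\<tau>) = ((\<integral>x. F x \<partial>m) :: real)"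
    "\<And>J s \<phi>. finite J \<Longrightarrow> J \<subseteq> \<rat> \<Longrightarrow> s \<in> \<rat> \<Longrightarrow> (\<And>q. continuous_on UNIV (\<phi> q)) \<Longrightarrow> (\<And>q x. 0 \<le> \<phi> q x \<and> \<phi> q x \<le> 1) \<Longrightarrow>
       (\<integral>t. (\<Prod>q\<in>J. \<phi> q (G (s + q) t)) \<partial>\<tau>) = ((\<integral>t. (\<Prod>q\<in>J. \<phi> q (G q t)) \<partial>\<tau>) :: real)"
    "\<And>p q. p \<in> \<rat> \<Longrightarrow> q \<in> \<rat> \<Longrightarrow> p \<le> q \<Longrightarrow> AE t in \<tau>. norm (G q t - G p t) \<le> 4 * M * (q - p)"
    "\<And>p q c Lc. p \<in> \<rat> \<Longrightarrow> q \<in> \<rat> \<Longrightarrow> p \<le> q \<Longrightarrow> Lc-lipschitz_on UNIV c \<Longrightarrow>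
       (\<integral>t. norm (G q t - G p t - (q - p) *\<^sub>R c (G p t)) \<partial>\<tau>)
       \<le> (q - p) * (\<integral>x. norm (b x - c x) \<partial>m) + (q - p) * Lc * (4 * M * (q - p))"
proof -
  define h where "h n = 1 / (fact n :: real)" for n
  have h: "0 < h n" "h n \<le> 1" for n by (auto simp: h_def fact_ge_1)
  have hlim: "h \<longlonglongrightarrow> 0"
  proof (rule tendsto_sandwich[of "\<lambda>_. 0" _ _ "\<lambda>n. 1 / real n"])
    show "\<forall>\<^sub>F n in sequentially. h n \<le> 1 / real n"
      using fact_ge_self by (intro eventually_sequentiallyI[of 1]) (auto simp: h_def intro!: divide_left_mono mult_pos_pos, metis of_nat_fact of_nat_le_iff)
    show "(\<lambda>n. 1 / real n) \<longlonglongrightarrow> 0" by (rule lim_1_over_n)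
  qed (use h in \<open>auto intro!: always_eventually less_imp_le\<close>)
  \<comment> \<open>Over a time span T there are K = T / h steps, so with slack h^3 and bound C = 4
    M the mean-square estimate reads T h C^2 + 10 C T^2 h and tends to 0. A slack of h^2 would leave
    the second term constant.\<close>
  have ex: "\<exists>w kern. approximate_chain w kern (h n) (4 * M) (h n ^ 3) \<and>
     (\<forall>F L. continuous_on UNIV F \<longrightarrow> L-lipschitz_on UNIV F \<longrightarrow>
       \<bar>measure_pmf.expectation w F - (\<integral>x. F (x, b x) \<partial>m)\<bar> \<le> L * h n ^ 3)" for n
  proof (rule approximate_chain_step[OF h(1)[of n] h(2)[of n] zero_less_power[OF h(1)[of n], of 3]])
    fix w kern assume wk: "finite (set_pmf w)" "set_pmf w \<subseteq> cball 0 (4 * M)" "bind_pmf w kern = w"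
      "measure_pmf.expectation w (\<lambda>i. norm (measure_pmf.expectation (kern i) (\<lambda>j. fst j - h n *\<^sub>R snd j) - fst i)) \<le> h n ^ 3"
      "\<bar>measure_pmf.expectation w (\<lambda>i. fst i \<bullet> snd i)\<bar> \<le> h n ^ 3"
      "\<And>F L. continuous_on UNIV F \<Longrightarrow> L-lipschitz_on UNIV F \<Longrightarrow>
         \<bar>measure_pmf.expectation w F - (\<integral>x. F (x, b x) \<partial>m)\<bar> \<le> L * h n ^ 3"
    have nb: "norm (fst i) \<le> 4 * M" "norm (snd i) \<le> 4 * M" if "i \<in> set_pmf w" for i
    proof -
      have "norm i \<le> 4 * M" using wk(2) that by auto
      then show "norm (fst i) \<le> 4 * M" "norm (snd i) \<le> 4 * M"
        using dist_fst_le[of i 0] dist_snd_le[of i 0] by auto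
    qed
    have "approximate_chain w kern (h n) (4 * M) (h n ^ 3)"
      using wk(1,3,4,5) nb h[of n] M_ge_1 by unfold_locales auto
    with wk(6) show ?thesis by (intro exI[of _ w] exI[of _ kern] conjI allI impI)
  qed
  obtain w kern where ac: "\<And>n. approximate_chain (w n) (kern n) (h n) (4 * M) (h n ^ 3)"
    and wF: "\<And>n F L. continuous_on UNIV F \<Longrightarrow> L-lipschitz_on UNIV F \<Longrightarrow>
       \<bar>measure_pmf.expectation (w n) F - (\<integral>x. F (x, b x) \<partial>m)\<bar> \<le> L * h n ^ 3"
    using ex by metis
  have invar: "bind_pmf (w n) (kern n) = w n" for n using ac by (rule approximate_chain.invar)
  define N where "N n = 2 * n * (fact n :: nat)" for n
  define P where "P n = chain_pmf (w n) (kern n) (N n)" for n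
  \<comment> \<open>Clamping the index assigns some state of the chain to every time, also outside
    the window or off the grid. Hence a single code can prescribe the values at all rational times
    simultaneously.\<close>
  define X where "X n t l = fst (l ! min (N n) (time_index n t))" for n t and l :: "('a \<times> 'a) list"
  have lenP: "length l = Suc (N n)" if "l \<in> set_pmf (P n)" for l n
    using that unfolding P_def by (rule length_chain_pmf)
  have X_grid: "X n t l = fst (l ! time_index n t)" if "on_grid n t" for n t l
    using time_index_le[OF that] by (simp add: X_def N_def min_absorb2)
  have X_bound: "norm (X n t l) \<le> 4 * M" if "l \<in> set_pmf (P n)" for n t l
    unfolding X_def using approximate_chain.chain_nth_in[OF ac that[unfolded P_def]]
    by (intro approximate_chain.bound(1)[OF ac[of n]]) auto
  have M4: "0 < 4 * M" using M_ge_1 by simp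
  obtain G :: "real \<Rightarrow> real \<Rightarrow> 'a" and B where G: "\<And>q. continuous_on UNIV (G q)" "\<And>q t. norm (G q t) \<le> B"
    and Gsurj: "\<And>y. (\<And>q. q \<in> \<rat> \<Longrightarrow> norm (y q) \<le> 4 * M) \<Longrightarrow> \<exists>t. 0 \<le> t \<and> t \<le> 1 \<and> (\<forall>q\<in>\<rat>. G q t = y q)"
  proof (rule universal_coordinates[OF countable_rat M4])
    fix G :: "real \<Rightarrow> real \<Rightarrow> 'a" and B
    assume "\<And>q. continuous_on UNIV (G q)" "\<And>q t. norm (G q t) \<le> B"
      "\<And>y. (\<And>q. q \<in> \<rat> \<Longrightarrow> norm (y q) \<le> 4 * M) \<Longrightarrow> \<exists>t. 0 \<le> t \<and> t \<le> 1 \<and> (\<forall>q\<in>\<rat>. G q t = y q)"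
    then show thesis by (rule that)
  qed
  have exT: "\<exists>t. 0 \<le> t \<and> t \<le> 1 \<and> (l \<in> set_pmf (P n) \<longrightarrow> (\<forall>q\<in>\<rat>. G q t = X n q l))" for n l
  proof (cases "l \<in> set_pmf (P n)")
    case True
    then show ?thesis using Gsurj[of "\<lambda>q. X n q l"] X_bound[OF True] by blast
  qed (auto intro: exI[of _ 0])
  define T where "T n l = (SOME t. 0 \<le> t \<and> t \<le> 1 \<and> (l \<in> set_pmf (P n) \<longrightarrow> (\<forall>q\<in>\<rat>. G q t = X n q l)))" for n l
  have Tspec: "0 \<le> T n l \<and> T n l \<le> 1 \<and> (l \<in> set_pmf (P n) \<longrightarrow> (\<forall>q\<in>\<rat>. G q (T n l) = X n q l))" for n l
    unfolding T_def by (rule someI_ex[OF exT])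
  then have T: "\<And>n l. 0 \<le> T n l" "\<And>n l. T n l \<le> 1"
    and GT: "\<And>n l q. l \<in> set_pmf (P n) \<Longrightarrow> q \<in> \<rat> \<Longrightarrow> G q (T n l) = X n q l"
    by auto
  \<comment> \<open>The code \<open>T n\<close> comes from an arbitrary choice; it is measurable
    because the law of the chain lives on a discrete sigma-algebra.\<close>
  define \<nu> where "\<nu> n = distr (measure_pmf (P n)) borel (T n)" for n
  have \<nu>: "real_distribution (\<nu> n)" for n
    unfolding real_distribution_def real_distribution_axioms_def \<nu>_def
    by (auto intro!: measure_pmf.prob_space_distr)
  have "tight \<nu>"
  proof (rule tight_of_bounded_support[OF \<nu>])
    show "AE t in \<nu> n. 0 \<le> t \<and> t \<le> 1" for n
      unfolding \<nu>_def by (subst AE_distr_iff) (auto simp: T)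
  qed
  then obtain r \<tau> where r: "strict_mono r" and \<tau>: "real_distribution \<tau>" and conv: "weak_conv_m (\<nu> \<circ> id \<circ> r) \<tau>"
    using tight_imp_convergent_subsubsequence[of \<nu> id] by (auto simp: strict_mono_id)
  interpret \<tau>: real_distribution \<tau> by (rule \<tau>)
  have lim: "(\<lambda>n. measure_pmf.expectation (P (r n)) (\<lambda>l. H (T (r n) l))) \<longlonglongrightarrow> (\<integral>t. H t \<partial>\<tau>)"
    if H: "continuous_on UNIV H" "\<And>t. \<bar>H t\<bar> \<le> D" for H :: "real \<Rightarrow> real" and D
  proof -
    have [measurable]: "H \<in> borel_measurable borel" using H(1) by (rule borel_measurable_continuous_onI)
    have "(\<lambda>n. integral\<^sup>L ((\<nu> \<circ> id \<circ> r) n) H) \<longlonglongrightarrow> integral\<^sup>L \<tau> H"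
      by (rule weak_conv_imp_integral_bdd_continuous_conv[where B = D])
         (use \<nu> \<tau> conv H in \<open>auto simp: continuous_on_eq_continuous_at o_def\<close>)
    then show ?thesis by (simp add: \<nu>_def integral_distr)
  qed
  have bounded_comp: "\<exists>D. \<forall>x\<in>cball 0 R. \<bar>F x\<bar> \<le> D" if "continuous_on UNIV F" for F :: "'b::euclidean_space \<Rightarrow> real" and R
  proof -
    have "compact (F ` cball 0 R)" using that by (intro compact_continuous_image) (auto intro: continuous_on_subset)
    then show ?thesis using compact_imp_bounded bounded_iff by (metis image_eqI real_norm_def)
  qed
  have ev: "\<forall>\<^sub>F n in sequentially. Q (r n)" if "\<forall>\<^sub>F n in sequentially. Q n" for Q
    using that filterlim_subseq[OF r] by (simp add: filterlim_iff)
  have lim2: "(\<lambda>n. measure_pmf.expectation (P (r n)) (\<lambda>l. F (X (r n) p l, X (r n) q l))) \<longlonglongrightarrow> (\<integral>t. F (G p t, G q t) \<partial>\<tau>)"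
    if F: "continuous_on UNIV F" and pq: "p \<in> \<rat>" "q \<in> \<rat>" for F :: "'a \<times> 'a \<Rightarrow> real" and p q
  proof -
    obtain D where D: "\<And>x. x \<in> cball 0 (2 * B) \<Longrightarrow> \<bar>F x\<bar> \<le> D" using bounded_comp[OF F] by metis
    have "(\<lambda>n. measure_pmf.expectation (P (r n)) (\<lambda>l. F (G p (T (r n) l), G q (T (r n) l)))) \<longlonglongrightarrow> (\<integral>t. F (G p t, G q t) \<partial>\<tau>)"
    proof (rule lim)
      show "continuous_on UNIV (\<lambda>t. F (G p t, G q t))"
        by (rule continuous_on_compose2[OF F]) (auto intro!: continuous_intros G)
      show "\<bar>F (G p t, G q t)\<bar> \<le> D" for t
      proof (rule D)
        show "(G p t, G q t) \<in> cball 0 (2 * B)"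
          using G(2)[of p t] G(2)[of q t] norm_Pair_le[of "G p t" "G q t"] by simp
      qed
    qed
    moreover have "measure_pmf.expectation (P n) (\<lambda>l. F (G p (T n l), G q (T n l)))
      = measure_pmf.expectation (P n) (\<lambda>l. F (X n p l, X n q l))" for n
      by (intro integral_cong_AE) (auto simp: AE_measure_pmf_iff GT pq)
    ultimately show ?thesis by simp
  qed
  have h3: "(\<lambda>n. L * h (r n) ^ 3) \<longlonglongrightarrow> 0" for L
    using LIMSEQ_subseq_LIMSEQ[OF hlim r] by (auto intro!: tendsto_eq_intros simp: o_def)
  \<comment> \<open>By stationarity the joint law at \<open>p\<close> and \<open>q\<close> depends
    only on the number of steps between them, so the estimates for a chain of length
    \<open>K\<close> started at index 0 apply.\<close>
  have two_time: "measure_pmf.expectation (P n) (\<lambda>l. F (X n p l) (X n q l))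
      = measure_pmf.expectation (chain_pmf (w n) (kern n) K) (\<lambda>l. F (fst (l ! 0)) (fst (l ! K)))"
    if g: "on_grid n p" "on_grid n q" "p \<le> q" and K: "K = nat \<lfloor>(q - p) * fact n\<rfloor>" for F :: "'a \<Rightarrow> 'a \<Rightarrow> real" and n p q K
  proof -
    have iq: "time_index n q = time_index n p + K" using time_index_shift(1)[OF g] K by simp
    have le: "time_index n p + K \<le> N n" using time_index_le[OF g(2)] iq by (simp add: N_def)
    have "measure_pmf.expectation (P n) (\<lambda>l. F (X n p l) (X n q l))
      = measure_pmf.expectation (P n) (\<lambda>l. F (fst (take (Suc K) (drop (time_index n p) l) ! 0)) (fst (take (Suc K) (drop (time_index n p) l) ! K)))"
    proof (intro integral_cong_AE)
      show "AE l in P n. F (X n p l) (X n q l) = F (fst (take (Suc K) (drop (time_index n p) l) ! 0)) (fst (take (Suc K) (drop (time_index n p) l) ! K))"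
        unfolding AE_measure_pmf_iff using lenP le g by (auto simp: X_grid iq nth_window)
    qed auto
    also have "\<dots> = measure_pmf.expectation (chain_pmf (w n) (kern n) K) (\<lambda>l. F (fst (l ! 0)) (fst (l ! K)))"
      unfolding P_def by (rule expectation_window[OF invar le])
    finally show ?thesis .
  qed
  have Kh: "real (nat \<lfloor>(q - p) * fact n\<rfloor>) * h n = q - p" if "on_grid n p" "on_grid n q" "p \<le> q" for n p q
    using time_index_shift(2)[OF that] by (simp add: h_def)
  have \<rho>lim: "(\<lambda>n. approximate_chain.defect_bound (h n) (4 * M) (h n ^ 3) (nat \<lfloor>(q - p) * fact n\<rfloor>)) \<longlonglongrightarrow> 0"
    if pq: "p \<in> \<rat>" "q \<in> \<rat>" "p \<le> q" for p q :: real
  proof (rule Lim_transform_eventually)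
    show "(\<lambda>n. sqrt ((q - p) * h n * (4 * M)\<^sup>2 + 10 * (4 * M) * (q - p)\<^sup>2 * h n)) \<longlonglongrightarrow> 0"
      by (auto intro!: tendsto_eq_intros hlim)
    show "\<forall>\<^sub>F n in sequentially. sqrt ((q - p) * h n * (4 * M)\<^sup>2 + 10 * (4 * M) * (q - p)\<^sup>2 * h n)
      = approximate_chain.defect_bound (h n) (4 * M) (h n ^ 3) (nat \<lfloor>(q - p) * fact n\<rfloor>)"
      using eventually_on_grid[OF pq(1)] eventually_on_grid[OF pq(2)]
    proof eventually_elim
      case (elim n)
      let ?K = "real (nat \<lfloor>(q - p) * fact n\<rfloor>)"
      have "?K * ((h n)\<^sup>2 * (4 * M)\<^sup>2 + 10 * (4 * M) * ?K * h n ^ 3)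
        = (?K * h n) * h n * (4 * M)\<^sup>2 + 10 * (4 * M) * (?K * h n)\<^sup>2 * h n"
        by (simp add: power2_eq_square power3_eq_cube algebra_simps)
      then show ?case unfolding approximate_chain.defect_bound_def[OF ac] Kh[OF elim pq(3)] by simp
    qed
  qed
  show ?thesis
  proof (rule that[of \<tau> G B])
    show "prob_space \<tau>" by unfold_locales
    show "sets \<tau> = sets borel" by simp
    show "continuous_on UNIV (G q)" "norm (G q t) \<le> B" for q t using G by auto
  next
    fix q :: real and F :: "'a \<Rightarrow> real" and L assume q: "q \<in> \<rat>" and F: "L-lipschitz_on UNIV F"
    have cF: "continuous_on UNIV F" using F by (rule lipschitz_on_continuous_on)
    then have cF2: "continuous_on UNIV (\<lambda>x::'a \<times> 'a. F (fst x))"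
      by (rule continuous_on_compose2) (auto intro!: continuous_intros)
    have L: "0 \<le> L" using F by (rule lipschitz_on_nonneg)
    have lF2: "L-lipschitz_on UNIV (\<lambda>x::'a \<times> 'a. F (fst x))"
    proof (rule lipschitz_onI[OF _ L])
      fix x y :: "'a \<times> 'a"
      have "dist (F (fst x)) (F (fst y)) \<le> L * dist (fst x) (fst y)" using lipschitz_onD[OF F] by auto
      also have "\<dots> \<le> L * dist x y" using L by (intro mult_left_mono dist_fst_le)
      finally show "dist (F (fst x)) (F (fst y)) \<le> L * dist x y" .
    qed
    have eq: "\<forall>\<^sub>F n in sequentially. measure_pmf.expectation (w (r n)) (\<lambda>i. F (fst i)) = measure_pmf.expectation (P (r n)) (\<lambda>l. F (fst (X (r n) q l, X (r n) q l)))"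
      using ev[OF eventually_on_grid[OF q]]
    proof eventually_elim
      case (elim n)
      have "measure_pmf.expectation (map_pmf (\<lambda>l. l ! time_index (r n) q) (P (r n))) (\<lambda>i. F (fst i)) = measure_pmf.expectation (w (r n)) (\<lambda>i. F (fst i))"
        unfolding P_def by (subst nth_chain_pmf[OF invar]) (use time_index_le[OF elim] in \<open>auto simp: N_def\<close>)
      then show ?case by (simp add: X_grid[OF elim])
    qed
    have "(\<lambda>n. measure_pmf.expectation (w (r n)) (\<lambda>i. F (fst i)) - (\<integral>x. F (fst (x, b x)) \<partial>m)) \<longlonglongrightarrow> 0"
      by (rule Lim_null_comparison[OF _ h3[of L]]) (use wF[OF cF2 lF2] in auto)
    then have "(\<lambda>n. measure_pmf.expectation (w (r n)) (\<lambda>i. F (fst i))) \<longlonglongrightarrow> (\<integral>x. F x \<partial>m)"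
      by (simp add: LIM_zero_iff)
    from Lim_transform_eventually[OF this eq] lim2[OF cF2 q q]
    show "(\<integral>t. F (G q t) \<partial>\<tau>) = (\<integral>x. F x \<partial>m)"
      using LIMSEQ_unique by force
  next
    fix J :: "real set" and s :: real and \<phi> :: "real \<Rightarrow> 'a \<Rightarrow> real"
    assume J: "finite J" "J \<subseteq> \<rat>" and s: "s \<in> \<rat>" and \<phi>: "\<And>q. continuous_on UNIV (\<phi> q)" "\<And>q x. 0 \<le> \<phi> q x \<and> \<phi> q x \<le> 1"
    show "(\<integral>t. (\<Prod>q\<in>J. \<phi> q (G (s + q) t)) \<partial>\<tau>) = (\<integral>t. (\<Prod>q\<in>J. \<phi> q (G q t)) \<partial>\<tau>)"
    proof (cases "J = {}")
      case False
      have pl: "(\<lambda>n. measure_pmf.expectation (P (r n)) (\<lambda>l. \<Prod>q\<in>J. \<phi> q (X (r n) (u + q) l))) \<longlonglongrightarrow> (\<integral>t. (\<Prod>q\<in>J. \<phi> q (G (u + q) t)) \<partial>\<tau>)"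
        if u: "u \<in> \<rat>" for u
      proof -
        have "(\<lambda>n. measure_pmf.expectation (P (r n)) (\<lambda>l. \<Prod>q\<in>J. \<phi> q (G (u + q) (T (r n) l)))) \<longlonglongrightarrow> (\<integral>t. (\<Prod>q\<in>J. \<phi> q (G (u + q) t)) \<partial>\<tau>)"
        proof (rule lim)
          show "continuous_on UNIV (\<lambda>t. \<Prod>q\<in>J. \<phi> q (G (u + q) t))"
            by (intro continuous_on_prod continuous_on_compose2[OF \<phi>(1) G(1)]) auto
          show "\<bar>\<Prod>q\<in>J. \<phi> q (G (u + q) t)\<bar> \<le> 1" for t
            using \<phi>(2) by (simp add: abs_prod) (intro prod_le_1, auto)
        qed
        moreover have "measure_pmf.expectation (P n) (\<lambda>l. \<Prod>q\<in>J. \<phi> q (G (u + q) (T n l)))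
           = measure_pmf.expectation (P n) (\<lambda>l. \<Prod>q\<in>J. \<phi> q (X n (u + q) l))" for n
        proof (intro integral_cong_AE)
          show "AE l in P n. (\<Prod>q\<in>J. \<phi> q (G (u + q) (T n l))) = (\<Prod>q\<in>J. \<phi> q (X n (u + q) l))"
            unfolding AE_measure_pmf_iff using J u by (intro ballI prod.cong refl) (subst GT, auto)
        qed auto
        ultimately show ?thesis by simp
      qed
      have grid: "\<forall>\<^sub>F n in sequentially. \<forall>q\<in>J. on_grid n (u + q)" if "u \<in> \<rat>" for u
        using J that by (intro eventually_ball_finite ballI eventually_on_grid) auto
      \<comment> \<open>The right-hand side does not mention \<open>u\<close>: on the grid, every
        shift of the product has the expectation of one window of the chain, whose index 0
        corresponds to \<open>Min J\<close>.\<close>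
      have key: "measure_pmf.expectation (P n) (\<lambda>l. \<Prod>q\<in>J. \<phi> q (X n (u + q) l))
         = measure_pmf.expectation (chain_pmf (w n) (kern n) (nat \<lfloor>(Max J - Min J) * fact n\<rfloor>))
             (\<lambda>l. \<Prod>q\<in>J. \<phi> q (fst (l ! nat \<lfloor>(q - Min J) * fact n\<rfloor>)))"
        if g: "\<forall>q\<in>J. on_grid n (u + q)" for u n
      proof -
        let ?m = "nat \<lfloor>(Max J - Min J) * fact n\<rfloor>" and ?a = "time_index n (u + Min J)"
        have mm: "Min J \<in> J" "Max J \<in> J" using J False by auto
        have iq: "time_index n (u + q) = ?a + nat \<lfloor>(q - Min J) * fact n\<rfloor>" if "q \<in> J" for q
          using time_index_shift(1)[of n "u + Min J" "u + q"] g mm that J by auto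
        have km: "nat \<lfloor>(q - Min J) * fact n\<rfloor> \<le> ?m" if "q \<in> J" for q
          using J that by (intro nat_mono floor_mono mult_right_mono) auto
        have le: "?a + ?m \<le> N n" using time_index_le[of n "u + Max J"] iq[OF mm(2)] g mm by (auto simp: N_def)
        have "measure_pmf.expectation (P n) (\<lambda>l. \<Prod>q\<in>J. \<phi> q (X n (u + q) l))
          = measure_pmf.expectation (P n) (\<lambda>l. \<Prod>q\<in>J. \<phi> q (fst (take (Suc ?m) (drop ?a l) ! nat \<lfloor>(q - Min J) * fact n\<rfloor>)))"
        proof (intro integral_cong_AE)
          show "AE l in P n. (\<Prod>q\<in>J. \<phi> q (X n (u + q) l)) = (\<Prod>q\<in>J. \<phi> q (fst (take (Suc ?m) (drop ?a l) ! nat \<lfloor>(q - Min J) * fact n\<rfloor>)))"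
            unfolding AE_measure_pmf_iff
          proof (intro ballI prod.cong refl)
            fix l q assume "l \<in> set_pmf (P n)" "q \<in> J"
            then show "\<phi> q (X n (u + q) l) = \<phi> q (fst (take (Suc ?m) (drop ?a l) ! nat \<lfloor>(q - Min J) * fact n\<rfloor>))"
              using lenP[of l n] le km[of q] g by (simp add: X_grid iq nth_window)
          qed
        qed auto
        also have "\<dots> = measure_pmf.expectation (chain_pmf (w n) (kern n) ?m) (\<lambda>l. \<Prod>q\<in>J. \<phi> q (fst (l ! nat \<lfloor>(q - Min J) * fact n\<rfloor>)))"
          unfolding P_def by (rule expectation_window[OF invar le])
        finally show ?thesis .
      qed
      have "\<forall>\<^sub>F n in sequentially. measure_pmf.expectation (P (r n)) (\<lambda>l. \<Prod>q\<in>J. \<phi> q (X (r n) (s + q) l))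
         = measure_pmf.expectation (P (r n)) (\<lambda>l. \<Prod>q\<in>J. \<phi> q (X (r n) (0 + q) l))"
        using ev[OF grid[OF s]] ev[OF grid[OF Rats_0]] by eventually_elim (simp only: key)
      from Lim_transform_eventually[OF pl[OF s] this] pl[OF Rats_0] show ?thesis
        using LIMSEQ_unique by force
    qed simp
  next
    fix p q :: real assume pq: "p \<in> \<rat>" "q \<in> \<rat>" "p \<le> q"
    \<comment> \<open>The positive part makes the integrand nonnegative, so that a vanishing mean
      forces the Lipschitz bound for almost every code.\<close>
    let ?F = "\<lambda>x::'a \<times> 'a. max 0 (norm (snd x - fst x) - 4 * M * (q - p))"
    have cF: "continuous_on UNIV ?F" by (intro continuous_intros)
    have "(\<integral>t. ?F (G p t, G q t) \<partial>\<tau>) \<le> 0"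
    proof (rule LIMSEQ_le[OF lim2[OF cF pq(1,2)] LIMSEQ_subseq_LIMSEQ[OF \<rho>lim[OF pq] r]])
      have "\<forall>\<^sub>F n in sequentially. measure_pmf.expectation (P (r n)) (\<lambda>l. ?F (X (r n) p l, X (r n) q l))
         \<le> approximate_chain.defect_bound (h (r n)) (4 * M) (h (r n) ^ 3) (nat \<lfloor>(q - p) * fact (r n)\<rfloor>)"
        using ev[OF eventually_on_grid[OF pq(1)]] ev[OF eventually_on_grid[OF pq(2)]]
      proof eventually_elim
        case (elim n)
        show ?case
          using approximate_chain.displacement_excess[OF ac, of "r n" "nat \<lfloor>(q - p) * fact (r n)\<rfloor>"]
            two_time[OF elim pq(3) refl, of "\<lambda>x y. ?F (x, y)"]
          by (simp add: Kh[OF elim pq(3)])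
      qed
      then show "\<exists>K. \<forall>n\<ge>K. measure_pmf.expectation (P (r n)) (\<lambda>l. ?F (X (r n) p l, X (r n) q l))
         \<le> ((\<lambda>n. approximate_chain.defect_bound (h n) (4 * M) (h n ^ 3) (nat \<lfloor>(q - p) * fact n\<rfloor>)) \<circ> r) n"
        by (simp add: eventually_sequentially o_def)
    qed
    moreover have "0 \<le> (\<integral>t. ?F (G p t, G q t) \<partial>\<tau>)" by (intro Bochner_Integration.integral_nonneg) auto
    ultimately have z: "(\<integral>t. ?F (G p t, G q t) \<partial>\<tau>) = 0" by linarith
    obtain D where D: "\<And>x. x \<in> cball 0 (2 * B) \<Longrightarrow> \<bar>?F x\<bar> \<le> D" using bounded_comp[OF cF] by metis
    have [measurable]: "G q \<in> borel_measurable borel" for q using G(1) by (rule borel_measurable_continuous_onI)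
    have "integrable \<tau> (\<lambda>t. ?F (G p t, G q t))"
    proof (rule \<tau>.integrable_const_bound[where B = D])
      have "\<bar>?F (G p t, G q t)\<bar> \<le> D" for t
      proof (rule D)
        show "(G p t, G q t) \<in> cball 0 (2 * B)"
          using G(2)[of p t] G(2)[of q t] norm_Pair_le[of "G p t" "G q t"] by simp
      qed
      then show "AE t in \<tau>. norm (?F (G p t, G q t)) \<le> D" by auto
    qed measurable
    then have "AE t in \<tau>. ?F (G p t, G q t) = 0"
      using z by (subst (asm) integral_nonneg_eq_0_iff_AE) auto
    then show "AE t in \<tau>. norm (G q t - G p t) \<le> 4 * M * (q - p)"
      by eventually_elim (auto simp: max_def split: if_splits)
  next
    fix p q :: real and c :: "'a \<Rightarrow> 'a" and Lc assume pq: "p \<in> \<rat>" "q \<in> \<rat>" "p \<le> q" and c: "Lc-lipschitz_on UNIV c"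
    have cc: "continuous_on A c" for A using lipschitz_on_continuous_on[OF c] continuous_on_subset by blast
    have Lc: "0 \<le> Lc" using c by (rule lipschitz_on_nonneg)
    let ?F = "\<lambda>x::'a \<times> 'a. norm (snd x - fst x - (q - p) *\<^sub>R c (fst x))"
    let ?H = "\<lambda>x::'a \<times> 'a. norm (snd x - c (fst x))"
    let ?\<rho> = "\<lambda>n. approximate_chain.defect_bound (h n) (4 * M) (h n ^ 3) (nat \<lfloor>(q - p) * fact n\<rfloor>)"
    have cF: "continuous_on UNIV ?F" by (intro continuous_intros continuous_on_compose2[OF cc[of UNIV]]) auto
    have cH: "continuous_on UNIV ?H" by (intro continuous_intros continuous_on_compose2[OF cc[of UNIV]]) auto
    have lH: "(1 + Lc)-lipschitz_on UNIV ?H"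
    proof (rule lipschitz_onI)
      fix x y :: "'a \<times> 'a"
      have "dist (?H x) (?H y) \<le> norm ((snd x - c (fst x)) - (snd y - c (fst y)))"
        by (simp add: dist_real_def norm_triangle_ineq3)
      also have "\<dots> = norm ((snd x - snd y) - (c (fst x) - c (fst y)))" by (simp add: algebra_simps)
      also have "\<dots> \<le> dist (snd x) (snd y) + dist (c (fst x)) (c (fst y))"
        unfolding dist_norm by (rule norm_triangle_ineq4)
      also have "\<dots> \<le> dist x y + Lc * dist x y"
      proof (intro add_mono dist_snd_le)
        have "dist (c (fst x)) (c (fst y)) \<le> Lc * dist (fst x) (fst y)" using lipschitz_onD[OF c] by auto
        also have "\<dots> \<le> Lc * dist x y" using Lc by (intro mult_left_mono dist_fst_le)
        finally show "dist (c (fst x)) (c (fst y)) \<le> Lc * dist x y" .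
      qed
      finally show "dist (?H x) (?H y) \<le> (1 + Lc) * dist x y" by (simp add: algebra_simps)
    qed (use Lc in simp)
    have "(\<lambda>n. measure_pmf.expectation (w (r n)) ?H - (\<integral>x. ?H (x, b x) \<partial>m)) \<longlonglongrightarrow> 0"
      by (rule Lim_null_comparison[OF _ h3[of "1 + Lc"]]) (use wF[OF cH lH] in auto)
    then have wlim: "(\<lambda>n. measure_pmf.expectation (w (r n)) ?H) \<longlonglongrightarrow> (\<integral>x. norm (b x - c x) \<partial>m)"
      by (simp add: LIM_zero_iff)
    have \<rho>r: "(\<lambda>n. ?\<rho> (r n)) \<longlonglongrightarrow> 0" using LIMSEQ_subseq_LIMSEQ[OF \<rho>lim[OF pq] r] by (simp add: o_def)
    have up: "(\<lambda>n. ?\<rho> (r n) + (q - p) * measure_pmf.expectation (w (r n)) ?H + (q - p) * Lc * (?\<rho> (r n) + 4 * M * (q - p)))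
       \<longlonglongrightarrow> 0 + (q - p) * (\<integral>x. norm (b x - c x) \<partial>m) + (q - p) * Lc * (0 + 4 * M * (q - p))"
      by (intro tendsto_intros wlim \<rho>r)
    have "(\<integral>t. ?F (G p t, G q t) \<partial>\<tau>) \<le> 0 + (q - p) * (\<integral>x. norm (b x - c x) \<partial>m) + (q - p) * Lc * (0 + 4 * M * (q - p))"
    proof (rule LIMSEQ_le[OF lim2[OF cF pq(1,2)] up])
      have "\<forall>\<^sub>F n in sequentially. measure_pmf.expectation (P (r n)) (\<lambda>l. ?F (X (r n) p l, X (r n) q l))
         \<le> ?\<rho> (r n) + (q - p) * measure_pmf.expectation (w (r n)) ?H + (q - p) * Lc * (?\<rho> (r n) + 4 * M * (q - p))"
        using ev[OF eventually_on_grid[OF pq(1)]] ev[OF eventually_on_grid[OF pq(2)]]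
      proof eventually_elim
        case (elim n)
        show ?case
          using approximate_chain.one_step_consistency[OF ac c, of "r n" "nat \<lfloor>(q - p) * fact (r n)\<rfloor>"]
            two_time[OF elim pq(3) refl, of "\<lambda>x y. ?F (x, y)"]
          by (simp add: Kh[OF elim pq(3)])
      qed
      then show "\<exists>K. \<forall>n\<ge>K. measure_pmf.expectation (P (r n)) (\<lambda>l. ?F (X (r n) p l, X (r n) q l))
         \<le> ?\<rho> (r n) + (q - p) * measure_pmf.expectation (w (r n)) ?H + (q - p) * Lc * (?\<rho> (r n) + 4 * M * (q - p))"
        by (simp add: eventually_sequentially)
    qed
    then show "(\<integral>t. norm (G q t - G p t - (q - p) *\<^sub>R c (G p t)) \<partial>\<tau>)
       \<le> (q - p) * (\<integral>x. norm (b x - c x) \<partial>m) + (q - p) * Lc * (4 * M * (q - p))" by simp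
  qed
qed

end

section \<open>The space of curves\<close>

text \<open>A Lipschitz approximation of the indicator of \<open>S\<close>. The empty set is treated
  apart because \<open>infdist\<close> to it is 0, which would give the value 1 everywhere.\<close>

definition tent :: "real \<Rightarrow> 'a::metric_space set \<Rightarrow> 'a \<Rightarrow> real" where
  "tent k S x = (if S = {} then 0 else max 0 (1 - k * infdist x S))"

lemma tent_bounds: "0 \<le> k \<Longrightarrow> 0 \<le> tent k S x" "0 \<le> k \<Longrightarrow> tent k S x \<le> 1"
  by (auto simp: tent_def infdist_nonneg)

lemma tent_lipschitz:
  assumes "0 \<le> k"
  shows "k-lipschitz_on UNIV (tent k S)"
proof (rule lipschitz_onI[OF _ assms])
  fix x y :: 'a
  have "k * \<bar>infdist x S - infdist y S\<bar> \<le> k * dist x y"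
    using assms infdist_triangle_abs by (intro mult_left_mono) auto
  then have "\<bar>k * infdist x S - k * infdist y S\<bar> \<le> k * dist x y"
    using assms by (simp add: abs_mult flip: right_diff_distrib)
  then show "dist (tent k S x) (tent k S y) \<le> k * dist x y"
    using assms unfolding tent_def dist_real_def
    by (cases "S = {}") (simp_all add: max_def abs_le_iff split: if_splits)
qed

lemma tent_tendsto_indicator:
  assumes "closed S"
  shows "(\<lambda>n. tent (real n) S x) \<longlonglongrightarrow> indicator S x"
proof (cases "x \<in> S")
  case True
  then have "S \<noteq> {}" by auto
  then show ?thesis using True by (simp add: tent_def)
next
  case False
  show ?thesis
  proof (cases "S = {}")
    case ne: False
    have pos: "0 < infdist x S"
      using False in_closed_iff_infdist_zero[OF assms ne] infdist_nonneg[of x S] by (metis less_eq_real_def)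
    obtain n0 where "1 / infdist x S \<le> real n0" using real_arch_simple by blast
    then have "tent (real n) S x = 0" if "n \<ge> n0" for n
    proof -
      have "1 / infdist x S \<le> real n" using \<open>1 / infdist x S \<le> real n0\<close> that by linarith
      then have "1 \<le> real n * infdist x S" using pos by (simp add: divide_le_eq)
      then show ?thesis by (simp add: tent_def)
    qed
    then show ?thesis using False by (intro tendsto_eventually eventually_sequentiallyI[of n0]) auto
  qed (simp add: tent_def)
qed

lemma space_curve_space: "space curve_space = {\<gamma>. continuous_on UNIV \<gamma>}"
  by (simp add: curve_space_def space_restrict_space space_PiM PiE_UNIV_domain)

lemma measurable_eval_curve: "(\<lambda>\<gamma>. \<gamma> t) \<in> curve_space \<rightarrow>\<^sub>M borel"
  unfolding curve_space_def by (intro measurable_restrict_space1 measurable_component_singleton) simp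

lemma measurable_into_curve_space:
  assumes "\<And>t. (\<lambda>\<omega>. f \<omega> t) \<in> N \<rightarrow>\<^sub>M borel" "\<And>\<omega>. \<omega> \<in> space N \<Longrightarrow> continuous_on UNIV (f \<omega>)"
  shows "f \<in> N \<rightarrow>\<^sub>M curve_space"
  unfolding curve_space_def
proof (rule measurable_restrict_space2)
  show "f \<in> N \<rightarrow>\<^sub>M Pi\<^sub>M UNIV (\<lambda>_. borel)"
    using measurable_PiM_single'[of UNIV "\<lambda>t \<omega>. f \<omega> t" N "\<lambda>_. borel"] assms(1) by (simp add: PiE_UNIV_domain)
qed (use assms(2) in auto)

lemma measurable_shift [measurable]: "shift t \<in> curve_space \<rightarrow>\<^sub>M curve_space"
proof (rule measurable_into_curve_space)
  show "(\<lambda>\<gamma>. shift t \<gamma> s) \<in> curve_space \<rightarrow>\<^sub>M borel" for s unfolding shift_def by (rule measurable_eval_curve)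
  show "continuous_on UNIV (shift t \<gamma>)" if "\<gamma> \<in> space curve_space" for \<gamma> :: "real \<Rightarrow> 'a"
    using that unfolding shift_def space_curve_space mem_Collect_eq
    by (rule continuous_on_compose2) (auto intro!: continuous_intros)
qed

definition grid_approx :: "nat \<Rightarrow> real \<Rightarrow> real" where
  "grid_approx n t = of_int \<lfloor>real (Suc n) * t\<rfloor> / real (Suc n)"

lemma grid_approx_Rats: "grid_approx n t \<in> \<rat>"
  by (simp add: grid_approx_def)

lemma grid_approx_tendsto: "(\<lambda>n. grid_approx n t) \<longlonglongrightarrow> t"
proof (rule tendsto_sandwich[of "\<lambda>n. t - inverse (real (Suc n))" _ _ "\<lambda>_. t"])
  have "t - inverse (real (Suc n)) \<le> grid_approx n t" "grid_approx n t \<le> t" for n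
  proof -
    have "real (Suc n) * t - 1 \<le> of_int \<lfloor>real (Suc n) * t\<rfloor>" "of_int \<lfloor>real (Suc n) * t\<rfloor> \<le> real (Suc n) * t" by linarith+
    then have "(real (Suc n) * t - 1) / real (Suc n) \<le> grid_approx n t" "grid_approx n t \<le> (real (Suc n) * t) / real (Suc n)"
      unfolding grid_approx_def by (intro divide_right_mono; simp)+
    then show "t - inverse (real (Suc n)) \<le> grid_approx n t" "grid_approx n t \<le> t"
      by (simp_all add: diff_divide_distrib inverse_eq_divide del: of_nat_Suc)
  qed
  then show "\<forall>\<^sub>F n in sequentially. t - inverse (real (Suc n)) \<le> grid_approx n t"
    "\<forall>\<^sub>F n in sequentially. grid_approx n t \<le> t" by auto
  show "(\<lambda>n. t - inverse (real (Suc n))) \<longlonglongrightarrow> t"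
    using tendsto_diff[OF tendsto_const LIMSEQ_inverse_real_of_nat, of t] by simp
qed auto

text \<open>For a continuous curve, evaluation at \<open>t\<close> is the limit of evaluations at
  \<open>grid_approx n t\<close>. These take countably many values of time, so each approximation is
  measurable piece by piece.\<close>

lemma measurable_eval_joint:
  "(\<lambda>(\<gamma>, t). \<gamma> t) \<in> (curve_space :: (real \<Rightarrow> 'a::euclidean_space) measure) \<Otimes>\<^sub>M borel \<rightarrow>\<^sub>M borel"
proof (rule borel_measurable_LIMSEQ_metric)
  fix n
  have "(\<lambda>x. (\<lambda>i x. fst x (of_int i / real (Suc n))) \<lfloor>real (Suc n) * snd x\<rfloor> x)
     \<in> (curve_space :: (real \<Rightarrow> 'a) measure) \<Otimes>\<^sub>M borel \<rightarrow>\<^sub>M borel"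
    by (rule measurable_compose_countable) (rule measurable_compose[OF measurable_fst measurable_eval_curve], measurable)
  then show "(\<lambda>x. fst x (grid_approx n (snd x))) \<in> (curve_space :: (real \<Rightarrow> 'a) measure) \<Otimes>\<^sub>M borel \<rightarrow>\<^sub>M borel"
    by (simp add: grid_approx_def)
next
  fix x :: "(real \<Rightarrow> 'a) \<times> real" assume "x \<in> space (curve_space \<Otimes>\<^sub>M borel)"
  then have "continuous_on UNIV (fst x)" by (auto simp: space_pair_measure space_curve_space)
  then have "isCont (fst x) (snd x)" by (simp add: continuous_on_eq_continuous_at)
  then have "(\<lambda>n. fst x (grid_approx n (snd x))) \<longlonglongrightarrow> fst x (snd x)"
    using grid_approx_tendsto by (rule isCont_tendsto_compose)
  then show "(\<lambda>n. fst x (grid_approx n (snd x))) \<longlonglongrightarrow> (case x of (\<gamma>, t) \<Rightarrow> \<gamma> t)" by (simp add: case_prod_beta)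
qed

lemma measurable_eval:
  assumes "f \<in> N \<rightarrow>\<^sub>M (curve_space :: (real \<Rightarrow> 'a::euclidean_space) measure)" "g \<in> N \<rightarrow>\<^sub>M borel"
  shows "(\<lambda>x. f x (g x)) \<in> N \<rightarrow>\<^sub>M borel"
  using measurable_compose[OF measurable_Pair[OF assms] measurable_eval_joint] by simp

text \<open>Closed sets form an intersection-stable generator, and tents approximate their
  indicators. Lipschitz test functions are the ones for which the limit process provides the law
  \<open>m\<close>.\<close>

lemma borel_measure_eqI_lipschitz:
  fixes \<mu> \<nu> :: "'a::euclidean_space measure"
  assumes "prob_space \<mu>" "prob_space \<nu>" "sets \<mu> = sets borel" "sets \<nu> = sets borel"
    and eq: "\<And>F L. L-lipschitz_on UNIV F \<Longrightarrow> (\<integral>x. F x \<partial>\<mu>) = ((\<integral>x. F x \<partial>\<nu>) :: real)"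
  shows "\<mu> = \<nu>"
proof (rule measure_eqI_generator_eq[where E = "Collect closed" and \<Omega> = UNIV and A = "\<lambda>_. UNIV"])
  interpret \<mu>: prob_space \<mu> by fact
  interpret \<nu>: prob_space \<nu> by fact
  show "sets \<mu> = sigma_sets UNIV (Collect closed)" "sets \<nu> = sigma_sets UNIV (Collect closed)"
    using assms(3,4) by (simp_all add: borel_eq_closed)
  fix S :: "'a set" assume "S \<in> Collect closed"
  then have S: "closed S" by simp
  then have [measurable]: "S \<in> sets \<mu>" "S \<in> sets \<nu>" using assms(3,4) by auto
  have m: "tent (real n) S \<in> borel_measurable \<mu>" "tent (real n) S \<in> borel_measurable \<nu>" for n
    using borel_measurable_continuous_onI[OF lipschitz_on_continuous_on[OF tent_lipschitz[of "real n" S]]] assms(3,4)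
    by (auto cong: measurable_cong_sets)
  have "(\<lambda>n. \<integral>x. tent (real n) S x \<partial>\<mu>) \<longlonglongrightarrow> (\<integral>x. indicator S x \<partial>\<mu>)"
    by (rule integral_dominated_convergence[where w = "\<lambda>_. 1"])
       (use m tent_tendsto_indicator[OF S] in \<open>auto simp: tent_bounds\<close>)
  moreover have "(\<lambda>n. \<integral>x. tent (real n) S x \<partial>\<nu>) \<longlonglongrightarrow> (\<integral>x. indicator S x \<partial>\<nu>)"
    by (rule integral_dominated_convergence[where w = "\<lambda>_. 1"])
       (use m tent_tendsto_indicator[OF S] in \<open>auto simp: tent_bounds\<close>)
  moreover have "(\<integral>x. tent (real n) S x \<partial>\<mu>) = (\<integral>x. tent (real n) S x \<partial>\<nu>)" for n
    using eq[OF tent_lipschitz] by simp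
  ultimately have "measure \<mu> S = measure \<nu> S" using LIMSEQ_unique by simp
  then show "emeasure \<mu> S = emeasure \<nu> S" by (simp add: \<mu>.emeasure_eq_measure \<nu>.emeasure_eq_measure)
next
  show "emeasure \<mu> UNIV \<noteq> \<infinity>"
    using assms(1,3) by (metis ennreal_top_neq_one infinity_ennreal_def prob_space.emeasure_space_1 sets_eq_imp_space_eq space_borel)
qed (auto simp: Int_stable_def)

lemma sets_PiM_closed_boxes:
  "sets (Pi\<^sub>M UNIV (\<lambda>_. borel :: 'a::euclidean_space measure))
   = sigma_sets UNIV {{f. \<forall>i\<in>j. f i \<in> A i} | A j. finite j \<and> (\<forall>i\<in>j. closed (A i))}"
proof -
  have "sets (Pi\<^sub>M UNIV (\<lambda>_. sigma UNIV (Collect closed) :: 'a measure))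
    = sets (sigma (PiE UNIV (\<lambda>_. UNIV)) {{f \<in> PiE UNIV (\<lambda>_. UNIV). \<forall>i\<in>j. f i \<in> A i} | A j. j \<in> Collect finite \<and> A \<in> Pi j (\<lambda>_. Collect closed)})"
  proof (rule sets_PiM_sigma)
    show "\<exists>S\<subseteq>Collect closed. countable S \<and> (UNIV :: 'a set) = \<Union> S" by (intro exI[of _ "{UNIV}"]) auto
  qed auto
  also have "\<dots> = sigma_sets UNIV {{f. \<forall>i\<in>j. f i \<in> A i} | A j. finite j \<and> (\<forall>i\<in>j. closed (A i))}"
    by (simp add: PiE_UNIV_domain Pi_iff)
  finally show ?thesis by (simp add: borel_eq_closed)
qed

text \<open>Finite-dimensional laws determine a measure on curves: products of tents converge to
  indicators of closed boxes. The test functions have values in [0,1], so 1 dominates their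
  products, and they have the shape in which stationarity of the limit process is known.\<close>

lemma curve_measure_eqI:
  fixes \<mu> \<nu> :: "(real \<Rightarrow> 'a::euclidean_space) measure"
  assumes "prob_space \<mu>" "prob_space \<nu>" and sets: "sets \<mu> = sets curve_space" "sets \<nu> = sets curve_space"
    and eq: "\<And>J \<phi>. finite J \<Longrightarrow> (\<And>t. continuous_on UNIV (\<phi> t)) \<Longrightarrow> (\<And>t x. 0 \<le> \<phi> t x \<and> \<phi> t x \<le> 1) \<Longrightarrow>
       (\<integral>\<gamma>. (\<Prod>t\<in>J. \<phi> t (\<gamma> t)) \<partial>\<mu>) = ((\<integral>\<gamma>. (\<Prod>t\<in>J. \<phi> t (\<gamma> t)) \<partial>\<nu>) :: real)"
  shows "\<mu> = \<nu>"
proof -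
  interpret \<mu>: prob_space \<mu> by fact
  interpret \<nu>: prob_space \<nu> by fact
  let ?P = "Pi\<^sub>M UNIV (\<lambda>_. borel) :: (real \<Rightarrow> 'a) measure"
  have id: "(\<lambda>\<gamma>. \<gamma>) \<in> curve_space \<rightarrow>\<^sub>M ?P"
    unfolding curve_space_def by (rule measurable_restrict_space1) simp
  have id\<mu> [measurable]: "(\<lambda>\<gamma>. \<gamma>) \<in> \<mu> \<rightarrow>\<^sub>M ?P" and id\<nu> [measurable]: "(\<lambda>\<gamma>. \<gamma>) \<in> \<nu> \<rightarrow>\<^sub>M ?P"
    using id sets by (auto cong: measurable_cong_sets)
  have ev [measurable]: "(\<lambda>\<gamma>. \<gamma> t) \<in> \<mu> \<rightarrow>\<^sub>M borel" "(\<lambda>\<gamma>. \<gamma> t) \<in> \<nu> \<rightarrow>\<^sub>M borel" for t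
    using measurable_eval_curve[of t] sets by (auto cong: measurable_cong_sets)
  have sp: "space \<mu> = space curve_space" "space \<nu> = space curve_space" using sets by (auto dest: sets_eq_imp_space_eq)
  let ?E = "{{f :: real \<Rightarrow> 'a. \<forall>i\<in>j. f i \<in> A i} | A j. finite j \<and> (\<forall>i\<in>j. closed (A i))}"
  \<comment> \<open>The comparison takes place on the full product space, where the boxes form an
    intersection-stable generator. Measurable sets of curves are the traces of measurable sets
    there.\<close>
  have D: "distr \<mu> ?P (\<lambda>\<gamma>. \<gamma>) = distr \<nu> ?P (\<lambda>\<gamma>. \<gamma>)"
  proof (rule measure_eqI_generator_eq[where E = ?E and \<Omega> = UNIV and A = "\<lambda>_. UNIV"])
    show "Int_stable ?E"
    proof (rule Int_stableI)
      fix a b assume "a \<in> ?E" "b \<in> ?E"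
      then obtain A j B k where a: "a = {f. \<forall>i\<in>j. f i \<in> A i}" "finite j" "\<forall>i\<in>j. closed (A i)"
        and b: "b = {f. \<forall>i\<in>k. f i \<in> B i}" "finite k" "\<forall>i\<in>k. closed (B i)" by auto
      have "a \<inter> b = {f. \<forall>i\<in>j \<union> k. f i \<in> (if i \<in> j then A i else UNIV) \<inter> (if i \<in> k then B i else UNIV)}"
        unfolding a(1) b(1) by auto
      then show "a \<inter> b \<in> ?E" using a b
        by (intro CollectI exI[of _ "\<lambda>i. (if i \<in> j then A i else UNIV) \<inter> (if i \<in> k then B i else UNIV)"] exI[of _ "j \<union> k"]) auto
    qed
    show "sets (distr \<mu> ?P (\<lambda>\<gamma>. \<gamma>)) = sigma_sets UNIV ?E" "sets (distr \<nu> ?P (\<lambda>\<gamma>. \<gamma>)) = sigma_sets UNIV ?E"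
      by (simp_all add: sets_PiM_closed_boxes)
    show "range (\<lambda>_. UNIV) \<subseteq> ?E" by (auto intro!: exI[of _ "{}"])
    show "emeasure (distr \<mu> ?P (\<lambda>\<gamma>. \<gamma>)) UNIV \<noteq> \<infinity>" for i
      using prob_space.emeasure_space_1[OF \<mu>.prob_space_distr[OF id\<mu>]] by (simp add: space_PiM PiE_UNIV_domain)
    fix X assume "X \<in> ?E"
    then obtain A j where X: "X = {f. \<forall>i\<in>j. f i \<in> A i}" "finite j" "\<forall>i\<in>j. closed (A i)" by auto
    have XP: "X \<in> sets ?P" using \<open>X \<in> ?E\<close> unfolding sets_PiM_closed_boxes by (rule sigma_sets.Basic)
    define \<phi> where "\<phi> n t = (if t \<in> j then tent (real n) (A t) else (\<lambda>_. 0))" for n t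
    have \<phi>: "continuous_on UNIV (\<phi> n t)" "0 \<le> \<phi> n t x \<and> \<phi> n t x \<le> 1" for n t x
      using lipschitz_on_continuous_on[OF tent_lipschitz[of "real n" "A t"]] by (auto simp: \<phi>_def tent_bounds)
    have \<phi>m [measurable]: "\<phi> n t \<in> borel_measurable borel" for n t
      using \<phi>(1) by (rule borel_measurable_continuous_onI)
    have lim: "(\<lambda>n. \<Prod>t\<in>j. \<phi> n t (\<gamma> t)) \<longlonglongrightarrow> indicator X \<gamma>" for \<gamma>
    proof -
      have "(\<lambda>n. \<Prod>t\<in>j. \<phi> n t (\<gamma> t)) \<longlonglongrightarrow> (\<Prod>t\<in>j. indicator (A t) (\<gamma> t))"
        using X by (intro tendsto_prod) (auto simp: \<phi>_def tent_tendsto_indicator)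
      also have "(\<Prod>t\<in>j. indicator (A t) (\<gamma> t)) = (indicator X \<gamma> :: real)"
        using X(2) by (auto simp: X(1) indicator_def prod_eq_1_iff intro!: prod.neutral prod_zero)
      finally show ?thesis .
    qed
    have bd: "\<bar>\<Prod>t\<in>j. \<phi> n t (\<gamma> t)\<bar> \<le> 1" for n \<gamma>
      using \<phi>(2) by (simp add: abs_prod) (intro prod_le_1, auto)
    have X\<mu>: "X \<inter> space \<mu> \<in> sets \<mu>" and X\<nu>: "X \<inter> space \<nu> \<in> sets \<nu>"
      using measurable_sets[OF id\<mu> XP] measurable_sets[OF id\<nu> XP] by auto
    have "(\<lambda>n. \<integral>\<gamma>. (\<Prod>t\<in>j. \<phi> n t (\<gamma> t)) \<partial>\<mu>) \<longlonglongrightarrow> (\<integral>\<gamma>. indicator X \<gamma> \<partial>\<mu>)"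
      by (rule integral_dominated_convergence[where w = "\<lambda>_. 1"])
         (use lim bd X\<mu> in \<open>auto simp: borel_measurable_indicator_iff\<close>)
    moreover have "(\<lambda>n. \<integral>\<gamma>. (\<Prod>t\<in>j. \<phi> n t (\<gamma> t)) \<partial>\<nu>) \<longlonglongrightarrow> (\<integral>\<gamma>. indicator X \<gamma> \<partial>\<nu>)"
      by (rule integral_dominated_convergence[where w = "\<lambda>_. 1"])
         (use lim bd X\<nu> in \<open>auto simp: borel_measurable_indicator_iff\<close>)
    moreover have "(\<integral>\<gamma>. (\<Prod>t\<in>j. \<phi> n t (\<gamma> t)) \<partial>\<mu>) = (\<integral>\<gamma>. (\<Prod>t\<in>j. \<phi> n t (\<gamma> t)) \<partial>\<nu>)" for n
      by (rule eq[OF X(2) \<phi>])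
    ultimately have "(\<integral>\<gamma>. indicator X \<gamma> \<partial>\<mu>) = ((\<integral>\<gamma>. indicator X \<gamma> \<partial>\<nu>) :: real)" using LIMSEQ_unique by simp
    then have "measure \<mu> (X \<inter> space \<mu>) = measure \<nu> (X \<inter> space \<nu>)" by simp
    then show "emeasure (distr \<mu> ?P (\<lambda>\<gamma>. \<gamma>)) X = emeasure (distr \<nu> ?P (\<lambda>\<gamma>. \<gamma>)) X"
      using XP by (simp add: emeasure_distr \<mu>.emeasure_eq_measure \<nu>.emeasure_eq_measure)
  qed auto
  show ?thesis
  proof (rule measure_eqI)
    show "sets \<mu> = sets \<nu>" using sets by simp
    fix A assume "A \<in> sets \<mu>"
    then have "A \<in> sets curve_space" using sets by simp
    then obtain B where B: "B \<in> sets ?P" "A = B \<inter> space curve_space"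
      unfolding space_curve_space unfolding curve_space_def sets_restrict_space by auto
    have "emeasure \<mu> A = emeasure (distr \<mu> ?P (\<lambda>\<gamma>. \<gamma>)) B"
      using B by (simp add: emeasure_distr sp)
    also have "\<dots> = emeasure \<nu> A"
      unfolding D using B by (simp add: emeasure_distr sp)
    finally show "emeasure \<mu> A = emeasure \<nu> A" .
  qed
qed

lemma pred_Ball_countable:
  assumes X: "countable X" and P: "\<And>i. i \<in> X \<Longrightarrow> Measurable.pred N (\<lambda>x. P x i)"
  shows "Measurable.pred N (\<lambda>x. \<forall>i\<in>X. P x i)"
proof (cases "X = {}")
  case False
  have "Measurable.pred N (\<lambda>x. P x (from_nat_into X n))" for n
    by (rule P[OF from_nat_into[OF False]])
  then have "Measurable.pred N (\<lambda>x. \<forall>n. P x (from_nat_into X n))" by measurable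
  moreover have "(\<forall>i\<in>X. P x i) \<longleftrightarrow> (\<forall>n. P x (from_nat_into X n))" for x
    using range_from_nat_into[OF False X] by (metis rangeE rangeI)
  ultimately show ?thesis by simp
qed simp

lemma lipschitz_on_UNIV_of_Rats:
  fixes g :: "real \<Rightarrow> 'a::euclidean_space"
  assumes "C-lipschitz_on \<rat> g" "continuous_on UNIV g"
  shows "C-lipschitz_on UNIV g"
  using lipschitz_on_closure[of C \<rat> g] assms by (simp add: Rats_closure_real)

section \<open>From rational times to a law on curves\<close>

context invariant_field begin

text \<open>The limit is almost surely Lipschitz on the rationals and therefore extends to the line.
  Shift invariance for real shifts follows from rational ones by continuity of curves, and it
  carries the law at time 0 to all times.\<close>

lemma curve_law:
  obtains \<theta> :: "(real \<Rightarrow> 'a) measure" where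
    "prob_space \<theta>" "sets \<theta> = sets curve_space"
    "\<And>s. distr \<theta> curve_space (shift s) = \<theta>"
    "AE \<gamma> in \<theta>. (4 * M)-lipschitz_on UNIV \<gamma>"
    "\<And>t. distr \<theta> borel (\<lambda>\<gamma>. \<gamma> t) = m"
    "\<And>p q c Lc. p \<in> \<rat> \<Longrightarrow> q \<in> \<rat> \<Longrightarrow> p \<le> q \<Longrightarrow> Lc-lipschitz_on UNIV c \<Longrightarrow>
       (\<integral>\<gamma>. norm (\<gamma> q - \<gamma> p - (q - p) *\<^sub>R c (\<gamma> p)) \<partial>\<theta>)
       \<le> (q - p) * (\<integral>x. norm (b x - c x) \<partial>m) + (q - p) * Lc * (4 * M * (q - p))"
proof (rule limit_process)
  fix \<tau> :: "real measure" and G :: "real \<Rightarrow> real \<Rightarrow> 'a" and B :: real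
  assume \<tau>: "prob_space \<tau>" and sets_\<tau>: "sets \<tau> = sets borel"
    and G: "\<And>q. continuous_on UNIV (G q)" "\<And>q t. norm (G q t) \<le> B"
    and law: "\<And>q F L. q \<in> \<rat> \<Longrightarrow> L-lipschitz_on UNIV F \<Longrightarrow> (\<integral>t. F (G q t) \<partial>\<tau>) = ((\<integral>x. F x \<partial>m) :: real)"
    and stat: "\<And>J s \<phi>. finite J \<Longrightarrow> J \<subseteq> \<rat> \<Longrightarrow> s \<in> \<rat> \<Longrightarrow> (\<And>q. continuous_on UNIV (\<phi> q)) \<Longrightarrow> (\<And>q x. 0 \<le> \<phi> q x \<and> \<phi> q x \<le> 1) \<Longrightarrow>
       (\<integral>t. (\<Prod>q\<in>J. \<phi> q (G (s + q) t)) \<partial>\<tau>) = ((\<integral>t. (\<Prod>q\<in>J. \<phi> q (G q t)) \<partial>\<tau>) :: real)"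
    and lip: "\<And>p q. p \<in> \<rat> \<Longrightarrow> q \<in> \<rat> \<Longrightarrow> p \<le> q \<Longrightarrow> AE t in \<tau>. norm (G q t - G p t) \<le> 4 * M * (q - p)"
    and cons: "\<And>p q c Lc. p \<in> \<rat> \<Longrightarrow> q \<in> \<rat> \<Longrightarrow> p \<le> q \<Longrightarrow> Lc-lipschitz_on UNIV c \<Longrightarrow>
       (\<integral>t. norm (G q t - G p t - (q - p) *\<^sub>R c (G p t)) \<partial>\<tau>)
       \<le> (q - p) * (\<integral>x. norm (b x - c x) \<partial>m) + (q - p) * Lc * (4 * M * (q - p))"
  interpret \<tau>: prob_space \<tau> by (rule \<tau>)
  note measurable_eval_curve [measurable]
  have mG [measurable]: "G q \<in> \<tau> \<rightarrow>\<^sub>M borel" for q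
    using borel_measurable_continuous_onI[OF G(1)[of q]] sets_\<tau> by (auto cong: measurable_cong_sets)
  define good where "good \<omega> \<longleftrightarrow> (\<forall>p\<in>\<rat>. \<forall>q\<in>\<rat>. dist (G p \<omega>) (G q \<omega>) \<le> 4 * M * dist p q)" for \<omega>
  \<comment> \<open>Off the good event the zero curve is taken, so that every value of
    \<open>\<Gamma>\<close> is a Lipschitz curve and the map goes into \<open>curve_space\<close>
    without exception.\<close>
  define \<Gamma> where "\<Gamma> \<omega> t = (if good \<omega> then lim (\<lambda>n. G (grid_approx n t) \<omega>) else 0)" for \<omega> t
  have M4: "0 \<le> 4 * M" using M_ge_1 by simp
  have good_m [measurable]: "Measurable.pred \<tau> good"
    unfolding good_def
    by (intro pred_Ball_countable countable_rat) measurable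
  have "AE \<omega> in \<tau>. \<forall>p\<in>\<rat>. \<forall>q\<in>\<rat>. dist (G p \<omega>) (G q \<omega>) \<le> 4 * M * dist p q"
  proof (intro AE_ball_countable' countable_rat)
    fix p q :: real assume pq: "p \<in> \<rat>" "q \<in> \<rat>"
    show "AE \<omega> in \<tau>. dist (G p \<omega>) (G q \<omega>) \<le> 4 * M * dist p q"
    proof (cases "p \<le> q")
      case True
      show ?thesis using lip[OF pq True] by eventually_elim (use True in \<open>simp add: dist_norm norm_minus_commute dist_real_def\<close>)
    next
      case False
      then have "q \<le> p" by simp
      show ?thesis using lip[OF pq(2,1) \<open>q \<le> p\<close>] by eventually_elim (use False in \<open>simp add: dist_norm norm_minus_commute dist_real_def\<close>)
    qed
  qed
  then have AEgood: "AE \<omega> in \<tau>. good \<omega>" by (simp add: good_def)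
  have \<Gamma>good: "(4 * M)-lipschitz_on UNIV (\<Gamma> \<omega>)" "\<And>q. q \<in> \<rat> \<Longrightarrow> \<Gamma> \<omega> q = G q \<omega>" if "good \<omega>" for \<omega>
  proof -
    have "(4 * M)-lipschitz_on \<rat> (\<lambda>q. G q \<omega>)"
      using that M4 by (intro lipschitz_onI) (auto simp: good_def)
    from lipschitz_extend_closure[OF this] obtain g where g: "(4 * M)-lipschitz_on UNIV g" "\<And>q. q \<in> \<rat> \<Longrightarrow> g q = G q \<omega>"
      by (auto simp: Rats_closure_real)
    have "\<Gamma> \<omega> t = g t" for t
    proof -
      have "isCont g t" using lipschitz_on_continuous_on[OF g(1)] by (simp add: continuous_on_eq_continuous_at)
      then have "(\<lambda>n. g (grid_approx n t)) \<longlonglongrightarrow> g t"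
        using grid_approx_tendsto by (rule isCont_tendsto_compose)
      then have "(\<lambda>n. G (grid_approx n t) \<omega>) \<longlonglongrightarrow> g t" by (simp add: g(2)[OF grid_approx_Rats])
      then show ?thesis using that by (simp add: \<Gamma>_def limI)
    qed
    then have "\<Gamma> \<omega> = g" by auto
    then show "(4 * M)-lipschitz_on UNIV (\<Gamma> \<omega>)" "\<And>q. q \<in> \<rat> \<Longrightarrow> \<Gamma> \<omega> q = G q \<omega>" using g by auto
  qed
  have \<Gamma>lip: "(4 * M)-lipschitz_on UNIV (\<Gamma> \<omega>)" for \<omega>
  proof (cases "good \<omega>")
    case False
    then have "\<Gamma> \<omega> = (\<lambda>_. 0)" by (auto simp: \<Gamma>_def)
    then show ?thesis using M4 by (auto intro: lipschitz_onI)
  qed (rule \<Gamma>good)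
  have \<Gamma>m [measurable]: "\<Gamma> \<in> \<tau> \<rightarrow>\<^sub>M curve_space"
  proof (rule measurable_into_curve_space)
    show "(\<lambda>\<omega>. \<Gamma> \<omega> t) \<in> \<tau> \<rightarrow>\<^sub>M borel" for t
      unfolding \<Gamma>_def by (intro measurable_If borel_measurable_lim_metric mG) measurable
    show "continuous_on UNIV (\<Gamma> \<omega>)" for \<omega> using \<Gamma>lip by (rule lipschitz_on_continuous_on)
  qed
  define \<theta> where "\<theta> = distr \<tau> curve_space \<Gamma>"
  have \<theta>: "prob_space \<theta>" unfolding \<theta>_def by (rule \<tau>.prob_space_distr[OF \<Gamma>m])
  have sets_\<theta>: "sets \<theta> = sets curve_space" by (simp add: \<theta>_def)
  interpret \<theta>: prob_space \<theta> by (rule \<theta>)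
  have ev [measurable]: "(\<lambda>\<gamma>. \<gamma> t) \<in> \<theta> \<rightarrow>\<^sub>M borel" for t
    using measurable_eval_curve[of t] sets_\<theta> by (auto cong: measurable_cong_sets)
  have sh [measurable]: "shift s \<in> \<theta> \<rightarrow>\<^sub>M curve_space" for s
    using measurable_shift[of s] sets_\<theta> by (auto cong: measurable_cong_sets)
  have cont: "continuous_on UNIV \<gamma>" if "\<gamma> \<in> space \<theta>" for \<gamma>
    using that by (simp add: \<theta>_def space_curve_space)
  have transfer1: "(\<integral>\<gamma>. F (\<gamma> p) (\<gamma> q) \<partial>\<theta>) = (\<integral>\<omega>. F (G p \<omega>) (G q \<omega>) \<partial>\<tau>)"
    if F: "(\<lambda>x. F (fst x) (snd x)) \<in> borel_measurable (borel \<Otimes>\<^sub>M borel)" and pq: "p \<in> \<rat>" "q \<in> \<rat>" for F :: "'a \<Rightarrow> 'a \<Rightarrow> real" and p q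
  proof -
    have [measurable]: "(\<lambda>x. F (f x) (g x)) \<in> borel_measurable N" if "f \<in> N \<rightarrow>\<^sub>M borel" "g \<in> N \<rightarrow>\<^sub>M borel" for f g and N :: "'c measure"
      using measurable_compose[OF measurable_Pair[OF that] F] by simp
    have "(\<integral>\<gamma>. F (\<gamma> p) (\<gamma> q) \<partial>\<theta>) = (\<integral>\<omega>. F (\<Gamma> \<omega> p) (\<Gamma> \<omega> q) \<partial>\<tau>)"
      unfolding \<theta>_def by (rule integral_distr) measurable
    also have "\<dots> = (\<integral>\<omega>. F (G p \<omega>) (G q \<omega>) \<partial>\<tau>)"
    proof (rule integral_cong_AE)
      show "AE \<omega> in \<tau>. F (\<Gamma> \<omega> p) (\<Gamma> \<omega> q) = F (G p \<omega>) (G q \<omega>)"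
        using AEgood by eventually_elim (simp add: \<Gamma>good pq)
    qed measurable
    finally show ?thesis .
  qed
  have statR: "(\<integral>\<gamma>. (\<Prod>t\<in>J. \<phi> t (\<gamma> (s + t))) \<partial>\<theta>) = ((\<integral>\<gamma>. (\<Prod>t\<in>J. \<phi> t (\<gamma> t)) \<partial>\<theta>) :: real)"
    if J: "finite J" and \<phi>: "\<And>t. continuous_on UNIV (\<phi> t)" "\<And>t x. 0 \<le> \<phi> t x \<and> \<phi> t x \<le> 1" for J s and \<phi> :: "real \<Rightarrow> 'a \<Rightarrow> real"
  proof -
    have [measurable]: "\<phi> t \<in> borel_measurable borel" for t using \<phi>(1) by (rule borel_measurable_continuous_onI)
    have bd: "\<bar>\<Prod>t\<in>A. \<phi> t (f t)\<bar> \<le> 1" for f and A :: "real set"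
      using \<phi>(2) by (simp add: abs_prod) (intro prod_le_1, auto)
    have rat: "(\<integral>\<gamma>. (\<Prod>t\<in>J. \<phi> t (\<gamma> (u + k t))) \<partial>\<theta>) = (\<integral>\<gamma>. (\<Prod>t\<in>J. \<phi> t (\<gamma> (k t))) \<partial>\<theta>)"
      if u: "u \<in> \<rat>" and k: "\<And>t. k t \<in> \<rat>" for u :: real and k :: "real \<Rightarrow> real"
    proof -
      \<comment> \<open>\<open>k\<close> need not be injective on \<open>J\<close>: distinct times
        may have the same rational approximation. Factors at the same rational time are multiplied
        into one test function, as \<open>stat\<close> has a single factor per time.\<close>
      define \<psi> where "\<psi> q x = (\<Prod>t\<in>{t\<in>J. k t = q}. \<phi> t x)" for q x
      have \<psi>: "continuous_on UNIV (\<psi> q)" "0 \<le> \<psi> q x \<and> \<psi> q x \<le> 1" for q x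
        unfolding \<psi>_def using \<phi> by (auto intro!: continuous_on_prod prod_nonneg prod_le_1)
      have [measurable]: "\<psi> q \<in> borel_measurable borel" for q using \<psi>(1) by (rule borel_measurable_continuous_onI)
      have group: "(\<Prod>t\<in>J. \<phi> t (f (k t))) = (\<Prod>q\<in>k ` J. \<psi> q (f q))" for f
        unfolding \<psi>_def by (subst prod.image_gen[OF J, of _ k]) (auto intro!: prod.cong)
      have tr: "(\<integral>\<gamma>. (\<Prod>q\<in>k ` J. \<psi> q (\<gamma> (v + q))) \<partial>\<theta>) = (\<integral>\<omega>. (\<Prod>q\<in>k ` J. \<psi> q (G (v + q) \<omega>)) \<partial>\<tau>)" if v: "v \<in> \<rat>" for v
      proof -
        have "(\<integral>\<gamma>. (\<Prod>q\<in>k ` J. \<psi> q (\<gamma> (v + q))) \<partial>\<theta>) = (\<integral>\<omega>. (\<Prod>q\<in>k ` J. \<psi> q (\<Gamma> \<omega> (v + q))) \<partial>\<tau>)"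
          unfolding \<theta>_def by (rule integral_distr) measurable
        also have "\<dots> = (\<integral>\<omega>. (\<Prod>q\<in>k ` J. \<psi> q (G (v + q) \<omega>)) \<partial>\<tau>)"
        proof (rule integral_cong_AE)
          show "AE \<omega> in \<tau>. (\<Prod>q\<in>k ` J. \<psi> q (\<Gamma> \<omega> (v + q))) = (\<Prod>q\<in>k ` J. \<psi> q (G (v + q) \<omega>))"
            using AEgood by eventually_elim (use k v in \<open>auto simp: \<Gamma>good intro!: prod.cong\<close>)
        qed measurable
        finally show ?thesis .
      qed
      have "(\<integral>\<omega>. (\<Prod>q\<in>k ` J. \<psi> q (G (u + q) \<omega>)) \<partial>\<tau>) = (\<integral>\<omega>. (\<Prod>q\<in>k ` J. \<psi> q (G q \<omega>)) \<partial>\<tau>)"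
        using J k u \<psi> by (intro stat) auto
      then have "(\<integral>\<gamma>. (\<Prod>q\<in>k ` J. \<psi> q (\<gamma> (u + q))) \<partial>\<theta>) = (\<integral>\<gamma>. (\<Prod>q\<in>k ` J. \<psi> q (\<gamma> q)) \<partial>\<theta>)"
        using tr[OF u] tr[of 0] by simp
      then show ?thesis by (simp only: group group[of "\<lambda>t. _ (u + t)"])
    qed
    \<comment> \<open>The shift and the times are approximated separately, so that both sides of the
      limit use the same rational times and differ only in a rational shift, which
      \<open>rat\<close> removes.\<close>
    have lim: "(\<lambda>n. \<integral>\<gamma>. (\<Prod>t\<in>J. \<phi> t (\<gamma> (grid_approx n v + grid_approx n t))) \<partial>\<theta>) \<longlonglongrightarrow> (\<integral>\<gamma>. (\<Prod>t\<in>J. \<phi> t (\<gamma> (v + t))) \<partial>\<theta>)" for v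
    proof (rule integral_dominated_convergence[where w = "\<lambda>_. 1"])
      show "AE \<gamma> in \<theta>. (\<lambda>n. \<Prod>t\<in>J. \<phi> t (\<gamma> (grid_approx n v + grid_approx n t))) \<longlonglongrightarrow> (\<Prod>t\<in>J. \<phi> t (\<gamma> (v + t)))"
      proof (intro AE_I2 tendsto_prod)
        fix \<gamma> t assume "\<gamma> \<in> space \<theta>"
        then have "continuous_on UNIV (\<lambda>u. \<phi> t (\<gamma> u))"
          using cont by (intro continuous_on_compose2[OF \<phi>(1)]) auto
        then have "isCont (\<lambda>u. \<phi> t (\<gamma> u)) (v + t)" by (simp add: continuous_on_eq_continuous_at)
        then show "(\<lambda>n. \<phi> t (\<gamma> (grid_approx n v + grid_approx n t))) \<longlonglongrightarrow> \<phi> t (\<gamma> (v + t))"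
          by (rule isCont_tendsto_compose[where g = "\<lambda>u. \<phi> t (\<gamma> u)"]) (intro tendsto_add grid_approx_tendsto)
      qed
    qed (use bd in auto)
    have "(\<integral>\<gamma>. (\<Prod>t\<in>J. \<phi> t (\<gamma> (grid_approx n s + grid_approx n t))) \<partial>\<theta>)
        = (\<integral>\<gamma>. (\<Prod>t\<in>J. \<phi> t (\<gamma> (grid_approx n 0 + grid_approx n t))) \<partial>\<theta>)" for n
      using rat[of "grid_approx n s" "grid_approx n"] rat[of "grid_approx n 0" "grid_approx n"] grid_approx_Rats by simp
    then have "(\<integral>\<gamma>. (\<Prod>t\<in>J. \<phi> t (\<gamma> (s + t))) \<partial>\<theta>) = (\<integral>\<gamma>. (\<Prod>t\<in>J. \<phi> t (\<gamma> (0 + t))) \<partial>\<theta>)"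
      using LIMSEQ_unique[OF lim[of s]] lim[of 0] by simp
    then show ?thesis by simp
  qed
  have shift_inv: "distr \<theta> curve_space (shift s) = \<theta>" for s
  proof (rule curve_measure_eqI)
    fix J :: "real set" and \<phi> :: "real \<Rightarrow> 'a \<Rightarrow> real"
    assume J: "finite J" and \<phi>: "\<And>t. continuous_on UNIV (\<phi> t)" "\<And>t x. 0 \<le> \<phi> t x \<and> \<phi> t x \<le> 1"
    have [measurable]: "\<phi> t \<in> borel_measurable borel" for t using \<phi>(1) by (rule borel_measurable_continuous_onI)
    have "(\<integral>\<gamma>. (\<Prod>t\<in>J. \<phi> t (\<gamma> t)) \<partial>distr \<theta> curve_space (shift s)) = (\<integral>\<gamma>. (\<Prod>t\<in>J. \<phi> t (shift s \<gamma> t)) \<partial>\<theta>)"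
      by (rule integral_distr) measurable
    then show "(\<integral>\<gamma>. (\<Prod>t\<in>J. \<phi> t (\<gamma> t)) \<partial>distr \<theta> curve_space (shift s)) = (\<integral>\<gamma>. (\<Prod>t\<in>J. \<phi> t (\<gamma> t)) \<partial>\<theta>)"
      using statR[OF J \<phi>] by (simp add: shift_def)
  qed (use sets_\<theta> \<theta> in \<open>auto intro: \<theta>.prob_space_distr\<close>)
  have law0: "distr \<theta> borel (\<lambda>\<gamma>. \<gamma> 0) = m"
  proof (rule borel_measure_eqI_lipschitz)
    show "prob_space (distr \<theta> borel (\<lambda>\<gamma>. \<gamma> 0))" by (rule \<theta>.prob_space_distr) measurable
    show "prob_space m" by unfold_locales
    fix F :: "'a \<Rightarrow> real" and L assume F: "L-lipschitz_on UNIV F"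
    have [measurable]: "F \<in> borel_measurable borel"
      using lipschitz_on_continuous_on[OF F] by (rule borel_measurable_continuous_onI)
    have "(\<integral>x. F x \<partial>distr \<theta> borel (\<lambda>\<gamma>. \<gamma> 0)) = (\<integral>\<gamma>. F (\<gamma> 0) \<partial>\<theta>)" by (rule integral_distr) measurable
    also have "\<dots> = (\<integral>x. F x \<partial>m)"
      using transfer1[of "\<lambda>x y. F x" 0 0] law[OF Rats_0 F] by simp
    finally show "(\<integral>x. F x \<partial>distr \<theta> borel (\<lambda>\<gamma>. \<gamma> 0)) = (\<integral>x. F x \<partial>m)" .
  qed (auto simp: sets_m)
  show ?thesis
  proof (rule that[of \<theta>])
    show "prob_space \<theta>" "sets \<theta> = sets curve_space" "distr \<theta> curve_space (shift s) = \<theta>" for s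
      by (fact \<theta> sets_\<theta> shift_inv)+
    show "AE \<gamma> in \<theta>. (4 * M)-lipschitz_on UNIV \<gamma>"
    proof -
      have "AE \<gamma> in \<theta>. \<forall>p\<in>\<rat>. \<forall>q\<in>\<rat>. dist (\<gamma> p) (\<gamma> q) \<le> 4 * M * dist p q"
        unfolding \<theta>_def
      proof (subst AE_distr_iff[OF \<Gamma>m])
        show "{\<gamma> \<in> space (curve_space :: (real \<Rightarrow> 'a) measure). \<forall>p\<in>\<rat>. \<forall>q\<in>\<rat>. dist (\<gamma> p) (\<gamma> q) \<le> 4 * M * dist p q} \<in> sets curve_space"
          unfolding pred_def[symmetric] by (intro pred_Ball_countable countable_rat) measurable
        show "AE \<omega> in \<tau>. \<forall>p\<in>\<rat>. \<forall>q\<in>\<rat>. dist (\<Gamma> \<omega> p) (\<Gamma> \<omega> q) \<le> 4 * M * dist p q"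
          using lipschitz_onD[OF \<Gamma>lip] by auto
      qed
      then show ?thesis
      proof (rule AE_mp, intro AE_I2 impI)
        fix \<gamma> assume "\<gamma> \<in> space \<theta>" "\<forall>p\<in>\<rat>. \<forall>q\<in>\<rat>. dist (\<gamma> p) (\<gamma> q) \<le> 4 * M * dist p q"
        then show "(4 * M)-lipschitz_on UNIV \<gamma>"
          using M4 cont by (intro lipschitz_on_UNIV_of_Rats lipschitz_onI) auto
      qed
    qed
    show "distr \<theta> borel (\<lambda>\<gamma>. \<gamma> t) = m" for t
    proof -
      have "distr \<theta> borel (\<lambda>\<gamma>. \<gamma> t) = distr \<theta> borel ((\<lambda>\<gamma>. \<gamma> 0) \<circ> shift t)"
        by (simp add: o_def shift_def)
      also have "\<dots> = distr (distr \<theta> curve_space (shift t)) borel (\<lambda>\<gamma>. \<gamma> 0)"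
        by (rule distr_distr[symmetric]) measurable
      also have "\<dots> = m" unfolding shift_inv law0 ..
      finally show ?thesis .
    qed
    fix p q :: real and c :: "'a \<Rightarrow> 'a" and Lc assume pq: "p \<in> \<rat>" "q \<in> \<rat>" "p \<le> q" and c: "Lc-lipschitz_on UNIV c"
    have [measurable]: "c \<in> borel_measurable borel"
      using lipschitz_on_continuous_on[OF c] by (rule borel_measurable_continuous_onI)
    have "(\<integral>\<gamma>. norm (\<gamma> q - \<gamma> p - (q - p) *\<^sub>R c (\<gamma> p)) \<partial>\<theta>) = (\<integral>t. norm (G q t - G p t - (q - p) *\<^sub>R c (G p t)) \<partial>\<tau>)"
      by (rule transfer1[of "\<lambda>x y. norm (y - x - (q - p) *\<^sub>R c x)"]) (use pq in measurable)
    then show "(\<integral>\<gamma>. norm (\<gamma> q - \<gamma> p - (q - p) *\<^sub>R c (\<gamma> p)) \<partial>\<theta>)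
       \<le> (q - p) * (\<integral>x. norm (b x - c x) \<partial>m) + (q - p) * Lc * (4 * M * (q - p))"
      using cons[OF pq c] by simp
  qed
qed

end

section \<open>Differentiation of indefinite integrals\<close>

text \<open>The averages run over one-sided intervals from x to x + h, so the result is a right
  derivative.\<close>

lemma right_derivative_AE:
  fixes f g :: "real \<Rightarrow> 'a::euclidean_space"
  assumes int: "\<And>a b. f integrable_on {a..b}"
    and g: "\<And>x y. x \<le> y \<Longrightarrow> g y - g x = integral {x..y} f"
  obtains N where "negligible N"
    "\<And>x. x \<notin> N \<Longrightarrow> ((\<lambda>h. (g (x + h) - g x) /\<^sub>R h) \<longlongrightarrow> f x) (at_right 0)"
proof -
  obtain N where N: "negligible N"
    "\<And>x e. x \<notin> N \<Longrightarrow> 0 < e \<Longrightarrow> \<exists>d>0. \<forall>h. 0 < h \<and> h < d \<longrightarrow>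
       norm (integral (cbox x (x + h *\<^sub>R One)) f /\<^sub>R h ^ DIM(real) - f x) < e"
    using integrable_ccontinuous_explicit[of f] int by (auto simp: cbox_interval)
  show ?thesis
  proof (rule that[OF N(1)])
    fix x assume x: "x \<notin> N"
    show "((\<lambda>h. (g (x + h) - g x) /\<^sub>R h) \<longlongrightarrow> f x) (at_right 0)"
    proof (rule tendstoI)
      fix e :: real assume "0 < e"
      then obtain d where d: "d > 0" "\<And>h. 0 < h \<Longrightarrow> h < d \<Longrightarrow> norm (integral {x..x + h} f /\<^sub>R h - f x) < e"
        using N(2)[OF x \<open>0 < e\<close>] by (auto simp: cbox_interval)
      show "\<forall>\<^sub>F h in at_right 0. dist ((g (x + h) - g x) /\<^sub>R h) (f x) < e"
        using eventually_at_right_less[of 0] eventually_at_right_real[OF d(1)]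
        by eventually_elim (use d(2) g in \<open>auto simp: dist_norm\<close>)
    qed
  qed
qed

text \<open>A left derivative of \<open>g\<close> is a right derivative of
  \<open>\<lambda>x. - g (- x)\<close>, which is an indefinite integral of the reflected
  \<open>f\<close>. The second exceptional set has to be reflected back, and reflection preserves
  null sets.\<close>

lemma lebesgue_differentiation_real:
  fixes f g :: "real \<Rightarrow> 'a::euclidean_space"
  assumes int: "\<And>a b. f integrable_on {a..b}"
    and g: "\<And>x y. x \<le> y \<Longrightarrow> g y - g x = integral {x..y} f"
  shows "AE t in lborel. (g has_vector_derivative f t) (at t)"
proof -
  obtain N1 where N1: "negligible N1"
    "\<And>x. x \<notin> N1 \<Longrightarrow> ((\<lambda>h. (g (x + h) - g x) /\<^sub>R h) \<longlongrightarrow> f x) (at_right 0)"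
    using right_derivative_AE[OF assms] by blast
  have int': "(\<lambda>x. f (- x)) integrable_on {a..b}" for a b
    using int[of "-b" "-a"] by (simp add: Henstock_Kurzweil_Integration.integrable_reflect_real[of f, symmetric] del: Henstock_Kurzweil_Integration.integrable_reflect_real)
  have g': "- g (- y) - (- g (- x)) = integral {x..y} (\<lambda>x. f (- x))" if "x \<le> y" for x y
    using g[of "-y" "-x"] that Henstock_Kurzweil_Integration.integral_reflect_real[of "-x" "-y" f] by (simp only: minus_minus) simp
  obtain N2 where N2: "negligible N2"
    "\<And>x. x \<notin> N2 \<Longrightarrow> ((\<lambda>h. (- g (- (x + h)) - (- g (- x))) /\<^sub>R h) \<longlongrightarrow> f (- x)) (at_right 0)"
    by (rule right_derivative_AE[OF int' g']) auto
  let ?N = "N1 \<union> uminus ` N2"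
  have "negligible (uminus ` N2)"
    by (rule negligible_differentiable_image_negligible[OF _ N2(1)]) (auto simp: differentiable_on_def)
  then have neg: "negligible ?N" using N1(1) by simp
  have deriv: "(g has_vector_derivative f t) (at t)" if t: "t \<notin> ?N" for t
  proof -
    have R: "((\<lambda>h. (g (t + h) - g t) /\<^sub>R h) \<longlongrightarrow> f t) (at_right 0)" using N1(2) t by blast
    have "- t \<notin> N2" using t by force
    from N2(2)[OF this] have "((\<lambda>h. (- g (t - h) - (- g t)) /\<^sub>R h) \<longlongrightarrow> f t) (at_right 0)" by simp
    then have "((\<lambda>h. (g (t + h) - g t) /\<^sub>R h) \<longlongrightarrow> f t) (at_left 0)"
      by (subst at_left_minus[of 0]) (simp add: filterlim_filtermap algebra_simps)
    with R have "((\<lambda>h. (g (t + h) - g t) /\<^sub>R h) \<longlongrightarrow> f t) (at 0)" by (rule filterlim_split_at[rotated])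
    then have "((\<lambda>h. norm ((g (t + h) - g t) /\<^sub>R h - f t)) \<longlongrightarrow> 0) (at 0)"
      by (simp add: tendsto_norm_zero_iff LIM_zero_iff)
    then have "((\<lambda>h. norm (g (t + h) - g t - h *\<^sub>R f t) / norm h) \<longlongrightarrow> 0) (at 0)"
    proof (rule Lim_transform_eventually)
      show "\<forall>\<^sub>F h in at 0. norm ((g (t + h) - g t) /\<^sub>R h - f t) = norm (g (t + h) - g t - h *\<^sub>R f t) / norm h"
      proof (rule eventually_at_ball'[of 1 0 UNIV, THEN eventually_mono])
        fix h :: real assume h: "h \<in> ball 0 1 \<and> h \<noteq> 0 \<and> h \<in> UNIV"
        then have "(g (t + h) - g t) /\<^sub>R h - f t = (g (t + h) - g t - h *\<^sub>R f t) /\<^sub>R h" by (simp add: scaleR_diff_right)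
        then show "norm ((g (t + h) - g t) /\<^sub>R h - f t) = norm (g (t + h) - g t - h *\<^sub>R f t) / norm h"
          by (simp add: divide_inverse mult.commute)
      qed simp
    qed
    then show ?thesis
      unfolding has_vector_derivative_def has_derivative_at by (auto intro: bounded_linear_scaleR_left)
  qed
  have "?N \<in> null_sets lebesgue" using neg by (simp add: negligible_iff_null_sets)
  then have "AE t in lebesgue. t \<notin> ?N" by (rule AE_not_in)
  then have "AE t in lborel. t \<notin> ?N" by (simp add: AE_completion_iff)
  then show ?thesis by (rule eventually_mono) (rule deriv)
qed

section \<open>The differential equation\<close>

context invariant_field begin

text \<open>Inner regularity gives a compact subset of \<open>A\<close> that loses at most
  \<open>\<epsilon> / 2\<close> of its measure; tents over it converge in L1 to its
  indicator.\<close>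

lemma lipschitz_approximation_indicator:
  assumes A: "A \<in> sets borel" and e: "0 < \<epsilon>"
  obtains c :: "'a \<Rightarrow> real" and L where "L-lipschitz_on UNIV c" "\<And>x. 0 \<le> c x \<and> c x \<le> 1"
    "(\<integral>x. \<bar>indicator A x - c x\<bar> \<partial>m) \<le> \<epsilon>"
proof -
  have fin: "emeasure m (space m) \<noteq> \<infinity>" by simp
  have "emeasure m A = (SUP K\<in>{K. K \<subseteq> A \<and> compact K}. emeasure m K)"
    by (rule inner_regular[OF sets_m fin A])
  then obtain K where K: "K \<subseteq> A" "compact K" "measure m A - measure m K \<le> \<epsilon> / 2"
  proof -
    assume sup: "emeasure m A = (SUP K\<in>{K. K \<subseteq> A \<and> compact K}. emeasure m K)"
    show ?thesis
    proof (cases "measure m A \<le> \<epsilon> / 2")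
      case True
      then show ?thesis using that[of "{}"] by simp
    next
      case False
      have "ennreal (measure m A - \<epsilon> / 2) < emeasure m A"
        using False e by (simp add: emeasure_eq_measure ennreal_less_iff)
      then obtain K where "K \<subseteq> A" "compact K" "ennreal (measure m A - \<epsilon> / 2) < emeasure m K"
        unfolding sup less_SUP_iff by auto
      then show ?thesis using False e that[of K] by (simp add: emeasure_eq_measure ennreal_less_iff)
    qed
  qed
  have cl: "closed K" using K(2) by (rule compact_imp_closed)
  have [measurable]: "K \<in> sets m" "A \<in> sets m" using A cl by (auto simp: sets_m)
  have tm [measurable]: "tent (real n) K \<in> borel_measurable m" for n
    using borel_measurable_continuous_onI[OF lipschitz_on_continuous_on[OF tent_lipschitz[of "real n" K]]]
    by (simp add: measurable_m_eq)
  have "(\<lambda>n. \<integral>x. \<bar>indicator A x - tent (real n) K x\<bar> \<partial>m) \<longlonglongrightarrow> (\<integral>x. \<bar>indicator A x - indicator K x :: real\<bar> \<partial>m)"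
  proof (rule integral_dominated_convergence[where w = "\<lambda>_. 2"])
    show "AE x in m. (\<lambda>n. \<bar>indicator A x - tent (real n) K x\<bar>) \<longlonglongrightarrow> \<bar>indicator A x - indicator K x :: real\<bar>"
      by (intro AE_I2 tendsto_intros tent_tendsto_indicator cl)
    show "AE x in m. norm \<bar>indicator A x - tent (real n) K x\<bar> \<le> 2" for n
    proof (intro AE_I2)
      fix x
      show "norm \<bar>indicator A x - tent (real n) K x\<bar> \<le> 2"
        using tent_bounds[of "real n" K x] by (auto simp: indicator_def)
    qed
  qed auto
  moreover have "(\<integral>x. \<bar>indicator A x - indicator K x :: real\<bar> \<partial>m) = (\<integral>x. indicator A x - indicator K x \<partial>m)"
    using K(1) by (intro Bochner_Integration.integral_cong) (auto simp: indicator_def)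
  moreover have "(\<integral>x. indicator A x - indicator K x \<partial>m) = measure m A - measure m K"
    by (subst Bochner_Integration.integral_diff) (auto simp: space_m emeasure_eq_measure)
  ultimately have "(\<lambda>n. \<integral>x. \<bar>indicator A x - tent (real n) K x\<bar> \<partial>m) \<longlonglongrightarrow> measure m A - measure m K" by simp
  moreover have "measure m A - measure m K < \<epsilon>" using K(3) e by linarith
  ultimately have "\<forall>\<^sub>F n in sequentially. (\<integral>x. \<bar>indicator A x - tent (real n) K x\<bar> \<partial>m) < \<epsilon>"
    by (rule order_tendstoD(2))
  then obtain n where "(\<integral>x. \<bar>indicator A x - tent (real n) K x\<bar> \<partial>m) < \<epsilon>"
    by (auto simp: eventually_sequentially)
  then show ?thesis using that[of "real n" "tent (real n) K"] by (simp add: tent_lipschitz tent_bounds)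
qed

text \<open>Density of bounded Lipschitz fields in L1: \<open>b\<close> is approximated by a simple
  function with \<open>\<epsilon> / 2\<close> to spare, and each of its finitely many level sets by
  a Lipschitz function.\<close>

lemma lipschitz_approximation_field:
  assumes e: "0 < \<epsilon>" and bd: "\<And>x. norm (b x) \<le> M"
  obtains c :: "'a \<Rightarrow> 'a" and L C where "L-lipschitz_on UNIV c" "\<And>x. norm (c x) \<le> C"
    "(\<integral>x. norm (b x - c x) \<partial>m) \<le> \<epsilon>"
proof -
  obtain F where F: "\<And>i. simple_function m (F i)" "\<And>x. (\<lambda>i. F i x) \<longlonglongrightarrow> b x" "\<And>i x. norm (F i x) \<le> 2 * norm (b x)"
    using borel_measurable_implies_sequence_metric[OF b_measurable_m, of 0] by (auto simp: space_m)
  have Fm [measurable]: "F i \<in> borel_measurable m" for i using F(1) by (rule borel_measurable_simple_function)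
  have Fn: "norm (F i x) \<le> 2 * M" for i x using F(3)[of i x] bd[of x] by linarith
  have nb: "norm (b x - F i x) \<le> 3 * M" for x i
    using norm_triangle_ineq4[of "b x" "F i x"] Fn[of i x] bd[of x] by simp
  have "(\<lambda>i. \<integral>x. norm (b x - F i x) \<partial>m) \<longlonglongrightarrow> (\<integral>x. 0 \<partial>m)"
  proof (rule integral_dominated_convergence[where w = "\<lambda>_. 3 * M"])
    show "AE x in m. (\<lambda>i. norm (b x - F i x)) \<longlonglongrightarrow> 0"
    proof (intro AE_I2)
      fix x
      have "(\<lambda>i. norm (b x - F i x)) \<longlonglongrightarrow> norm (b x - b x)" by (intro tendsto_intros F)
      then show "(\<lambda>i. norm (b x - F i x)) \<longlonglongrightarrow> 0" by simp
    qed
  qed (use nb in auto)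
  then have "(\<lambda>i. \<integral>x. norm (b x - F i x) \<partial>m) \<longlonglongrightarrow> 0" by simp
  from order_tendstoD(2)[OF this, of "\<epsilon> / 2"] e obtain i where i: "(\<integral>x. norm (b x - F i x) \<partial>m) < \<epsilon> / 2"
    by (auto simp: eventually_sequentially)
  define V where "V = range (F i)"
  have V: "finite V" using simple_functionD(1)[OF F(1)[of i]] by (simp add: V_def space_m)
  have Vn: "norm v \<le> 2 * M" if "v \<in> V" for v using that Fn by (auto simp: V_def)
  have setF: "F i -` {v} \<in> sets borel" for v
    using simple_functionD(2)[OF F(1)[of i], of "{v}"] by (simp add: space_m sets_m)
  \<comment> \<open>There are \<open>card V\<close> level sets with values of norm at most
    \<open>2 * M\<close>, so their errors add up to at most \<open>\<epsilon> / 2\<close>; the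
    summand 1 keeps the denominator positive.\<close>
  define \<delta> where "\<delta> = \<epsilon> / (2 * (real (card V) * (2 * M) + 1))"
  have M: "0 < M" using M_ge_1 by simp
  have "0 < real (card V) * (2 * M) + 1" using M by (simp add: add_nonneg_pos)
  then have \<delta>: "0 < \<delta>" "real (card V) * (2 * M) * \<delta> \<le> \<epsilon> / 2"
    using e by (auto simp: \<delta>_def field_simps)
  have "\<exists>c L. L-lipschitz_on UNIV c \<and> (\<forall>x. 0 \<le> c x \<and> c x \<le> 1) \<and> (\<integral>x. \<bar>indicator (F i -` {v}) x - c x\<bar> \<partial>m) \<le> \<delta>" for v
    by (rule lipschitz_approximation_indicator[OF setF[of v] \<delta>(1)]) blast
  then obtain c L where c: "\<And>v. (L v)-lipschitz_on UNIV (c v)" "\<And>v x. 0 \<le> c v x \<and> c v x \<le> 1"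
    "\<And>v. (\<integral>x. \<bar>indicator (F i -` {v}) x - c v x\<bar> \<partial>m) \<le> \<delta>" by metis
  have cm [measurable]: "c v \<in> borel_measurable m" for v
    using borel_measurable_continuous_onI[OF lipschitz_on_continuous_on[OF c(1)[of v]]] by (simp add: measurable_m_eq)
  have [measurable]: "F i -` {v} \<in> sets m" for v using setF by (simp add: sets_m)
  define f where "f x = (\<Sum>v\<in>V. c v x *\<^sub>R v)" for x
  have fm [measurable]: "f \<in> borel_measurable m" unfolding f_def by measurable
  have fn: "norm (f x) \<le> real (card V) * (2 * M)" for x
  proof -
    have "norm (f x) \<le> (\<Sum>v\<in>V. 2 * M)" unfolding f_def
    proof (rule sum_norm_le)
      fix v assume "v \<in> V"
      have "\<bar>c v x\<bar> * norm v \<le> 1 * (2 * M)" using c(2)[of v x] Vn[OF \<open>v \<in> V\<close>] by (intro mult_mono) auto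
      then show "norm (c v x *\<^sub>R v) \<le> 2 * M" by simp
    qed
    then show ?thesis by simp
  qed
  have intc: "integrable m (\<lambda>x. \<bar>indicator (F i -` {v}) x - c v x\<bar>)" for v
  proof (rule integrable_const_bound[where B = 2])
    show "AE x in m. norm \<bar>indicator (F i -` {v}) x - c v x\<bar> \<le> 2"
    proof (intro AE_I2)
      fix x show "norm \<bar>indicator (F i -` {v}) x - c v x\<bar> \<le> 2"
        using c(2)[of v x] by (auto simp: indicator_def)
    qed
  qed measurable
  have lipf: "(\<Sum>v\<in>V. L v * norm v)-lipschitz_on UNIV f"
  proof (rule lipschitz_onI)
    have L0: "0 \<le> L v" for v using c(1) by (rule lipschitz_on_nonneg)
    then show "0 \<le> (\<Sum>v\<in>V. L v * norm v)" by (intro sum_nonneg) auto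
    fix x y
    have "dist (f x) (f y) = norm (\<Sum>v\<in>V. (c v x - c v y) *\<^sub>R v)"
      by (simp add: dist_norm f_def sum_subtractf scaleR_diff_left)
    also have "\<dots> \<le> (\<Sum>v\<in>V. (L v * dist x y) * norm v)"
      using lipschitz_onD[OF c(1)] by (intro sum_norm_le) (auto intro!: mult_right_mono simp: dist_real_def)
    finally show "dist (f x) (f y) \<le> (\<Sum>v\<in>V. L v * norm v) * dist x y"
      by (simp add: sum_distrib_left sum_distrib_right mult_ac)
  qed
  have Ff: "norm (F i x - f x) \<le> (\<Sum>v\<in>V. 2 * M * \<bar>indicator (F i -` {v}) x - c v x\<bar>)" for x
  proof -
    have Fi: "(\<Sum>v\<in>V. indicator (F i -` {v}) x *\<^sub>R v) = F i x"
    proof -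
      have "(\<Sum>v\<in>V. indicator (F i -` {v}) x *\<^sub>R v) = (\<Sum>v\<in>V. if v = F i x then v else 0)"
        by (intro sum.cong) (auto simp: indicator_def)
      then show ?thesis using V by (simp add: V_def)
    qed
    have "norm (F i x - f x) = norm (\<Sum>v\<in>V. (indicator (F i -` {v}) x - c v x) *\<^sub>R v)"
      by (simp only: f_def sum_subtractf scaleR_diff_left Fi)
    also have "\<dots> \<le> (\<Sum>v\<in>V. 2 * M * \<bar>indicator (F i -` {v}) x - c v x\<bar>)"
    proof (rule sum_norm_le)
      fix v assume "v \<in> V"
      have "\<bar>indicator (F i -` {v}) x - c v x\<bar> * norm v \<le> \<bar>indicator (F i -` {v}) x - c v x\<bar> * (2 * M)"
        using Vn[OF \<open>v \<in> V\<close>] by (intro mult_left_mono) auto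
      then show "norm ((indicator (F i -` {v}) x - c v x) *\<^sub>R v) \<le> 2 * M * \<bar>indicator (F i -` {v}) x - c v x\<bar>"
        by (simp only: norm_scaleR real_norm_def mult.commute[of "2 * M"])
    qed
    finally show ?thesis .
  qed
  have int1: "integrable m (\<lambda>x. norm (b x - F i x))" by (rule integrable_const_bound[where B = "3 * M"]) (use nb in auto)
  have int2: "integrable m (\<lambda>x. norm (b x - f x))"
  proof (rule integrable_const_bound[where B = "M + real (card V) * (2 * M)"])
    have "norm (b x - f x) \<le> M + real (card V) * (2 * M)" for x
      using norm_triangle_ineq4[of "b x" "f x"] bd[of x] fn[of x] by linarith
    then show "AE x in m. norm (norm (b x - f x)) \<le> M + real (card V) * (2 * M)" by auto
  qed measurable
  have "(\<integral>x. norm (b x - f x) \<partial>m) \<le> (\<integral>x. norm (b x - F i x) + (\<Sum>v\<in>V. 2 * M * \<bar>indicator (F i -` {v}) x - c v x\<bar>) \<partial>m)"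
  proof (intro integral_mono int2 Bochner_Integration.integrable_add int1 Bochner_Integration.integrable_sum integrable_mult_right intc)
    fix x
    have "norm (b x - f x) \<le> norm (b x - F i x) + norm (F i x - f x)"
      using norm_triangle_ineq[of "b x - F i x" "F i x - f x"] by simp
    then show "norm (b x - f x) \<le> norm (b x - F i x) + (\<Sum>v\<in>V. 2 * M * \<bar>indicator (F i -` {v}) x - c v x\<bar>)"
      using Ff[of x] by linarith
  qed
  also have "\<dots> = (\<integral>x. norm (b x - F i x) \<partial>m) + (\<Sum>v\<in>V. 2 * M * (\<integral>x. \<bar>indicator (F i -` {v}) x - c v x\<bar> \<partial>m))"
    using int1 intc by (simp add: Bochner_Integration.integral_sum)
  also have "\<dots> \<le> \<epsilon> / 2 + (\<Sum>v\<in>V. 2 * M * \<delta>)"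
    using i c(3) M by (intro add_mono sum_mono mult_left_mono) auto
  also have "\<dots> \<le> \<epsilon>" using \<delta>(2) by (simp add: mult_ac)
  finally have "(\<integral>x. norm (b x - f x) \<partial>m) \<le> \<epsilon>" .
  with lipf fn show ?thesis by (rule that)
qed

end

text \<open>Links two integrals of the same integrand: the Lebesgue integral, which admits Fubini,
  and the gauge integral over an interval, which supplies additivity and differentiation.\<close>

lemma bounded_measurable_along_curve:
  fixes f :: "'a::euclidean_space \<Rightarrow> 'b::euclidean_space" and \<gamma> :: "real \<Rightarrow> 'a"
  assumes f: "f \<in> borel_measurable borel" "\<And>x. norm (f x) \<le> C" and \<gamma>: "continuous_on UNIV \<gamma>"
  shows "integrable lborel (\<lambda>s. indicator {p..q} s *\<^sub>R f (\<gamma> s))"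
    and "(\<lambda>s. f (\<gamma> s)) integrable_on {p..q}"
    and "integral {p..q} (\<lambda>s. f (\<gamma> s)) = (\<integral>s. indicator {p..q} s *\<^sub>R f (\<gamma> s) \<partial>lborel)"
    and "p \<le> q \<Longrightarrow> norm (integral {p..q} (\<lambda>s. f (\<gamma> s))) \<le> C * (q - p)"
proof -
  have [measurable]: "\<gamma> \<in> borel_measurable borel" using \<gamma> by (rule borel_measurable_continuous_onI)
  note f(1)[measurable]
  have C: "0 \<le> C" using f(2)[of 0] norm_ge_zero order_trans by blast
  show int: "integrable lborel (\<lambda>s. indicator {p..q} s *\<^sub>R f (\<gamma> s))"
  proof (rule Bochner_Integration.integrable_bound)
    show "integrable lborel (\<lambda>s. indicator {p..q} s *\<^sub>R C)" by (cases "p \<le> q") auto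
    show "AE s in lborel. norm (indicator {p..q} s *\<^sub>R f (\<gamma> s)) \<le> norm (indicator {p..q} s *\<^sub>R C)"
      using f(2) C by (auto simp: indicator_def)
  qed measurable
  then have "set_integrable lborel {p..q} (\<lambda>s. f (\<gamma> s))" by (simp add: set_integrable_def)
  from set_borel_integral_eq_integral[OF this]
  show io: "(\<lambda>s. f (\<gamma> s)) integrable_on {p..q}"
    and "integral {p..q} (\<lambda>s. f (\<gamma> s)) = (\<integral>s. indicator {p..q} s *\<^sub>R f (\<gamma> s) \<partial>lborel)"
    by (auto simp: set_lebesgue_integral_def)
  show "norm (integral {p..q} (\<lambda>s. f (\<gamma> s))) \<le> C * (q - p)" if "p \<le> q"
    using that io f(2) has_integral_bound[OF C, of "\<lambda>s. f (\<gamma> s)" "integral {p..q} (\<lambda>s. f (\<gamma> s))" p q]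
    by (simp add: integrable_integral cbox_interval)
qed

lemma AE_all_Rats:
  assumes "\<And>p q. p \<in> \<rat> \<Longrightarrow> q \<in> \<rat> \<Longrightarrow> AE x in N. P p (q::real) x"
  shows "AE x in N. \<forall>p\<in>\<rat>. \<forall>q\<in>(\<rat>::real set). P p q x"
  by (intro AE_ball_countable' countable_rat assms)

context invariant_field begin

text \<open>The error \<open>D p q\<close> is compared with a Lipschitz field \<open>c\<close> in
  three pieces: one Euler step of \<open>c\<close>, bounded by \<open>cons\<close>; the variation of
  \<open>c\<close> along a Lipschitz path, quadratic in the length; and the time integral of the
  distance between \<open>b\<close> and \<open>c\<close>. Subdividing the interval removes the
  quadratic terms, and only afterwards does \<open>c\<close> tend to \<open>b\<close> in L1. The
  order matters, since the Lipschitz constant of \<open>c\<close> may blow up.\<close>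

lemma integral_equation:
  fixes \<theta> :: "(real \<Rightarrow> 'a) measure"
  assumes bd: "\<And>x. norm (b x) \<le> M" and \<theta>: "prob_space \<theta>" and sets_\<theta>: "sets \<theta> = sets curve_space"
    and lip: "AE \<gamma> in \<theta>. (4 * M)-lipschitz_on UNIV \<gamma>"
    and law: "\<And>t. distr \<theta> borel (\<lambda>\<gamma>. \<gamma> t) = m"
    and cons: "\<And>p q c Lc. p \<in> \<rat> \<Longrightarrow> q \<in> \<rat> \<Longrightarrow> p \<le> q \<Longrightarrow> Lc-lipschitz_on UNIV c \<Longrightarrow>
       (\<integral>\<gamma>. norm (\<gamma> q - \<gamma> p - (q - p) *\<^sub>R c (\<gamma> p)) \<partial>\<theta>)
       \<le> (q - p) * (\<integral>x. norm (b x - c x) \<partial>m) + (q - p) * Lc * (4 * M * (q - p))"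
  shows "AE \<gamma> in \<theta>. \<forall>p\<in>\<rat>. \<forall>q\<in>\<rat>. p \<le> q \<longrightarrow> \<gamma> q - \<gamma> p = integral {p..q} (\<lambda>s. b (\<gamma> s))"
proof -
  interpret \<theta>: prob_space \<theta> by (rule \<theta>)
  interpret P: pair_sigma_finite \<theta> lborel by unfold_locales
  note b_measurable [measurable]
  have idm [measurable]: "(\<lambda>\<gamma>. \<gamma>) \<in> \<theta> \<rightarrow>\<^sub>M curve_space"
    using sets_\<theta> by (simp add: measurable_ident_sets)
  have evm [measurable]: "(\<lambda>\<gamma>. \<gamma> t) \<in> borel_measurable \<theta>" for t
    by (rule measurable_compose[OF idm measurable_eval_curve])
  have joint [measurable]: "(\<lambda>x. fst x (snd x)) \<in> borel_measurable (\<theta> \<Otimes>\<^sub>M lborel)"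
    by (rule measurable_eval[OF measurable_compose[OF measurable_fst idm]]) simp
  have cont: "continuous_on UNIV \<gamma>" if "\<gamma> \<in> space \<theta>" for \<gamma>
    using that sets_eq_imp_space_eq[OF sets_\<theta>] by (simp add: space_curve_space)
  have M: "0 < M" using M_ge_1 by simp
  define D where "D p q \<gamma> = \<gamma> q - \<gamma> p - integral {p..q} (\<lambda>s. b (\<gamma> s))" for p q :: real and \<gamma> :: "real \<Rightarrow> 'a"
  have im [measurable]: "(\<lambda>\<gamma>. integral {p..q} (\<lambda>s. f (\<gamma> s))) \<in> borel_measurable \<theta>"
    if [measurable]: "f \<in> borel_measurable borel" and "\<And>x. norm (f x) \<le> C" for f :: "'a \<Rightarrow> 'a" and C p q
  proof -
    have "(\<lambda>\<gamma>. \<integral>s. indicator {p..q} s *\<^sub>R f (\<gamma> s) \<partial>lborel) \<in> borel_measurable \<theta>"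
      by (rule lborel.borel_measurable_lebesgue_integral) (unfold case_prod_beta, measurable)
    then show ?thesis
      by (rule measurable_cong[THEN iffD1, rotated]) (simp add: bounded_measurable_along_curve(3)[OF that cont])
  qed
  have Dm [measurable]: "D p q \<in> borel_measurable \<theta>" for p q
    unfolding D_def using im[OF b_measurable bd] by measurable
  have Dint: "integrable \<theta> (\<lambda>\<gamma>. norm (D p q \<gamma>))" if "p \<le> q" for p q
  proof (rule \<theta>.integrable_const_bound[where B = "4 * M * (q - p) + M * (q - p)"])
    have "AE \<gamma> in \<theta>. norm (D p q \<gamma>) \<le> 4 * M * (q - p) + M * (q - p)"
      using lip AE_space
    proof eventually_elim
      case (elim \<gamma>)
      have "norm (\<gamma> q - \<gamma> p) \<le> 4 * M * (q - p)"
        using lipschitz_onD[OF elim(1), of q p] that by (simp add: dist_norm)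
      moreover have "norm (integral {p..q} (\<lambda>s. b (\<gamma> s))) \<le> M * (q - p)"
        by (rule bounded_measurable_along_curve(4)[OF b_measurable bd cont[OF elim(2)] that])
      ultimately show ?case unfolding D_def
        using norm_triangle_ineq4[of "\<gamma> q - \<gamma> p" "integral {p..q} (\<lambda>s. b (\<gamma> s))"] by linarith
    qed
    then show "AE \<gamma> in \<theta>. norm (norm (D p q \<gamma>)) \<le> 4 * M * (q - p) + M * (q - p)" by simp
  qed measurable
  \<comment> \<open>The two factors 2 arise alike: the distance of \<open>b\<close> from
    \<open>c\<close> enters through \<open>cons\<close> and through \<open>T3\<close>, the quadratic
    term through \<open>cons\<close> and through the variation of \<open>c\<close> along the
    path.\<close>
  have short: "(\<integral>\<gamma>. norm (D p q \<gamma>) \<partial>\<theta>) \<le> (q - p) * (2 * (\<integral>x. norm (b x - c x) \<partial>m)) + 2 * (4 * M * Lc * (q - p)\<^sup>2)"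
    if pq: "p \<in> \<rat>" "q \<in> \<rat>" "p \<le> q" and c: "Lc-lipschitz_on UNIV c" "\<And>x. norm (c x) \<le> C" for p q Lc C and c :: "'a \<Rightarrow> 'a"
  proof -
    have cm [measurable]: "c \<in> borel_measurable borel"
      using lipschitz_on_continuous_on[OF c(1)] by (rule borel_measurable_continuous_onI)
    have Lc: "0 \<le> Lc" using c(1) by (rule lipschitz_on_nonneg)
    have C: "0 \<le> C" using c(2)[of 0] norm_ge_zero order_trans by blast
    let ?d = "\<lambda>x. norm (b x - c x)"
    have dbd: "norm (?d x) \<le> M + C" for x using norm_triangle_ineq4[of "b x" "c x"] bd[of x] c(2)[of x] by simp
    define T1 where "T1 \<gamma> = norm (\<gamma> q - \<gamma> p - (q - p) *\<^sub>R c (\<gamma> p))" for \<gamma> :: "real \<Rightarrow> 'a"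
    define T3 where "T3 \<gamma> = (\<integral>s. indicator {p..q} s *\<^sub>R ?d (\<gamma> s) \<partial>lborel)" for \<gamma>
    have T1m [measurable]: "T1 \<in> borel_measurable \<theta>" unfolding T1_def by measurable
    have T3m [measurable]: "T3 \<in> borel_measurable \<theta>" unfolding T3_def
      by (rule lborel.borel_measurable_lebesgue_integral) (unfold case_prod_beta, measurable)
    have T1int: "integrable \<theta> T1"
    proof (rule \<theta>.integrable_const_bound[where B = "4 * M * (q - p) + (q - p) * C"])
      show "AE \<gamma> in \<theta>. norm (T1 \<gamma>) \<le> 4 * M * (q - p) + (q - p) * C"
        using lip
      proof eventually_elim
        case (elim \<gamma>)
        have "norm (\<gamma> q - \<gamma> p) \<le> 4 * M * (q - p)"
          using lipschitz_onD[OF elim, of q p] pq by (simp add: dist_norm)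
        moreover have "norm ((q - p) *\<^sub>R c (\<gamma> p)) \<le> (q - p) * C"
          using pq c(2) by (simp add: mult_left_mono)
        ultimately show ?case unfolding T1_def
          using norm_triangle_ineq4[of "\<gamma> q - \<gamma> p" "(q - p) *\<^sub>R c (\<gamma> p)"] by simp
      qed
    qed measurable
    have T3n: "norm (T3 \<gamma>) \<le> (M + C) * (q - p)" if "\<gamma> \<in> space \<theta>" for \<gamma>
      using bounded_measurable_along_curve(3,4)[of ?d "M + C" \<gamma> p q] dbd cont[OF that] pq by (simp add: T3_def)
    have T3int: "integrable \<theta> T3"
      by (rule \<theta>.integrable_const_bound[where B = "(M + C) * (q - p)"]) (use T3n in auto)
    \<comment> \<open>Fubini reduces the discrepancy along paths to one-time laws. All of these are
      \<open>m\<close>, so its mean is the length of the interval times the L1 distance.\<close>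
    have "(\<integral>\<gamma>. T3 \<gamma> \<partial>\<theta>) = (\<integral>s. (\<integral>\<gamma>. indicator {p..q} s *\<^sub>R ?d (\<gamma> s) \<partial>\<theta>) \<partial>lborel)"
      unfolding T3_def
    proof (rule P.Fubini_integral[symmetric])
      show "integrable (\<theta> \<Otimes>\<^sub>M lborel) (\<lambda>(\<gamma>, s). indicator {p..q} s *\<^sub>R ?d (\<gamma> s))"
      proof (rule P.Fubini_integrable)
        show "(\<lambda>(\<gamma>, s). indicator {p..q} s *\<^sub>R ?d (\<gamma> s)) \<in> borel_measurable (\<theta> \<Otimes>\<^sub>M lborel)"
          unfolding case_prod_beta by measurable
        have "(\<lambda>\<gamma>. \<integral>s. norm (case (\<gamma>, s) of (\<gamma>, s) \<Rightarrow> indicator {p..q} s *\<^sub>R ?d (\<gamma> s)) \<partial>lborel) = T3"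
          unfolding T3_def by (intro ext Bochner_Integration.integral_cong) (auto simp: indicator_def)
        then show "integrable \<theta> (\<lambda>\<gamma>. \<integral>s. norm (case (\<gamma>, s) of (\<gamma>, s) \<Rightarrow> indicator {p..q} s *\<^sub>R ?d (\<gamma> s)) \<partial>lborel)"
          using T3int by simp
        show "AE \<gamma> in \<theta>. integrable lborel (\<lambda>s. case (\<gamma>, s) of (\<gamma>, s) \<Rightarrow> indicator {p..q} s *\<^sub>R ?d (\<gamma> s))"
          using bounded_measurable_along_curve(1)[of ?d "M + C"] dbd cont by (intro AE_I2) simp
      qed
    qed
    also have "\<dots> = (\<integral>s. indicator {p..q} s *\<^sub>R (\<integral>x. ?d x \<partial>m) \<partial>lborel)"
    proof (intro Bochner_Integration.integral_cong refl)
      fix s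
      have "(\<integral>\<gamma>. ?d (\<gamma> s) \<partial>\<theta>) = (\<integral>x. ?d x \<partial>distr \<theta> borel (\<lambda>\<gamma>. \<gamma> s))"
        by (rule integral_distr[symmetric]) measurable
      then show "(\<integral>\<gamma>. indicator {p..q} s *\<^sub>R ?d (\<gamma> s) \<partial>\<theta>) = indicator {p..q} s *\<^sub>R (\<integral>x. ?d x \<partial>m)"
        unfolding law by simp
    qed
    also have "\<dots> = (q - p) * (\<integral>x. ?d x \<partial>m)" using pq by simp
    finally have T3E: "(\<integral>\<gamma>. T3 \<gamma> \<partial>\<theta>) = (q - p) * (\<integral>x. ?d x \<partial>m)" .
    have "(\<integral>\<gamma>. norm (D p q \<gamma>) \<partial>\<theta>) \<le> (\<integral>\<gamma>. T1 \<gamma> + 4 * M * Lc * (q - p)\<^sup>2 + T3 \<gamma> \<partial>\<theta>)"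
    proof (intro integral_mono_AE Dint pq Bochner_Integration.integrable_add T1int T3int \<theta>.integrable_const)
      show "AE \<gamma> in \<theta>. norm (D p q \<gamma>) \<le> T1 \<gamma> + 4 * M * Lc * (q - p)\<^sup>2 + T3 \<gamma>"
        using lip AE_space
      proof eventually_elim
        case (elim \<gamma>)
        note cg = cont[OF elim(2)]
        let ?Ic = "integral {p..q} (\<lambda>s. c (\<gamma> s))" and ?Ib = "integral {p..q} (\<lambda>s. b (\<gamma> s))"
        have cint: "(\<lambda>s. c (\<gamma> s)) integrable_on {p..q}" and bint: "(\<lambda>s. b (\<gamma> s)) integrable_on {p..q}"
          and dint: "(\<lambda>s. ?d (\<gamma> s)) integrable_on {p..q}"
          using bounded_measurable_along_curve(2)[OF cm c(2) cg] bounded_measurable_along_curve(2)[OF b_measurable bd cg]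
            bounded_measurable_along_curve(2)[of ?d "M + C" \<gamma>] dbd cg by auto
        have T3': "T3 \<gamma> = integral {p..q} (\<lambda>s. ?d (\<gamma> s))"
          using bounded_measurable_along_curve(3)[of ?d "M + C" \<gamma>] dbd cg by (simp add: T3_def)
        have h1: "norm ((q - p) *\<^sub>R c (\<gamma> p) - ?Ic) \<le> 4 * M * Lc * (q - p)\<^sup>2"
        proof -
          have "(q - p) *\<^sub>R c (\<gamma> p) - ?Ic = integral {p..q} (\<lambda>s. c (\<gamma> p) - c (\<gamma> s))"
            using pq cint by (subst Henstock_Kurzweil_Integration.integral_diff) auto
          also have "norm \<dots> \<le> (4 * M * Lc * (q - p)) * Henstock_Kurzweil_Integration.content (cbox p q)"
          proof (rule has_integral_bound)
            show "((\<lambda>s. c (\<gamma> p) - c (\<gamma> s)) has_integral integral {p..q} (\<lambda>s. c (\<gamma> p) - c (\<gamma> s))) (cbox p q)"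
              unfolding cbox_interval using cint by (intro integrable_integral Henstock_Kurzweil_Integration.integrable_diff) auto
            show "0 \<le> 4 * M * Lc * (q - p)" using M Lc pq by auto
            fix s assume "s \<in> cbox p q"
            have "norm (c (\<gamma> p) - c (\<gamma> s)) \<le> Lc * norm (\<gamma> p - \<gamma> s)"
              using lipschitz_onD[OF c(1), of "\<gamma> p" "\<gamma> s"] by (simp add: dist_norm)
            also have "\<dots> \<le> Lc * (4 * M * dist p s)"
              using lipschitz_onD[OF elim(1), of p s] Lc by (intro mult_left_mono) (auto simp: dist_norm)
            also have "\<dots> \<le> Lc * (4 * M * (q - p))"
              using \<open>s \<in> cbox p q\<close> M Lc by (intro mult_left_mono) (auto simp: dist_real_def)
            finally show "norm (c (\<gamma> p) - c (\<gamma> s)) \<le> 4 * M * Lc * (q - p)" by (simp add: mult_ac)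
          qed
          finally show ?thesis using pq by (simp add: power2_eq_square mult.assoc)
        qed
        have h2: "norm (?Ic - ?Ib) \<le> T3 \<gamma>"
        proof -
          have "?Ic - ?Ib = integral {p..q} (\<lambda>s. c (\<gamma> s) - b (\<gamma> s))"
            using cint bint by (rule Henstock_Kurzweil_Integration.integral_diff[symmetric])
          also have "norm \<dots> \<le> T3 \<gamma>" unfolding T3'
            using cint bint dint by (intro integral_norm_bound_integral Henstock_Kurzweil_Integration.integrable_diff) (auto simp: norm_minus_commute)
          finally show ?thesis .
        qed
        have Deq: "D p q \<gamma> = (\<gamma> q - \<gamma> p - (q - p) *\<^sub>R c (\<gamma> p)) + ((q - p) *\<^sub>R c (\<gamma> p) - ?Ic) + (?Ic - ?Ib)"
          by (simp add: D_def)
        have tri: "norm (u + v + z) \<le> norm u + norm v + norm z" for u v z :: 'a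
          by (intro norm_triangle_le add_mono norm_triangle_ineq order_refl)
        show ?case unfolding T1_def Deq
          by (rule order_trans[OF tri]) (intro add_mono order_refl h1 h2)
      qed
    qed
    also have "\<dots> = (\<integral>\<gamma>. T1 \<gamma> \<partial>\<theta>) + 4 * M * Lc * (q - p)\<^sup>2 + (q - p) * (\<integral>x. ?d x \<partial>m)"
      using T1int T3int by (simp add: T3E \<theta>.prob_space)
    also have "(\<integral>\<gamma>. T1 \<gamma> \<partial>\<theta>) \<le> (q - p) * (\<integral>x. ?d x \<partial>m) + (q - p) * Lc * (4 * M * (q - p))"
      unfolding T1_def by (rule cons[OF pq c(1)])
    finally show ?thesis by (simp add: power2_eq_square algebra_simps)
  qed
  have zero: "(\<integral>\<gamma>. norm (D p q \<gamma>) \<partial>\<theta>) = 0" if pq: "p \<in> \<rat>" "q \<in> \<rat>" "p \<le> q" for p q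
  proof -
    have le: "(\<integral>\<gamma>. norm (D p q \<gamma>) \<partial>\<theta>) \<le> (q - p) * (2 * (\<integral>x. norm (b x - c x) \<partial>m))"
      if c: "Lc-lipschitz_on UNIV c" "\<And>x. norm (c x) \<le> C" for Lc C and c :: "'a \<Rightarrow> 'a"
    proof -
      let ?e = "\<integral>x. norm (b x - c x) \<partial>m"
      \<comment> \<open>For \<open>Suc N\<close> equal pieces the terms linear in the length add up
        unchanged, and the quadratic ones shrink by the factor 1 / (N + 1). The division points stay
        rational, as \<open>short\<close> requires.\<close>
      have split: "(\<integral>\<gamma>. norm (D p q \<gamma>) \<partial>\<theta>) \<le> (q - p) * (2 * ?e) + (8 * M * Lc * (q - p)\<^sup>2) * inverse (real (Suc N))" for N
      proof -
        define \<eta> where "\<eta> = (q - p) / real (Suc N)"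
        have \<eta>: "0 \<le> \<eta>" "\<eta> \<in> \<rat>" "real (Suc N) * \<eta> = q - p" using pq by (auto simp: \<eta>_def simp del: of_nat_Suc)
        have tR: "p + real n * \<eta> \<in> \<rat>" for n using pq \<eta> by auto
        have "(\<integral>\<gamma>. norm (D p (p + real n * \<eta>) \<gamma>) \<partial>\<theta>) \<le> real n * (\<eta> * (2 * ?e) + 2 * (4 * M * Lc * \<eta>\<^sup>2))" for n
        proof (induction n)
          case 0
          then show ?case by (simp add: D_def)
        next
          case (Suc n)
          let ?a = "p + real n * \<eta>" and ?b = "p + real (Suc n) * \<eta>"
          have ab: "p \<le> ?a" "?a \<le> ?b" using \<eta> by (auto simp: mult_right_mono)
          have "(\<integral>\<gamma>. norm (D p ?b \<gamma>) \<partial>\<theta>) \<le> (\<integral>\<gamma>. norm (D p ?a \<gamma>) + norm (D ?a ?b \<gamma>) \<partial>\<theta>)"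
          proof (intro integral_mono Dint Bochner_Integration.integrable_add ab order_trans[OF ab])
            fix \<gamma> assume "\<gamma> \<in> space \<theta>"
            have comb: "integral {p..?b} (\<lambda>s. b (\<gamma> s)) = integral {p..?a} (\<lambda>s. b (\<gamma> s)) + integral {?a..?b} (\<lambda>s. b (\<gamma> s))"
              by (rule Henstock_Kurzweil_Integration.integral_combine[OF ab bounded_measurable_along_curve(2)[OF b_measurable bd cont[OF \<open>\<gamma> \<in> space \<theta>\<close>]], symmetric])
            have "D p ?b \<gamma> = D p ?a \<gamma> + D ?a ?b \<gamma>"
              unfolding D_def comb by (simp del: of_nat_Suc)
            then show "norm (D p ?b \<gamma>) \<le> norm (D p ?a \<gamma>) + norm (D ?a ?b \<gamma>)"
              by (simp add: norm_triangle_ineq)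
          qed
          also have "\<dots> = (\<integral>\<gamma>. norm (D p ?a \<gamma>) \<partial>\<theta>) + (\<integral>\<gamma>. norm (D ?a ?b \<gamma>) \<partial>\<theta>)"
            by (rule Bochner_Integration.integral_add[OF Dint[OF ab(1)] Dint[OF ab(2)]])
          also have "(\<integral>\<gamma>. norm (D ?a ?b \<gamma>) \<partial>\<theta>) \<le> (?b - ?a) * (2 * ?e) + 2 * (4 * M * Lc * (?b - ?a)\<^sup>2)"
            by (rule short[OF tR tR ab(2) c])
          also have "?b - ?a = \<eta>" by (simp add: algebra_simps)
          finally show ?case using Suc by (simp add: algebra_simps)
        qed
        from this[of "Suc N"] have "(\<integral>\<gamma>. norm (D p q \<gamma>) \<partial>\<theta>) \<le> real (Suc N) * (\<eta> * (2 * ?e) + 2 * (4 * M * Lc * \<eta>\<^sup>2))"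
          by (simp only: \<eta>(3)) simp
        also have "\<dots> = (real (Suc N) * \<eta>) * (2 * ?e) + 8 * M * Lc * (real (Suc N) * \<eta>) * \<eta>"
          by (simp add: power2_eq_square algebra_simps)
        also have "\<dots> = (q - p) * (2 * ?e) + (8 * M * Lc * (q - p)\<^sup>2) * inverse (real (Suc N))"
          unfolding \<eta>(3) by (simp add: \<eta>_def power2_eq_square divide_inverse)
        finally show ?thesis .
      qed
      have "(\<lambda>N. (q - p) * (2 * ?e) + (8 * M * Lc * (q - p)\<^sup>2) * inverse (real (Suc N))) \<longlonglongrightarrow> (q - p) * (2 * ?e) + (8 * M * Lc * (q - p)\<^sup>2) * 0"
        by (intro tendsto_intros LIMSEQ_inverse_real_of_nat)
      from LIMSEQ_le_const[OF this] split show ?thesis by auto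
    qed
    have "(\<integral>\<gamma>. norm (D p q \<gamma>) \<partial>\<theta>) \<le> 0 + e" if e: "0 < e" for e
    proof -
      \<comment> \<open>The summand 1 keeps the denominator positive also for
        \<open>p = q\<close>.\<close>
      define \<epsilon> where "\<epsilon> = e / (2 * (q - p) + 1)"
      have \<epsilon>: "0 < \<epsilon>" using e pq by (auto simp: \<epsilon>_def intro!: divide_pos_pos)
      obtain c :: "'a \<Rightarrow> 'a" and L C where c: "L-lipschitz_on UNIV c" "\<And>x. norm (c x) \<le> C" "(\<integral>x. norm (b x - c x) \<partial>m) \<le> \<epsilon>"
        by (rule lipschitz_approximation_field[OF \<epsilon> bd]) auto
      have "(\<integral>\<gamma>. norm (D p q \<gamma>) \<partial>\<theta>) \<le> (q - p) * (2 * \<epsilon>)"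
        using le[OF c(1,2)] c(3) pq by (intro order_trans[OF le[OF c(1,2)]] mult_left_mono) auto
      also have "\<dots> \<le> (2 * (q - p) + 1) * \<epsilon>" using \<epsilon> by (simp add: algebra_simps)
      also have "\<dots> = e" using pq by (simp add: \<epsilon>_def)
      finally show ?thesis by simp
    qed
    then have "(\<integral>\<gamma>. norm (D p q \<gamma>) \<partial>\<theta>) \<le> 0" by (rule field_le_epsilon)
    moreover have "0 \<le> (\<integral>\<gamma>. norm (D p q \<gamma>) \<partial>\<theta>)" by (rule Bochner_Integration.integral_nonneg) simp
    ultimately show ?thesis by linarith
  qed
  show ?thesis
  proof (rule AE_all_Rats)
    fix p q :: real assume pq: "p \<in> \<rat>" "q \<in> \<rat>"
    show "AE \<gamma> in \<theta>. p \<le> q \<longrightarrow> \<gamma> q - \<gamma> p = integral {p..q} (\<lambda>s. b (\<gamma> s))"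
    proof (cases "p \<le> q")
      case True
      have "AE \<gamma> in \<theta>. norm (D p q \<gamma>) = 0"
        using zero[OF pq True] by (subst (asm) integral_nonneg_eq_0_iff_AE[OF Dint[OF True]]) auto
      then show ?thesis by eventually_elim (simp add: D_def)
    qed simp
  qed
qed

end

section \<open>Derivatives of curves\<close>

text \<open>Both sides depend continuously on the right endpoint, so the rational equation extends
  by density.\<close>

lemma integral_equation_extends:
  fixes f \<gamma> :: "real \<Rightarrow> 'a::euclidean_space"
  assumes int: "\<And>a b. f integrable_on {a..b}" and \<gamma>: "continuous_on UNIV \<gamma>"
    and eq: "\<And>p q. p \<in> \<rat> \<Longrightarrow> q \<in> \<rat> \<Longrightarrow> p \<le> q \<Longrightarrow> \<gamma> q - \<gamma> p = integral {p..q} f" and xy: "x \<le> y"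
  shows "\<gamma> y - \<gamma> x = integral {x..y} f"
proof -
  \<comment> \<open>With a rational base point below \<open>x\<close> only the right endpoint has to
    be approximated, from below by \<open>grid_approx\<close>. Subtracting the equations from
    \<open>a\<close> to \<open>x\<close> and from \<open>a\<close> to \<open>y\<close> removes the
    base point.\<close>
  obtain a where a: "a \<in> \<rat>" "x - 1 < a" "a < x" using Rats_dense_in_real[of "x - 1" x] by auto
  define d where "d u = \<gamma> u - \<gamma> a - integral {a..u} f" for u
  have d0: "d u = 0" if u: "a < u" "u \<le> y" for u
  proof -
    have cd: "continuous_on {a..y} d" unfolding d_def
      by (intro continuous_intros continuous_on_subset[OF \<gamma>] indefinite_integral_continuous_1 int) auto
    have ev: "\<forall>\<^sub>F n in sequentially. a < grid_approx n u" using order_tendstoD(1)[OF grid_approx_tendsto u(1)] .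
    have le: "grid_approx n u \<le> u" for n
    proof -
      have "of_int \<lfloor>real (Suc n) * u\<rfloor> \<le> real (Suc n) * u" by linarith
      then have "grid_approx n u \<le> (real (Suc n) * u) / real (Suc n)" unfolding grid_approx_def by (intro divide_right_mono) auto
      then show ?thesis by simp
    qed
    have "(\<lambda>n. d (grid_approx n u)) \<longlonglongrightarrow> d u"
      by (rule continuous_on_tendsto_compose[OF cd grid_approx_tendsto])
         (use u in \<open>auto intro!: eventually_mono[OF ev] intro: order_trans[OF le]\<close>)
    moreover have "\<forall>\<^sub>F n in sequentially. d (grid_approx n u) = 0"
      using ev by eventually_elim (use eq[OF a(1) grid_approx_Rats] in \<open>auto simp: d_def\<close>)
    then have "(\<lambda>n. d (grid_approx n u)) \<longlonglongrightarrow> 0" by (rule tendsto_eventually)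
    ultimately show ?thesis by (rule LIMSEQ_unique)
  qed
  have "integral {a..x} f + integral {x..y} f = integral {a..y} f"
    using a xy by (intro Henstock_Kurzweil_Integration.integral_combine int) auto
  then show ?thesis using d0[of x] d0[of y] a xy by (simp add: d_def algebra_simps)
qed

text \<open>By continuity the increments at rational \<open>r\<close> determine all others, so
  differentiability becomes a condition with countable quantifiers and hence measurable. The
  non-strict inequality survives the limit.\<close>

lemma has_vector_derivative_iff_Rats:
  fixes \<gamma> :: "real \<Rightarrow> 'a::euclidean_space"
  assumes \<gamma>: "continuous_on UNIV \<gamma>"
  shows "(\<gamma> has_vector_derivative v) (at t) \<longleftrightarrow>
    (\<forall>n::nat. \<exists>k::nat. \<forall>r\<in>\<rat>. \<bar>r\<bar> < inverse (real (Suc k)) \<longrightarrow>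
       norm (\<gamma> (t + r) - \<gamma> t - r *\<^sub>R v) \<le> inverse (real (Suc n)) * \<bar>r\<bar>)" (is "?L \<longleftrightarrow> ?R")
proof
  assume ?L
  show ?R
  proof
    fix n :: nat
    have "0 < inverse (real (Suc n))" by simp
    then obtain d where d: "0 < d" "\<And>y. norm (y - t) < d \<Longrightarrow> norm (\<gamma> y - \<gamma> t - (y - t) *\<^sub>R v) \<le> inverse (real (Suc n)) * norm (y - t)"
      using \<open>?L\<close> unfolding has_vector_derivative_def has_derivative_at_alt by blast
    obtain k where k: "inverse (real (Suc k)) < d" using reals_Archimedean[OF d(1)] by auto
    show "\<exists>k. \<forall>r\<in>\<rat>. \<bar>r\<bar> < inverse (real (Suc k)) \<longrightarrow> norm (\<gamma> (t + r) - \<gamma> t - r *\<^sub>R v) \<le> inverse (real (Suc n)) * \<bar>r\<bar>"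
    proof (intro exI[of _ k] ballI impI)
      fix r :: real assume "\<bar>r\<bar> < inverse (real (Suc k))"
      then show "norm (\<gamma> (t + r) - \<gamma> t - r *\<^sub>R v) \<le> inverse (real (Suc n)) * \<bar>r\<bar>"
        using d(2)[of "t + r"] k by simp
    qed
  qed
next
  assume R: ?R
  show ?L unfolding has_vector_derivative_def has_derivative_at_alt
  proof (intro conjI allI impI)
    show "bounded_linear (\<lambda>x. x *\<^sub>R v)" by (rule bounded_linear_scaleR_left)
    fix e :: real assume "0 < e"
    then obtain n where n: "inverse (real (Suc n)) < e" using reals_Archimedean by blast
    obtain k where k: "\<And>r. r \<in> \<rat> \<Longrightarrow> \<bar>r\<bar> < inverse (real (Suc k)) \<Longrightarrow>
       norm (\<gamma> (t + r) - \<gamma> t - r *\<^sub>R v) \<le> inverse (real (Suc n)) * \<bar>r\<bar>" using R by blast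
    show "\<exists>d>0. \<forall>y. norm (y - t) < d \<longrightarrow> norm (\<gamma> y - \<gamma> t - (y - t) *\<^sub>R v) \<le> e * norm (y - t)"
    proof (intro exI[of _ "inverse (real (Suc k))"] conjI allI impI)
      fix y assume y: "norm (y - t) < inverse (real (Suc k))"
      let ?r = "\<lambda>j. grid_approx j (y - t)"
      have r: "?r \<longlonglongrightarrow> y - t" by (rule grid_approx_tendsto)
      have "isCont \<gamma> y" using \<gamma> by (simp add: continuous_on_eq_continuous_at)
      then have "(\<lambda>j. \<gamma> (t + ?r j)) \<longlonglongrightarrow> \<gamma> y"
        by (rule isCont_tendsto_compose) (use tendsto_add[OF tendsto_const[of t] r] in simp)
      then have 1: "(\<lambda>j. norm (\<gamma> (t + ?r j) - \<gamma> t - ?r j *\<^sub>R v)) \<longlonglongrightarrow> norm (\<gamma> y - \<gamma> t - (y - t) *\<^sub>R v)"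
        by (intro tendsto_intros r)
      have 2: "(\<lambda>j. inverse (real (Suc n)) * \<bar>?r j\<bar>) \<longlonglongrightarrow> inverse (real (Suc n)) * \<bar>y - t\<bar>"
        by (intro tendsto_intros r)
      have "\<forall>\<^sub>F j in sequentially. \<bar>?r j\<bar> < inverse (real (Suc k))"
        using y by (intro order_tendstoD(2)[OF tendsto_rabs[OF r]]) simp
      then have "\<forall>\<^sub>F j in sequentially. norm (\<gamma> (t + ?r j) - \<gamma> t - ?r j *\<^sub>R v) \<le> inverse (real (Suc n)) * \<bar>?r j\<bar>"
        by eventually_elim (rule k[OF grid_approx_Rats])
      then have "norm (\<gamma> y - \<gamma> t - (y - t) *\<^sub>R v) \<le> inverse (real (Suc n)) * \<bar>y - t\<bar>"
        by (rule tendsto_le[OF sequentially_bot 2 1])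
      also have "\<dots> \<le> e * norm (y - t)" using n \<open>0 < e\<close> by (intro mult_mono) auto
      finally show "norm (\<gamma> y - \<gamma> t - (y - t) *\<^sub>R v) \<le> e * norm (y - t)" .
    qed simp
  qed
qed

lemma measurable_has_vector_derivative:
  fixes V :: "'n \<Rightarrow> 'a::euclidean_space"
  assumes F: "F \<in> N \<rightarrow>\<^sub>M curve_space" and T: "T \<in> N \<rightarrow>\<^sub>M borel" and V: "V \<in> N \<rightarrow>\<^sub>M borel"
  shows "Measurable.pred N (\<lambda>x. (F x has_vector_derivative V x) (at (T x)))"
proof -
  have ev: "(\<lambda>x. F x (g x)) \<in> borel_measurable N" if "g \<in> borel_measurable N" for g
    by (rule measurable_eval[OF F that])
  have "Measurable.pred N (\<lambda>x. \<forall>n::nat. \<exists>k::nat. \<forall>r\<in>\<rat>. \<bar>r\<bar> < inverse (real (Suc k)) \<longrightarrow>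
       norm (F x (T x + r) - F x (T x) - r *\<^sub>R V x) \<le> inverse (real (Suc n)) * \<bar>r\<bar>)"
  proof (intro pred_intros_countable pred_Ball_countable countable_rat pred_intros_logic)
    fix n k :: nat and r :: real
    have "(\<lambda>x. F x (T x + r)) \<in> borel_measurable N" "(\<lambda>x. F x (T x)) \<in> borel_measurable N"
      using T by (auto intro!: ev)
    then have "(\<lambda>x. norm (F x (T x + r) - F x (T x) - r *\<^sub>R V x)) \<in> borel_measurable N" using V by measurable
    then show "Measurable.pred N (\<lambda>x. norm (F x (T x + r) - F x (T x) - r *\<^sub>R V x) \<le> inverse (real (Suc n)) * \<bar>r\<bar>)"
      by measurable
  qed auto
  moreover have "(F x has_vector_derivative V x) (at (T x)) \<longleftrightarrow> (\<forall>n::nat. \<exists>k::nat. \<forall>r\<in>\<rat>. \<bar>r\<bar> < inverse (real (Suc k)) \<longrightarrow>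
       norm (F x (T x + r) - F x (T x) - r *\<^sub>R V x) \<le> inverse (real (Suc n)) * \<bar>r\<bar>)" if "x \<in> space N" for x
    using measurable_space[OF F that] by (intro has_vector_derivative_iff_Rats) (simp add: space_curve_space)
  ultimately show ?thesis by (simp cong: measurable_cong)
qed

lemma has_vector_derivative_shift:
  "(shift t \<gamma> has_vector_derivative v) (at 0) \<longleftrightarrow> (\<gamma> has_vector_derivative v) (at t)"
  by (simp add: has_vector_derivative_def has_derivative_at shift_def)

text \<open>\<open>vector_derivative\<close> is a choice: at curves without a derivative its value
  is \<open>SOME v. False\<close>, unspecified but the same for all of them. Where a derivative
  exists, it is the limit \<open>l\<close> of difference quotients along 1 / (n + 1).\<close>

lemma measurable_vector_derivative_at_0:
  "(\<lambda>\<gamma>. vector_derivative \<gamma> (at 0)) \<in> (curve_space :: (real \<Rightarrow> 'a::euclidean_space) measure) \<rightarrow>\<^sub>M borel"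
proof -
  define l where "l \<gamma> = lim (\<lambda>n. (\<gamma> (inverse (real (Suc n))) - \<gamma> 0) /\<^sub>R inverse (real (Suc n)))" for \<gamma> :: "real \<Rightarrow> 'a"
  have l_deriv: "l \<gamma> = v" if v: "(\<gamma> has_vector_derivative v) (at 0)" for \<gamma> v
  proof -
    have "((\<lambda>h. norm (\<gamma> h - \<gamma> 0 - h *\<^sub>R v) / norm h) \<longlongrightarrow> 0) (at 0)"
      using v by (simp add: has_vector_derivative_def has_derivative_at)
    then have "(\<lambda>n. norm (\<gamma> (inverse (real (Suc n))) - \<gamma> 0 - inverse (real (Suc n)) *\<^sub>R v) / norm (inverse (real (Suc n)))) \<longlonglongrightarrow> 0"
      by (rule filterlim_compose) (auto simp: filterlim_at LIMSEQ_inverse_real_of_nat simp del: of_nat_Suc)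
    moreover have E: "norm (\<gamma> h - \<gamma> 0 - h *\<^sub>R v) / norm h = norm ((\<gamma> h - \<gamma> 0) /\<^sub>R h - v)" if "h \<noteq> 0" for h
    proof -
      have "(\<gamma> h - \<gamma> 0) /\<^sub>R h - v = (\<gamma> h - \<gamma> 0 - h *\<^sub>R v) /\<^sub>R h" using that by (simp add: scaleR_diff_right)
      then show ?thesis by (simp add: divide_inverse mult.commute)
    qed
    ultimately have "(\<lambda>n. norm ((\<gamma> (inverse (real (Suc n))) - \<gamma> 0) /\<^sub>R inverse (real (Suc n)) - v)) \<longlonglongrightarrow> 0"
      by (subst (asm) E) simp_all
    then have "(\<lambda>n. (\<gamma> (inverse (real (Suc n))) - \<gamma> 0) /\<^sub>R inverse (real (Suc n))) \<longlonglongrightarrow> v"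
      by (simp only: tendsto_norm_zero_iff LIM_zero_iff)
    then show ?thesis unfolding l_def by (rule limI)
  qed
  have lm: "l \<in> (curve_space :: (real \<Rightarrow> 'a) measure) \<rightarrow>\<^sub>M borel" unfolding l_def
    by (intro borel_measurable_lim_metric borel_measurable_scaleR borel_measurable_diff borel_measurable_const measurable_eval_curve)
  have "vector_derivative \<gamma> (at 0) = (if (\<gamma> has_vector_derivative l \<gamma>) (at 0) then l \<gamma> else (SOME v. False))" for \<gamma>
  proof (cases "(\<gamma> has_vector_derivative l \<gamma>) (at 0)")
    case True
    then show ?thesis by (simp add: vector_derivative_at)
  next
    case False
    then have "(\<gamma> has_vector_derivative v) (at 0) = False" for v using l_deriv by blast
    then show ?thesis using False by (simp add: vector_derivative_def)
  qed
  moreover have "(\<lambda>\<gamma>. if (\<gamma> has_vector_derivative l \<gamma>) (at 0) then l \<gamma> else (SOME v. False)) \<in> (curve_space :: (real \<Rightarrow> 'a) measure) \<rightarrow>\<^sub>M borel"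
    by (intro measurable_If lm measurable_const measurable_has_vector_derivative[unfolded pred_def] measurable_ident_sets) auto
  ultimately show ?thesis by simp
qed

section \<open>The stationary law of integral curves\<close>

context invariant_field begin

text \<open>An equation at almost every time says nothing about time 0. By Fubini, however, some
  time \<open>t\<close> is good for almost all curves, and \<open>shift t\<close>, which preserves
  \<open>\<theta>\<close>, carries the derivative at \<open>t\<close> to 0.\<close>

theorem stationary_curve_measure:
  assumes bd: "\<And>x. norm (b x) \<le> M"
  obtains \<theta> :: "(real \<Rightarrow> 'a) measure" where
    "prob_space \<theta>" "sets \<theta> = sets curve_space"
    "\<And>s. distr \<theta> curve_space (shift s) = \<theta>"
    "\<And>t. distr \<theta> borel (\<lambda>\<gamma>. \<gamma> t) = m"
    "AE \<gamma> in \<theta>. (4 * M)-lipschitz_on UNIV \<gamma>"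
    "AE \<gamma> in \<theta>. AE t in lborel. (\<gamma> has_vector_derivative b (\<gamma> t)) (at t)"
    "AE \<gamma> in \<theta>. (\<gamma> has_vector_derivative b (\<gamma> 0)) (at 0)"
proof (rule curve_law)
  fix \<theta> :: "(real \<Rightarrow> 'a) measure"
  assume \<theta>: "prob_space \<theta>" and sets_\<theta>: "sets \<theta> = sets curve_space"
    and inv: "\<And>s. distr \<theta> curve_space (shift s) = \<theta>"
    and lip: "AE \<gamma> in \<theta>. (4 * M)-lipschitz_on UNIV \<gamma>"
    and law: "\<And>t. distr \<theta> borel (\<lambda>\<gamma>. \<gamma> t) = m"
    and cons: "\<And>p q c Lc. p \<in> \<rat> \<Longrightarrow> q \<in> \<rat> \<Longrightarrow> p \<le> q \<Longrightarrow> Lc-lipschitz_on UNIV c \<Longrightarrow>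
       (\<integral>\<gamma>. norm (\<gamma> q - \<gamma> p - (q - p) *\<^sub>R c (\<gamma> p)) \<partial>\<theta>)
       \<le> (q - p) * (\<integral>x. norm (b x - c x) \<partial>m) + (q - p) * Lc * (4 * M * (q - p))"
  interpret \<theta>: prob_space \<theta> by (rule \<theta>)
  interpret P: pair_sigma_finite \<theta> lborel by unfold_locales
  have idm: "(\<lambda>\<gamma>. \<gamma>) \<in> \<theta> \<rightarrow>\<^sub>M curve_space" using sets_\<theta> by (simp add: measurable_ident_sets)
  have sh: "shift t \<in> \<theta> \<rightarrow>\<^sub>M curve_space" for t by (rule measurable_compose[OF idm measurable_shift])
  have cont: "continuous_on UNIV \<gamma>" if "\<gamma> \<in> space \<theta>" for \<gamma>
    using that sets_eq_imp_space_eq[OF sets_\<theta>] by (simp add: space_curve_space)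
  have ie: "AE \<gamma> in \<theta>. \<forall>p\<in>\<rat>. \<forall>q\<in>\<rat>. p \<le> q \<longrightarrow> \<gamma> q - \<gamma> p = integral {p..q} (\<lambda>s. b (\<gamma> s))"
    by (rule integral_equation[OF bd \<theta> sets_\<theta> lip law]) (rule cons)
  have ode: "AE \<gamma> in \<theta>. AE t in lborel. (\<gamma> has_vector_derivative b (\<gamma> t)) (at t)"
    using ie AE_space
  proof eventually_elim
    case (elim \<gamma>)
    have int: "(\<lambda>s. b (\<gamma> s)) integrable_on {p..q}" for p q
      by (rule bounded_measurable_along_curve(2)[OF b_measurable bd cont[OF elim(2)]])
    show ?case
    proof (rule lebesgue_differentiation_real[OF int])
      show "\<gamma> y - \<gamma> x = integral {x..y} (\<lambda>s. b (\<gamma> s))" if "x \<le> y" for x y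
        by (rule integral_equation_extends[OF int cont[OF elim(2)] _ that]) (use elim(1) in blast)
    qed
  qed
  have fm: "fst \<in> \<theta> \<Otimes>\<^sub>M lborel \<rightarrow>\<^sub>M curve_space" by (rule measurable_compose[OF measurable_fst idm])
  have sm: "snd \<in> \<theta> \<Otimes>\<^sub>M (lborel :: real measure) \<rightarrow>\<^sub>M borel" using measurable_snd[of \<theta> lborel] by simp
  have "Measurable.pred (\<theta> \<Otimes>\<^sub>M lborel) (\<lambda>x. (fst x has_vector_derivative b (fst x (snd x))) (at (snd x)))"
    by (rule measurable_has_vector_derivative[OF fm sm measurable_compose[OF measurable_eval[OF fm sm] b_measurable]])
  then have set: "{x \<in> space (\<theta> \<Otimes>\<^sub>M lborel). (fst x has_vector_derivative b (fst x (snd x))) (at (snd x))} \<in> sets (\<theta> \<Otimes>\<^sub>M lborel)"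
    by (simp add: pred_def)
  have "AE t in lborel. AE \<gamma> in \<theta>. (\<gamma> has_vector_derivative b (\<gamma> t)) (at t)"
    using ode P.AE_commute[OF set] by simp
  moreover have "ae_filter (lborel :: real measure) \<noteq> bot" by (simp add: ae_filter_eq_bot_iff)
  ultimately obtain t where t: "AE \<gamma> in \<theta>. (\<gamma> has_vector_derivative b (\<gamma> t)) (at t)"
    using eventually_happens' by blast
  have "AE \<gamma> in distr \<theta> curve_space (shift t). (\<gamma> has_vector_derivative b (\<gamma> 0)) (at 0)"
  proof (subst AE_distr_iff[OF sh])
    show "{\<gamma> \<in> space curve_space. (\<gamma> has_vector_derivative b (\<gamma> 0)) (at 0)} \<in> sets curve_space"
      unfolding pred_def[symmetric]
      by (rule measurable_has_vector_derivative[OF measurable_ident_sets[OF refl] measurable_const measurable_compose[OF measurable_eval_curve b_measurable]]) simp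
    show "AE \<gamma> in \<theta>. (shift t \<gamma> has_vector_derivative b (shift t \<gamma> 0)) (at 0)"
      using t by (simp add: has_vector_derivative_shift) (simp add: shift_def)
  qed
  then have "AE \<gamma> in \<theta>. (\<gamma> has_vector_derivative b (\<gamma> 0)) (at 0)" unfolding inv .
  from that[OF \<theta> sets_\<theta> inv law lip ode this] show ?thesis .
qed

end

section \<open>Closed measures\<close>

text \<open>The derivative is linear in the velocity, so its mean over a fibre is its value at the
  centroid, and closedness becomes the divergence condition. The work lies in making the test
  functions admissible for \<open>disintegration\<close>.\<close>

lemma closed_measure_invariant_field:
  fixes \<mu> :: "('a::euclidean_space \<times> 'a) measure" and K :: "'a \<Rightarrow> 'a measure"
  assumes closed: "closed_measure \<mu>" and dis: "disintegration \<mu> K"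
  obtains M b where "invariant_field (proj_measure \<mu>) b M" "\<And>x. norm (b x) \<le> M"
    "AE x in proj_measure \<mu>. centroid K x = b x" "centroid K \<in> borel_measurable borel"
proof -
  define m where "m = proj_measure \<mu>"
  obtain S where \<mu>: "prob_space \<mu>" and sets_\<mu>: "sets \<mu> = sets borel" and S: "compact S" "S \<in> sets \<mu>" "emeasure \<mu> S = 1"
    and grad: "\<And>g. smooth_fun g \<Longrightarrow> (\<integral>z. frechet_derivative g (at (fst z)) (snd z) \<partial>\<mu>) = 0"
    using closed by (auto simp: closed_measure_def compactly_supported_prob_def)
  interpret \<mu>: prob_space \<mu> by (rule \<mu>)
  have K: "K \<in> borel \<rightarrow>\<^sub>M prob_algebra borel"
    and Kdis: "\<And>\<phi> :: 'a \<times> 'a \<Rightarrow> real. continuous_on UNIV \<phi> \<Longrightarrow> bounded (range \<phi>) \<Longrightarrow>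
        (\<integral>z. \<phi> z \<partial>\<mu>) = (\<integral>x. (\<integral>v. \<phi> (x, v) \<partial>K x) \<partial>m)"
    using dis by (auto simp: disintegration_def m_def)
  have Ksub: "K \<in> borel \<rightarrow>\<^sub>M subprob_algebra borel" using K by (rule measurable_prob_algebraD)
  have Kprob: "prob_space (K x)" and Ksets: "sets (K x) = sets borel" for x
    using measurable_space[OF K, of x] by (auto simp: space_prob_algebra)
  have Kmeas: "measurable (K x) N = measurable borel N" for x and N :: "'c measure"
    by (rule measurable_cong_sets) (simp_all add: Ksets)
  have Kint: "(\<lambda>x. \<integral>v. f v \<partial>K x) \<in> borel_measurable borel" if "f \<in> borel_measurable borel"
    for f :: "'a \<Rightarrow> 'b::{banach, second_countable_topology}"
    by (rule measurable_compose[OF Ksub integral_measurable_subprob_algebra[OF that]])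
  have cm: "centroid K \<in> borel_measurable borel"
    using Kint[of "\<lambda>v. v"] by (simp add: centroid_def[abs_def])
  have fstm: "fst \<in> \<mu> \<rightarrow>\<^sub>M borel" and sndm: "snd \<in> \<mu> \<rightarrow>\<^sub>M borel"
    using sets_\<mu> by (simp_all add: borel_prod[symmetric] cong: measurable_cong_sets)
  have m: "prob_space m" unfolding m_def proj_measure_def by (rule \<mu>.prob_space_distr[OF fstm])
  have sets_m: "sets m = sets borel" by (simp add: m_def proj_measure_def)
  have mmeas: "measurable m N = measurable borel N" for N :: "'c measure"
    by (rule measurable_cong_sets) (simp_all add: sets_m)
  interpret m: prob_space m by (rule m)
  obtain R where R: "\<And>z. z \<in> S \<Longrightarrow> norm z \<le> R"
    using compact_imp_bounded[OF S(1)] by (auto simp: bounded_iff)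
  define M where "M = max 1 R"
  have M: "1 \<le> M" "0 < M" by (auto simp: M_def)
  have "AE z in \<mu>. z \<in> S" using S(2,3) by (intro \<mu>.AE_in_set_eq_1[THEN iffD2]) (auto simp: measure_def)
  then have supp: "AE z in \<mu>. norm (fst z) \<le> M \<and> norm (snd z) \<le> M"
  proof eventually_elim
    case (elim z)
    have "norm z \<le> M" using R[OF elim] by (simp add: M_def)
    then show ?case using dist_fst_le[of z 0] dist_snd_le[of z 0] by auto
  qed
  have m_supp: "AE x in m. norm x \<le> M"
    unfolding m_def proj_measure_def
    by (subst AE_distr_iff[OF fstm]) (use supp in \<open>auto elim: eventually_mono\<close>)
  have K_supp: "AE x in m. AE v in K x. norm v \<le> M"
  proof -
    \<comment> \<open>Bounded, continuous and zero precisely on the ball of radius \<open>M\<close>: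
      testing the disintegration with \<open>f\<close> shows that almost every fibre is supported in
      this ball.\<close>
    define f where "f v = min 1 (max 0 (norm v - M))" for v :: 'a
    have cf: "continuous_on UNIV f" unfolding f_def by (intro continuous_intros)
    have fm: "f \<in> borel_measurable borel" using cf by (rule borel_measurable_continuous_onI)
    have fb: "0 \<le> f v" "f v \<le> 1" for v by (auto simp: f_def)
    have "(\<integral>z. f (snd z) \<partial>\<mu>) = (\<integral>z. 0 \<partial>\<mu>)"
    proof (rule integral_cong_AE)
      show "AE z in \<mu>. f (snd z) = 0" using supp by eventually_elim (simp add: f_def)
    qed (use measurable_compose[OF sndm fm] in auto)
    moreover have "(\<integral>z. f (snd z) \<partial>\<mu>) = (\<integral>x. (\<integral>v. f (snd (x, v)) \<partial>K x) \<partial>m)"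
      by (rule Kdis) (auto intro!: continuous_on_compose2[OF cf] continuous_intros boundedI[of _ 1] simp: fb)
    ultimately have z: "(\<integral>x. (\<integral>v. f v \<partial>K x) \<partial>m) = 0" by simp
    have fi: "integrable (K x) f" for x
      by (rule finite_measure.integrable_const_bound[where B = 1])
         (use Kprob[of x] fb fm in \<open>auto simp: Kmeas prob_space_def\<close>)
    have n0: "0 \<le> (\<integral>v. f v \<partial>K x)" for x by (rule Bochner_Integration.integral_nonneg) (rule fb)
    have n1: "(\<integral>v. f v \<partial>K x) \<le> 1" for x
      using prob_space.integral_le_const[OF Kprob fi[of x], of 1] fb by simp
    have "integrable m (\<lambda>x. \<integral>v. f v \<partial>K x)"
      by (rule m.integrable_const_bound[where B = 1]) (use n0 n1 Kint[OF fm] in \<open>auto simp: mmeas\<close>)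
    then have "AE x in m. (\<integral>v. f v \<partial>K x) = 0"
      using z n0 by (subst (asm) integral_nonneg_eq_0_iff_AE) auto
    then show ?thesis
    proof eventually_elim
      case (elim x)
      then have "AE v in K x. f v = 0"
        using fi fb by (subst (asm) integral_nonneg_eq_0_iff_AE) auto
      then show ?case by eventually_elim (auto simp: f_def min_def max_def split: if_splits)
    qed
  qed
  \<comment> \<open>The truncation gives a bound at every point; by \<open>K_supp\<close> the result
    agrees with the centroid almost everywhere.\<close>
  define b where "b x = (if norm (centroid K x) \<le> M then centroid K x else 0)" for x
  have bm: "b \<in> borel_measurable borel" unfolding b_def
    using cm by measurable
  have bn: "norm (b x) \<le> M" for x using M by (auto simp: b_def)
  have Kid: "integrable (K x) (\<lambda>v. v)" and Kcn: "norm (centroid K x) \<le> M" if "AE v in K x. norm v \<le> M" for x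
  proof -
    interpret Kx: prob_space "K x" by (rule Kprob)
    show i: "integrable (K x) (\<lambda>v. v)"
      by (rule Kx.integrable_const_bound[where B = M]) (use that in \<open>auto simp: Kmeas\<close>)
    have "norm (centroid K x) \<le> (\<integral>v. norm v \<partial>K x)" unfolding centroid_def by (rule integral_norm_bound)
    also have "\<dots> \<le> M" using that i by (intro Kx.integral_le_const) auto
    finally show "norm (centroid K x) \<le> M" .
  qed
  have eqb: "AE x in m. centroid K x = b x"
    using K_supp by eventually_elim (simp add: b_def Kcn)
  let ?cp = "closest_point (cball 0 M :: 'a set)"
  have ccp: "continuous_on A ?cp" for A using M by (intro continuous_on_closest_point) auto
  have cpn: "norm (?cp x) \<le> M" for x using closest_point_in_set[of "cball 0 M" x] M by auto
  have cp_id: "?cp x = x" if "norm x \<le> M" for x using that by (simp add: closest_point_self)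
  have cpm: "?cp \<in> borel_measurable borel" using ccp by (rule borel_measurable_continuous_onI)
  have div: "(\<integral>x. frechet_derivative g (at x) (b x) \<partial>m) = 0" if g: "smooth_fun g" for g
  proof -
    obtain D where D: "D [] = g" "\<And>xs x. (D xs has_derivative (\<lambda>h. \<Sum>i\<in>Basis. (h \<bullet> i) * D (i # xs) x)) (at x)"
      using g unfolding smooth_fun_def by auto
    have fd: "frechet_derivative g (at x) h = (\<Sum>i\<in>Basis. (h \<bullet> i) * D [i] x)" for x h
      using frechet_derivative_at[OF D(2)[of "[]" x]] by (simp add: D(1)) metis
    have cD: "continuous_on A (D xs)" for A xs
      using D(2) by (meson has_derivative_continuous continuous_at_imp_continuous_on)
    have Dm: "D xs \<in> borel_measurable borel" for xs using cD by (rule borel_measurable_continuous_onI)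
    \<comment> \<open>The integrand of the closedness condition need not be bounded, while
      \<open>disintegration\<close> speaks of bounded continuous functions only. Projecting both
      variables onto the ball makes it admissible and leaves it unchanged almost everywhere for
      \<open>\<mu>\<close>.\<close>
    define \<phi> where "\<phi> z = (\<Sum>i\<in>Basis. (?cp (snd z) \<bullet> i) * D [i] (?cp (fst z)))" for z
    have cDcp: "continuous_on UNIV (\<lambda>z. D [i] (?cp (fst z)))" for i
      by (intro continuous_on_compose2[OF cD[of UNIV]] continuous_on_compose2[OF ccp[of UNIV]] continuous_intros) auto
    have ccps: "continuous_on UNIV (\<lambda>z. ?cp (snd z))"
      by (intro continuous_on_compose2[OF ccp[of UNIV]] continuous_intros) auto
    have c\<phi>: "continuous_on UNIV \<phi>" unfolding \<phi>_def by (intro continuous_intros cDcp ccps)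
    have "range \<phi> \<subseteq> (\<lambda>z. \<Sum>i\<in>Basis. (snd z \<bullet> i) * D [i] (fst z)) ` (cball 0 M \<times> cball 0 M)"
      using cpn by (auto simp: \<phi>_def intro!: image_eqI[of _ _ "(?cp _, ?cp _)"])
    moreover have "compact ((\<lambda>z. \<Sum>i\<in>Basis. (snd z \<bullet> i) * D [i] (fst z)) ` (cball 0 M \<times> cball 0 M))"
      by (intro compact_continuous_image compact_Times compact_cball continuous_intros
          continuous_on_compose2[OF cD[of UNIV]]) auto
    ultimately have b\<phi>: "bounded (range \<phi>)" using bounded_subset compact_imp_bounded by blast
    have \<phi>m: "\<phi> \<in> borel_measurable borel" using c\<phi> by (rule borel_measurable_continuous_onI)
    have "(\<integral>z. \<phi> z \<partial>\<mu>) = (\<integral>z. frechet_derivative g (at (fst z)) (snd z) \<partial>\<mu>)"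
      unfolding fd
    proof (rule integral_cong_AE)
      show "AE z in \<mu>. \<phi> z = (\<Sum>i\<in>Basis. (snd z \<bullet> i) * D [i] (fst z))"
        using supp by eventually_elim (simp add: \<phi>_def cp_id)
      show "\<phi> \<in> borel_measurable \<mu>" using \<phi>m sets_\<mu> by (simp cong: measurable_cong_sets)
      show "(\<lambda>z. \<Sum>i\<in>Basis. (snd z \<bullet> i) * D [i] (fst z)) \<in> borel_measurable \<mu>"
        by (intro borel_measurable_sum borel_measurable_times borel_measurable_inner sndm measurable_compose[OF fstm Dm] borel_measurable_const)
    qed
    then have "(\<integral>z. \<phi> z \<partial>\<mu>) = 0" using grad[OF g] by simp
    then have z: "(\<integral>x. (\<integral>v. \<phi> (x, v) \<partial>K x) \<partial>m) = 0" using Kdis[OF c\<phi> b\<phi>] by simp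
    have cpi: "integrable (K x) (\<lambda>v. ?cp v \<bullet> i)" for x i
    proof (rule finite_measure.integrable_const_bound[where B = "M * norm i"])
      show "finite_measure (K x)" using Kprob[of x] by (simp add: prob_space_def)
      show "AE v in K x. norm (?cp v \<bullet> i) \<le> M * norm i"
        using cpn by (auto intro!: AE_I2 order_trans[OF Cauchy_Schwarz_ineq2] mult_right_mono)
      show "(\<lambda>v. ?cp v \<bullet> i) \<in> borel_measurable (K x)"
        unfolding Kmeas by (intro borel_measurable_inner cpm borel_measurable_const)
    qed
    have inner: "(\<integral>v. \<phi> (x, v) \<partial>K x) = (\<Sum>i\<in>Basis. (\<integral>v. ?cp v \<bullet> i \<partial>K x) * D [i] (?cp x))" for x
      unfolding \<phi>_def using cpi by (simp add: Bochner_Integration.integral_sum)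
    have "(\<integral>x. frechet_derivative g (at x) (b x) \<partial>m) = (\<integral>x. (\<integral>v. \<phi> (x, v) \<partial>K x) \<partial>m)"
      unfolding fd inner
    proof (rule integral_cong_AE)
      show "(\<lambda>x. \<Sum>i\<in>Basis. (b x \<bullet> i) * D [i] x) \<in> borel_measurable m"
        unfolding mmeas by (intro borel_measurable_sum borel_measurable_times borel_measurable_inner bm Dm borel_measurable_const)
      show "(\<lambda>x. \<Sum>i\<in>Basis. (\<integral>v. ?cp v \<bullet> i \<partial>K x) * D [i] (?cp x)) \<in> borel_measurable m"
        unfolding mmeas by (intro borel_measurable_sum borel_measurable_times Kint borel_measurable_inner cpm
            measurable_compose[OF cpm Dm] borel_measurable_const)
      show "AE x in m. (\<Sum>i\<in>Basis. (b x \<bullet> i) * D [i] x) = (\<Sum>i\<in>Basis. (\<integral>v. ?cp v \<bullet> i \<partial>K x) * D [i] (?cp x))"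
        using K_supp m_supp
      proof eventually_elim
        case (elim x)
        have "(\<integral>v. ?cp v \<bullet> i \<partial>K x) = b x \<bullet> i" for i
        proof -
          have "(\<integral>v. ?cp v \<bullet> i \<partial>K x) = (\<integral>v. v \<bullet> i \<partial>K x)"
          proof (rule integral_cong_AE)
            show "AE v in K x. ?cp v \<bullet> i = v \<bullet> i" using elim(1) by eventually_elim (simp add: cp_id)
            show "(\<lambda>v. ?cp v \<bullet> i) \<in> borel_measurable (K x)"
              unfolding Kmeas by (intro borel_measurable_inner cpm borel_measurable_const)
            show "(\<lambda>v. v \<bullet> i) \<in> borel_measurable (K x)"
              unfolding Kmeas by (intro borel_measurable_inner borel_measurable_const) simp
          qed
          also have "\<dots> = (\<integral>v. v \<partial>K x) \<bullet> i" using Kid[OF elim(1)] by (intro integral_inner_left) simp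
          also have "\<dots> = b x \<bullet> i" using Kcn[OF elim(1)] by (simp add: b_def centroid_def)
          finally show ?thesis .
        qed
        then show ?case using elim(2) by (simp add: cp_id)
      qed
    qed
    with z show ?thesis by simp
  qed
  show ?thesis
  proof (rule that[of b M])
    show "invariant_field (proj_measure \<mu>) b M"
      unfolding m_def[symmetric]
      by unfold_locales (use sets_m bm M m_supp bn div in auto)
    show "AE x in proj_measure \<mu>. centroid K x = b x" using eqb unfolding m_def .
  qed (use bn cm in auto)
qed

theorem mainTheorem2:
  fixes \<mu> :: "('a::euclidean_space \<times> 'a) measure" and K :: "'a \<Rightarrow> 'a measure"
  assumes "closed_measure \<mu>"
    and "disintegration \<mu> K"
  shows "\<exists>\<theta> :: (real \<Rightarrow> 'a) measure.
     prob_space \<theta> \<and> sets \<theta> = sets curve_space \<and>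
     (\<forall>t. distr \<theta> curve_space (shift t) = \<theta>) \<and>
     (AE \<gamma> in \<theta>. (\<exists>L. L-lipschitz_on UNIV \<gamma>) \<and> \<gamma> differentiable (at 0)) \<and>
     (\<forall>\<phi> :: 'a \<times> 'a \<Rightarrow> real. \<phi> \<in> borel_measurable borel \<and> bounded (range \<phi>) \<longrightarrow>
        (\<integral>x. \<phi> (x, centroid K x) \<partial>proj_measure \<mu>)
          = (\<integral>\<gamma>. \<phi> (\<gamma> 0, vector_derivative \<gamma> (at 0)) \<partial>\<theta>)) \<and>
     (AE \<gamma> in \<theta>. AE t in lborel. (\<gamma> has_vector_derivative centroid K (\<gamma> t)) (at t))"
proof (rule closed_measure_invariant_field[OF assms])
  fix M b
  assume field: "invariant_field (proj_measure \<mu>) b M" and bd: "\<And>x. norm (b x) \<le> M"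
    and eq: "AE x in proj_measure \<mu>. centroid K x = b x" and cm: "centroid K \<in> borel_measurable borel"
  interpret invariant_field "proj_measure \<mu>" b M by (rule field)
  show ?thesis
  proof (rule stationary_curve_measure[OF bd])
    fix \<theta> :: "(real \<Rightarrow> 'a) measure"
    assume \<theta>: "prob_space \<theta>" and sets_\<theta>: "sets \<theta> = sets curve_space"
      and inv: "\<And>s. distr \<theta> curve_space (shift s) = \<theta>"
      and law: "\<And>t. distr \<theta> borel (\<lambda>\<gamma>. \<gamma> t) = proj_measure \<mu>"
      and lip: "AE \<gamma> in \<theta>. (4 * M)-lipschitz_on UNIV \<gamma>"
      and ode: "AE \<gamma> in \<theta>. AE t in lborel. (\<gamma> has_vector_derivative b (\<gamma> t)) (at t)"
      and deriv0: "AE \<gamma> in \<theta>. (\<gamma> has_vector_derivative b (\<gamma> 0)) (at 0)"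
    interpret \<theta>: prob_space \<theta> by (rule \<theta>)
    interpret P: pair_sigma_finite \<theta> lborel by unfold_locales
    have idm: "(\<lambda>\<gamma>. \<gamma>) \<in> \<theta> \<rightarrow>\<^sub>M curve_space" using sets_\<theta> by (simp add: measurable_ident_sets)
    have evm: "(\<lambda>\<gamma>. \<gamma> t) \<in> borel_measurable \<theta>" for t by (rule measurable_compose[OF idm measurable_eval_curve])
    have fm: "fst \<in> \<theta> \<Otimes>\<^sub>M lborel \<rightarrow>\<^sub>M curve_space" by (rule measurable_compose[OF measurable_fst idm])
    have sm: "snd \<in> \<theta> \<Otimes>\<^sub>M (lborel :: real measure) \<rightarrow>\<^sub>M borel" using measurable_snd[of \<theta> lborel] by simp
    have eqset: "{x. centroid K x = b x} \<in> sets borel" using cm b_measurable by measurable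
    \<comment> \<open>\<open>b\<close> and the centroid agree off an \<open>m\<close>-null set. As
      every one-time law is \<open>m\<close>, they agree at each fixed time along almost every
      curve, and Fubini then gives agreement at almost all times of almost every curve.\<close>
    have eqt: "AE \<gamma> in \<theta>. centroid K (\<gamma> t) = b (\<gamma> t)" for t
      using eq unfolding law[of t, symmetric] by (subst (asm) AE_distr_iff[OF evm]) (use eqset in auto)
    have "Measurable.pred (\<theta> \<Otimes>\<^sub>M lborel) (\<lambda>x. centroid K (fst x (snd x)) = b (fst x (snd x)))"
      using measurable_compose[OF measurable_eval[OF fm sm] cm] measurable_compose[OF measurable_eval[OF fm sm] b_measurable]
      by measurable
    then have "{x \<in> space (\<theta> \<Otimes>\<^sub>M lborel). centroid K (fst x (snd x)) = b (fst x (snd x))} \<in> sets (\<theta> \<Otimes>\<^sub>M lborel)"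
      by (simp add: pred_def)
    from P.AE_commute[OF this] have AEt: "AE \<gamma> in \<theta>. AE t in lborel. centroid K (\<gamma> t) = b (\<gamma> t)"
      using eqt by simp
    show ?thesis
    proof (intro exI[of _ \<theta>] conjI allI impI)
      show "prob_space \<theta>" "sets \<theta> = sets curve_space" "distr \<theta> curve_space (shift t) = \<theta>" for t
        by (fact \<theta> sets_\<theta> inv)+
      show "AE \<gamma> in \<theta>. (\<exists>L. L-lipschitz_on UNIV \<gamma>) \<and> \<gamma> differentiable (at 0)"
        using lip deriv0 by eventually_elim (auto intro: differentiableI_vector)
      show "AE \<gamma> in \<theta>. AE t in lborel. (\<gamma> has_vector_derivative centroid K (\<gamma> t)) (at t)"
        using ode AEt
      proof eventually_elim
        case (elim \<gamma>)
        then show ?case by eventually_elim simp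
      qed
      fix \<phi> :: "'a \<times> 'a \<Rightarrow> real" assume "\<phi> \<in> borel_measurable borel \<and> bounded (range \<phi>)"
      then have \<phi>: "\<phi> \<in> borel_measurable (borel \<Otimes>\<^sub>M borel)" by (simp add: borel_prod)
      have pair: "(\<lambda>x. (x, centroid K x)) \<in> borel \<rightarrow>\<^sub>M borel \<Otimes>\<^sub>M borel"
        by (rule measurable_Pair[OF measurable_ident cm, unfolded id_def])
      have "(\<integral>x. \<phi> (x, centroid K x) \<partial>proj_measure \<mu>) = (\<integral>x. \<phi> (x, centroid K x) \<partial>distr \<theta> borel (\<lambda>\<gamma>. \<gamma> 0))"
        unfolding law ..
      also have "\<dots> = (\<integral>\<gamma>. \<phi> (\<gamma> 0, centroid K (\<gamma> 0)) \<partial>\<theta>)"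
        by (rule integral_distr[OF evm measurable_compose[OF pair \<phi>]])
      also have "\<dots> = (\<integral>\<gamma>. \<phi> (\<gamma> 0, vector_derivative \<gamma> (at 0)) \<partial>\<theta>)"
      proof (rule integral_cong_AE)
        show "(\<lambda>\<gamma>. \<phi> (\<gamma> 0, centroid K (\<gamma> 0))) \<in> borel_measurable \<theta>"
          by (rule measurable_compose[OF evm measurable_compose[OF pair \<phi>]])
        show "(\<lambda>\<gamma>. \<phi> (\<gamma> 0, vector_derivative \<gamma> (at 0))) \<in> borel_measurable \<theta>"
          by (rule measurable_compose[OF measurable_Pair[OF evm measurable_compose[OF idm measurable_vector_derivative_at_0]] \<phi>])
        show "AE \<gamma> in \<theta>. \<phi> (\<gamma> 0, centroid K (\<gamma> 0)) = \<phi> (\<gamma> 0, vector_derivative \<gamma> (at 0))"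
          using deriv0 eqt[of 0] by eventually_elim (simp add: vector_derivative_at)
      qed
      finally show "(\<integral>x. \<phi> (x, centroid K x) \<partial>proj_measure \<mu>) = (\<integral>\<gamma>. \<phi> (\<gamma> 0, vector_derivative \<gamma> (at 0)) \<partial>\<theta>)" .
    qed
  qed
qed

end
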